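(* The processes $(V_j)_{j\in S}=(V_j(t))_{t\ge0,j\in S}$ defined by $$V_j(t):=\sum_{n=0}^\infty\mathbf 1_{\{J^j_t=n\}}\mathcal V_{(j,n)}(t),\quad t\ge0,$$ are state-wise prospective reserves. If $(\widetilde V_j)_{j\in S}$ is another set of state-wise prospective reserves, then $(I_j\widetilde V_j)_{j\in S}$ almost surely equals $(I_jV_j)_{j\in S}$.
   Context: **Information.** Let $(\Omega,\mathbb F,P)$ be a complete probability space with null sets $\mathcal A$, and let $Z=(Z_t)_{t\ge0}$ be a pure jump process (right-continuous, piecewise constant) on a countable state space $S$. Processes are defined only up to evanescence. Put $I_j(t)=\mathbf 1_{\{Z_t=j\}}$ and, for $j\ne k$, $N_{jk}(t)=\#\{s\in(0,t]:Z_{s-}=j,Z_s=k\}$, $N_{jk}(0-)=0$. Standing assumption: $\mathrm E[\sum_{j\ne k}N_{jk}(t)]<\infty$ for all $t\ge0$. Let $\mathcal F_t=\sigma(Z_s:s\le t)\vee\mathcal A$. Let $J^j_t=\sum_{k\ne j}N_{jk}(t-)$, $J_t=\sum_{j}I_j(t)J^j_t$, $\mathcal Z=(Z,J)$ with state space $\mathcal S=S\times\mathbb N_0$ (each state of $\mathcal S$ is visited at most once). For $x\in\mathcal S$: $T_x=\inf\{t\ge0:\mathcal Z_t=x\}$ ($\inf\emptyset=\infty$), $\mathcal I_x(t)=\mathbf 1_{\{\mathcal Z_t=x\}}$, $\xi_x=(T_y\mathbf 1_{\{T_y\le T_x\}})_{y\in\mathcal S}$. Reduced, possibly non-monotone,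 information: let $E'$ be a separable completely metrizable space, and let $\zeta_x$, $x\in\mathcal S$, be $E'$-valued random variables with $\sigma(\zeta_x)\subseteq\sigma(\xi_x)$; set $\zeta_{\mathcal Z_t}=\sum_x\mathcal I_x(t)\zeta_x$, $\mathcal G_t=\sigma(\mathcal Z_t,\zeta_{\mathcal Z_t})\vee\mathcal A$ for $t\ge0$ and $\mathcal G_{t-}=\sigma(\mathcal Z_{t-},\zeta_{\mathcal Z_{t-}})\vee\mathcal A$ for $t>0$. **Payments.** $B(\mathrm dt)=\sum_{j}I_j(t-)b_j(t)\beta(\mathrm dt)+\sum_{j\ne k}b_{jk}(t)N_{jk}(\mathrm dt)$ with $\mathcal F$-predictable bounded $b_j,b_{jk}$, and $\beta=m+\sum_{n\ge1}\varepsilon_{t_n}$, where $m$ is Lebesgue measure, $\varepsilon_s$ is Dirac measure at $s$, and $0\le t_1<t_2<\dots$ are deterministic and increase to infinity. $\kappa:[0,\infty)\to(0,\infty)$ is deterministic, measurable, càdlàg, bounded away from zero, of finite variation on compacts, $\kappa(0)=1$. $Y(t)=\int_{(t,\infty)}\frac{\kappa(t)}{\kappa(s)}B(\mathrm ds)$ is assumed to have finite expected variation on compacts. The prospective reserve $V$ is the (unique up to evanescence) optional projection of $Y$ with respect to $\mathcal G$, i.e. the càdlàg finite variation process with $V(t)=\mathrm E[Y(t)|\mathcal G_t]$ almost surely for each $t\ge0$. A finite variation process is an adapted process with càdlàg paths of finite variation on compacts. **Definition.** With the convention $0/0:=0$, $\mathcal V_x(t)=\frac{\mathrm E[\mathcal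 I_x(t)Y(t)|\zeta_x]}{\mathrm E[\mathcal I_x(t)|\zeta_x]}$, $x\in\mathcal S$, $t\ge0$ (as the conditioning variable does not depend on $t$, this is a well-defined stochastic process, the conditional expectations being computed simultaneously for all $t$). **Definition.** $(V_j(t))_{t\ge0,j\in S}$ are called *state-wise prospective reserves* if for each $j\in S$: (1) $I_j(t)V_j(t)=I_j(t)V(t)$ almost surely for each $t\ge0$; (2) $I_j(t-)V_j(t)$ is $\mathcal G_{t-}$-measurable for each $t>0$; (3) the mapping $t\mapsto\int_{(0,t]}I_j(s-)V_j(\mathrm ds)$ defines a finite variation process. *)

theory Defs
  imports "HOL-Probability.Probability"
begin

text \<open>
  Time is \<^typ>\<open>real\<close>; only the values of a process at times \<open>t \<ge> 0\<close> are ever used.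
  A process is a function of time and of the sample point.  The countable state space \<open>S\<close> is a type
  of class \<^class>\<open>countable\<close>, and \<open>E'\<close> is a type of class \<^class>\<open>polish_space\<close>.
\<close>

section \<open>Paths\<close>

definition cadlag :: "(real \<Rightarrow> real) \<Rightarrow> bool" where
  "cadlag f \<longleftrightarrow>
     (\<forall>t\<ge>0. (f \<longlongrightarrow> f t) (at_right t)) \<and> (\<forall>t>0. \<exists>l. (f \<longlongrightarrow> l) (at_left t))"

definition variation :: "(real \<Rightarrow> real) \<Rightarrow> real \<Rightarrow> real \<Rightarrow> ennreal" where
  "variation f a b =
     (SUP xs \<in> {xs. sorted xs \<and> set xs \<subseteq> {a..b}}.
        \<Sum>i<length xs - 1. ennreal \<bar>f (xs ! Suc i) - f (xs ! i)\<bar>)"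

definition fv_on_compacts :: "(real \<Rightarrow> real) \<Rightarrow> bool" where
  "fv_on_compacts f \<longleftrightarrow> (\<forall>t\<ge>0. variation f 0 t < \<infinity>)"

text \<open>
  Cadlag with respect to the discrete topology.  By compactness this means right-continuous and
  piecewise constant with finitely many jumps on every compact interval.
\<close>

definition pure_jump_path :: "(real \<Rightarrow> 's) \<Rightarrow> bool" where
  "pure_jump_path z \<longleftrightarrow>
     (\<forall>t\<ge>0. eventually (\<lambda>s. z s = z t) (at_right t)) \<and>
     (\<forall>t>0. \<exists>j. eventually (\<lambda>s. z s = j) (at_left t))"

text \<open>The left limit \<open>z(t-)\<close> in the discrete topology.\<close>

definition left_val :: "(real \<Rightarrow> 's) \<Rightarrow> real \<Rightarrow> 's" where
  "left_val z t = (THE j. eventually (\<lambda>s. z s = j) (at_left t))"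

text \<open>
  Lebesgue-Stieltjes integral of \<open>f\<close> with respect to \<open>F\<close> over the Borel set \<open>A\<close>.  The integrator only
  has to generate a signed measure \<open>\<mu> - \<nu>\<close> on the part of \<open>A\<close> where \<open>f\<close> does not vanish.  In all
  uses here this part is a countable union of intervals \<open>(c,d]\<close>, so that the value does not depend
  on the choice of \<open>\<mu>\<close> and \<open>\<nu>\<close>.  The restriction matters for \<open>\<integral> I\<^sub>j(s-) V\<^sub>j(ds)\<close>, because a state-wise
  reserve can be arbitrarily irregular while \<open>Z\<close> is not in state \<open>j\<close>.
\<close>

definition has_LS_integral ::
  "(real \<Rightarrow> real) \<Rightarrow> (real \<Rightarrow> real) \<Rightarrow> real set \<Rightarrow> real \<Rightarrow> bool" where
  "has_LS_integral f F A y \<longleftrightarrow>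
     (\<exists>\<mu> \<nu>. sets \<mu> = sets borel \<and> sets \<nu> = sets borel \<and>
        (\<forall>c d. c < d \<longrightarrow> {c<..d} \<subseteq> {s \<in> A. f s \<noteq> 0} \<longrightarrow>
           emeasure \<mu> {c<..d} < \<infinity> \<and> emeasure \<nu> {c<..d} < \<infinity> \<and>
           F d - F c = measure \<mu> {c<..d} - measure \<nu> {c<..d}) \<and>
        set_integrable \<mu> A f \<and> set_integrable \<nu> A f \<and>
        y = (LINT s:A|\<mu>. f s) - (LINT s:A|\<nu>. f s))"


section \<open>Information\<close>

definition augment :: "'a measure \<Rightarrow> 'a measure \<Rightarrow> 'a measure" where
  "augment M F = sigma (space M) (sets F \<union> null_sets M)"

definition full_info :: "'a measure \<Rightarrow> (real \<Rightarrow> 'a \<Rightarrow> 's) \<Rightarrow> real \<Rightarrow> 'a measure" where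
  "full_info M Z t =
     augment M (sigma (space M) {Z s -` A \<inter> space M | s A. 0 \<le> s \<and> s \<le> t})"

definition predictable_algebra :: "'a measure \<Rightarrow> (real \<Rightarrow> 'a measure) \<Rightarrow> (real \<times> 'a) measure" where
  "predictable_algebra M F =
     sigma ({0..} \<times> space M)
       ({{0} \<times> A | A. A \<in> sets (F 0)} \<union> {{s<..t} \<times> A | s t A. 0 \<le> s \<and> s < t \<and> A \<in> sets (F s)})"

definition predictable ::
  "'a measure \<Rightarrow> (real \<Rightarrow> 'a measure) \<Rightarrow> (real \<Rightarrow> 'a \<Rightarrow> real) \<Rightarrow> bool" where
  "predictable M F b \<longleftrightarrow> (\<lambda>(t, \<omega>). b t \<omega>) \<in> borel_measurable (predictable_algebra M F)"

definition bounded_process :: "'a measure \<Rightarrow> (real \<Rightarrow> 'a \<Rightarrow> real) \<Rightarrow> bool" where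
  "bounded_process M b \<longleftrightarrow> (\<exists>C. \<forall>t\<ge>0. \<forall>\<omega>\<in>space M. \<bar>b t \<omega>\<bar> \<le> C)"

definition fv_process ::
  "'a measure \<Rightarrow> (real \<Rightarrow> 'a measure) \<Rightarrow> (real \<Rightarrow> 'a \<Rightarrow> real) \<Rightarrow> bool" where
  "fv_process M F X \<longleftrightarrow>
     (\<forall>t\<ge>0. X t \<in> borel_measurable (F t)) \<and>
     (AE \<omega> in M. cadlag (\<lambda>t. X t \<omega>) \<and> fv_on_compacts (\<lambda>t. X t \<omega>))"

definition jump_count ::
  "(real \<Rightarrow> 'a \<Rightarrow> 's) \<Rightarrow> 's \<Rightarrow> 's \<Rightarrow> real \<Rightarrow> 'a \<Rightarrow> nat" where
  "jump_count Z j k t \<omega> = card {s. 0 < s \<and> s \<le> t \<and> left_val (\<lambda>u. Z u \<omega>) s = j \<and> Z s \<omega> = k}"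

definition jump_count_left ::
  "(real \<Rightarrow> 'a \<Rightarrow> 's) \<Rightarrow> 's \<Rightarrow> 's \<Rightarrow> real \<Rightarrow> 'a \<Rightarrow> nat" where
  "jump_count_left Z j k t \<omega> = (if t \<le> 0 then 0 else left_val (\<lambda>u. jump_count Z j k u \<omega>) t)"

text \<open>\<open>J\<^sup>j\<^sub>t\<close>, \<open>J\<^sub>t\<close> and \<open>(Z\<^sub>t, J\<^sub>t)\<close>; only finitely many terms of each sum are nonzero.\<close>

definition exits_before :: "(real \<Rightarrow> 'a \<Rightarrow> 's) \<Rightarrow> 's \<Rightarrow> real \<Rightarrow> 'a \<Rightarrow> nat" where
  "exits_before Z j t \<omega> = (\<Sum>\<^sub>\<infinity>k\<in>{k. k \<noteq> j}. jump_count_left Z j k t \<omega>)"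

definition visit_number :: "(real \<Rightarrow> 'a \<Rightarrow> 's) \<Rightarrow> real \<Rightarrow> 'a \<Rightarrow> nat" where
  "visit_number Z t \<omega> = (\<Sum>\<^sub>\<infinity>j. of_bool (Z t \<omega> = j) * exits_before Z j t \<omega>)"

definition ZJ :: "(real \<Rightarrow> 'a \<Rightarrow> 's) \<Rightarrow> real \<Rightarrow> 'a \<Rightarrow> 's \<times> nat" where
  "ZJ Z t \<omega> = (Z t \<omega>, visit_number Z t \<omega>)"

definition ZJ_left :: "(real \<Rightarrow> 'a \<Rightarrow> 's) \<Rightarrow> real \<Rightarrow> 'a \<Rightarrow> 's \<times> nat" where
  "ZJ_left Z t \<omega> = left_val (\<lambda>s. ZJ Z s \<omega>) t"

definition entry_time :: "(real \<Rightarrow> 'a \<Rightarrow> 's) \<Rightarrow> 's \<times> nat \<Rightarrow> 'a \<Rightarrow> ereal" where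
  "entry_time Z x \<omega> = Inf {ereal t | t. 0 \<le> t \<and> ZJ Z t \<omega> = x}"

definition history_at_entry ::
  "(real \<Rightarrow> 'a \<Rightarrow> 's) \<Rightarrow> 's \<times> nat \<Rightarrow> 'a \<Rightarrow> ('s \<times> nat \<Rightarrow> ereal)" where
  "history_at_entry Z x \<omega> =
     (\<lambda>y. if entry_time Z y \<omega> \<le> entry_time Z x \<omega> then entry_time Z y \<omega> else 0)"

definition sigma_history ::
  "'a measure \<Rightarrow> (real \<Rightarrow> 'a \<Rightarrow> 's) \<Rightarrow> 's \<times> nat \<Rightarrow> 'a measure" where
  "sigma_history M Z x =
     vimage_algebra (space M) (history_at_entry Z x) (Pi\<^sub>M UNIV (\<lambda>_. borel))"

definition sigma_info :: "'a measure \<Rightarrow> ('a \<Rightarrow> 'e::topological_space) \<Rightarrow> 'a measure" where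
  "sigma_info M \<zeta> = vimage_algebra (space M) \<zeta> borel"

text \<open>
  In \<open>\<zeta>\<close> at \<open>(Z\<^sub>t, J\<^sub>t)\<close>, the sum \<open>\<Sum>\<^sub>x 1{(Z\<^sub>t, J\<^sub>t) = x} \<zeta>\<^sub>x\<close> just selects the component of \<open>\<zeta>\<close> with
  the current index, so no addition on \<open>E'\<close> is involved.
\<close>

definition reduced_info ::
  "'a measure \<Rightarrow> (real \<Rightarrow> 'a \<Rightarrow> 's) \<Rightarrow> ('s \<times> nat \<Rightarrow> 'a \<Rightarrow> 'e::topological_space) \<Rightarrow> real \<Rightarrow> 'a measure" where
  "reduced_info M Z \<zeta> t =
     augment M (vimage_algebra (space M) (\<lambda>\<omega>. (ZJ Z t \<omega>, \<zeta> (ZJ Z t \<omega>) \<omega>))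
       (count_space UNIV \<Otimes>\<^sub>M borel))"

definition reduced_info_left ::
  "'a measure \<Rightarrow> (real \<Rightarrow> 'a \<Rightarrow> 's) \<Rightarrow> ('s \<times> nat \<Rightarrow> 'a \<Rightarrow> 'e::topological_space) \<Rightarrow> real \<Rightarrow> 'a measure" where
  "reduced_info_left M Z \<zeta> t =
     augment M (vimage_algebra (space M) (\<lambda>\<omega>. (ZJ_left Z t \<omega>, \<zeta> (ZJ_left Z t \<omega>) \<omega>))
       (count_space UNIV \<Otimes>\<^sub>M borel))"


section \<open>Payments\<close>

text \<open>The times \<open>t\<^sub>n\<close>, \<open>n \<ge> 1\<close>, are \<^term>\<open>\<tau> (n - 1)\<close>.\<close>

definition payment_clock :: "(nat \<Rightarrow> real) \<Rightarrow> real measure" where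
  "payment_clock \<tau> =
     measure_of UNIV (sets borel) (\<lambda>A. emeasure lborel (A \<inter> {0..}) + (\<Sum>n. indicator A (\<tau> n)))"

text \<open>
  \<open>B((0,t])\<close>.  A possible payment at time 0 is irrelevant, since \<open>Y(t)\<close> only involves \<open>B\<close> on \<open>(t,\<infinity>)\<close>.
\<close>

definition cumulative_payments ::
  "(real \<Rightarrow> 'a \<Rightarrow> 's) \<Rightarrow> (nat \<Rightarrow> real) \<Rightarrow> ('s \<Rightarrow> real \<Rightarrow> 'a \<Rightarrow> real) \<Rightarrow>
   ('s \<Rightarrow> 's \<Rightarrow> real \<Rightarrow> 'a \<Rightarrow> real) \<Rightarrow> real \<Rightarrow> 'a \<Rightarrow> real" where
  "cumulative_payments Z \<tau> b c t \<omega> =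
     (LINT s:{0<..t}|payment_clock \<tau>.
        (\<Sum>\<^sub>\<infinity>j. of_bool (left_val (\<lambda>u. Z u \<omega>) s = j) * b j s \<omega>)) +
     (\<Sum>\<^sub>\<infinity>(j, k)\<in>{(j, k). j \<noteq> k}.
        LINT s:{0<..t}|interval_measure (\<lambda>u. real (jump_count Z j k u \<omega>)). c j k s \<omega>)"

definition discounted_future_payments ::
  "'a measure \<Rightarrow> (real \<Rightarrow> real) \<Rightarrow> (real \<Rightarrow> 'a \<Rightarrow> real) \<Rightarrow> (real \<Rightarrow> 'a \<Rightarrow> real) \<Rightarrow> bool" where
  "discounted_future_payments M \<kappa> B Y \<longleftrightarrow>
     (AE \<omega> in M. \<forall>t\<ge>0. has_LS_integral (\<lambda>s. \<kappa> t / \<kappa> s) (\<lambda>s. B s \<omega>) {t<..} (Y t \<omega>))"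

text \<open>
  Finite expected variation on compacts, where the value at time 0 counts as a jump from 0:
  the conditional expectations defining the reserve require \<open>Y(t)\<close> to be integrable.
\<close>

definition finite_expected_variation :: "'a measure \<Rightarrow> (real \<Rightarrow> 'a \<Rightarrow> real) \<Rightarrow> bool" where
  "finite_expected_variation M Y \<longleftrightarrow>
     (\<forall>t\<ge>0. integrable M (Y t)) \<and>
     (\<forall>t\<ge>0. (\<integral>\<^sup>+\<omega>. variation (\<lambda>s. Y s \<omega>) 0 t \<partial>M) < \<infinity>)"


section \<open>Reserves\<close>

text \<open>
  \<open>G\<close> need not be monotone; adaptedness refers to the full information \<open>F\<close>.  Measurability of
  \<open>V(t)\<close> with respect to the augmented \<open>G\<^sub>t\<close> is implied by the second condition.
\<close>

definition prospective_reserve ::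
  "'a measure \<Rightarrow> (real \<Rightarrow> 'a \<Rightarrow> 's) \<Rightarrow> ('s \<times> nat \<Rightarrow> 'a \<Rightarrow> 'e::topological_space) \<Rightarrow>
   (real \<Rightarrow> 'a \<Rightarrow> real) \<Rightarrow> (real \<Rightarrow> 'a \<Rightarrow> real) \<Rightarrow> bool" where
  "prospective_reserve M Z \<zeta> Y V \<longleftrightarrow>
     fv_process M (full_info M Z) V \<and>
     (\<forall>t\<ge>0. AE \<omega> in M. V t \<omega> = real_cond_exp M (reduced_info M Z \<zeta> t) (Y t) \<omega>)"

text \<open>
  The process \<open>t \<mapsto> E[X(t)|F]\<close> for a fixed \<open>\<sigma>\<close>-algebra \<open>F\<close>, computed simultaneously for all \<open>t\<close>.  If
  \<open>X\<close> is cadlag with an integrable supremum on compacts, integrating \<open>X(t)\<close> against a regular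
  conditional distribution of the whole path gives such a process, with cadlag paths by dominated
  convergence.  Conversely the cadlag property fixes \<open>C\<close> up to evanescence, so the choice below is
  immaterial.
\<close>

definition is_cond_exp_process ::
  "'a measure \<Rightarrow> 'a measure \<Rightarrow> (real \<Rightarrow> 'a \<Rightarrow> real) \<Rightarrow> (real \<Rightarrow> 'a \<Rightarrow> real) \<Rightarrow> bool" where
  "is_cond_exp_process M F X C \<longleftrightarrow>
     (\<forall>t\<ge>0. C t \<in> borel_measurable F \<and> (AE \<omega> in M. C t \<omega> = real_cond_exp M F (X t) \<omega>)) \<and>
     (AE \<omega> in M. cadlag (\<lambda>t. C t \<omega>))"

definition cond_exp_process ::
  "'a measure \<Rightarrow> 'a measure \<Rightarrow> (real \<Rightarrow> 'a \<Rightarrow> real) \<Rightarrow> real \<Rightarrow> 'a \<Rightarrow> real" where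
  "cond_exp_process M F X = (SOME C. is_cond_exp_process M F X C)"

text \<open>The convention \<open>0/0 = 0\<close> is that of HOL division.\<close>

definition sojourn_reserve ::
  "'a measure \<Rightarrow> (real \<Rightarrow> 'a \<Rightarrow> 's) \<Rightarrow> ('s \<times> nat \<Rightarrow> 'a \<Rightarrow> 'e::topological_space) \<Rightarrow>
   (real \<Rightarrow> 'a \<Rightarrow> real) \<Rightarrow> 's \<times> nat \<Rightarrow> real \<Rightarrow> 'a \<Rightarrow> real" where
  "sojourn_reserve M Z \<zeta> Y x t \<omega> =
     cond_exp_process M (sigma_info M (\<zeta> x)) (\<lambda>t \<omega>. of_bool (ZJ Z t \<omega> = x) * Y t \<omega>) t \<omega> /
     cond_exp_process M (sigma_info M (\<zeta> x)) (\<lambda>t \<omega>. of_bool (ZJ Z t \<omega> = x)) t \<omega>"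

definition state_reserve ::
  "'a measure \<Rightarrow> (real \<Rightarrow> 'a \<Rightarrow> 's) \<Rightarrow> ('s \<times> nat \<Rightarrow> 'a \<Rightarrow> 'e::topological_space) \<Rightarrow>
   (real \<Rightarrow> 'a \<Rightarrow> real) \<Rightarrow> 's \<Rightarrow> real \<Rightarrow> 'a \<Rightarrow> real" where
  "state_reserve M Z \<zeta> Y j t \<omega> =
     (\<Sum>n. of_bool (exits_before Z j t \<omega> = n) * sojourn_reserve M Z \<zeta> Y (j, n) t \<omega>)"

definition state_wise_prospective_reserves ::
  "'a measure \<Rightarrow> (real \<Rightarrow> 'a \<Rightarrow> 's) \<Rightarrow> ('s \<times> nat \<Rightarrow> 'a \<Rightarrow> 'e::topological_space) \<Rightarrow>
   (real \<Rightarrow> 'a \<Rightarrow> real) \<Rightarrow> ('s \<Rightarrow> real \<Rightarrow> 'a \<Rightarrow> real) \<Rightarrow> bool" where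
  "state_wise_prospective_reserves M Z \<zeta> V W \<longleftrightarrow>
     (\<forall>j.
       (\<forall>t\<ge>0. W j t \<in> borel_measurable M) \<and>
       (\<forall>t\<ge>0. AE \<omega> in M. of_bool (Z t \<omega> = j) * W j t \<omega> = of_bool (Z t \<omega> = j) * V t \<omega>) \<and>
       (\<forall>t>0. (\<lambda>\<omega>. of_bool (left_val (\<lambda>u. Z u \<omega>) t = j) * W j t \<omega>)
                \<in> borel_measurable (reduced_info_left M Z \<zeta> t)) \<and>
       (\<exists>X. fv_process M (full_info M Z) X \<and>
         (AE \<omega> in M. \<forall>t\<ge>0.
            has_LS_integral (\<lambda>s. of_bool (left_val (\<lambda>u. Z u \<omega>) s = j)) (\<lambda>s. W j s \<omega>)
              {0<..t} (X t \<omega>))))"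

end

theory Submission
  imports Defs
begin

text \<open>
  Write \<open>I\<^sub>x(t)\<close> for the indicator of \<open>(Z\<^sub>t, J\<^sub>t) = x\<close>, \<open>N\<^sub>x(t) = E[I\<^sub>x(t) Y(t) | \<zeta>\<^sub>x]\<close> and
  \<open>D\<^sub>x(t) = E[I\<^sub>x(t) | \<zeta>\<^sub>x]\<close>.  The process \<open>(Z, J)\<close> occupies each state \<open>x = (j, n)\<close> on a single
  interval, and there \<open>V\<^sub>j\<close> is the quotient \<open>N\<^sub>x / D\<^sub>x\<close>.  So the theorem is about one quotient of two
  conditional expectations during one visit.

  \<^item> On the event \<open>(Z\<^sub>t, J\<^sub>t) = x\<close> the information at time \<open>t\<close> has the same traces as \<open>\<sigma>(\<zeta>\<^sub>x)\<close>.  Hence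
    \<open>E[Y(t) | G\<^sub>t] = N\<^sub>x(t) / D\<^sub>x(t)\<close> there (\<open>res_on_visit\<close>), which is the first property.  The second one
    is the same trace argument at \<open>t-\<close>, because \<open>J\<close> counts the exits strictly before \<open>t\<close>.

  \<^item> \<open>N\<^sub>x\<close> and \<open>D\<^sub>x\<close> exist as processes because \<open>I\<^sub>x Y\<close> and \<open>I\<^sub>x\<close> are differences of increasing integrable
    processes.  Conditioning preserves the monotonicity along the rationals, and right limits along the
    rationals then define the processes at all times at once (\<open>cond_exp_process_exists\<close>).  This also
    yields an increasing right-continuous function that dominates all increments, that is, cadlag paths
    of finite variation.

  \<^item> For the quotient, \<open>D\<^sub>x\<close> has to stay away from zero during the visit of \<open>x\<close>, although \<open>\<zeta>\<^sub>x\<close> neither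
    determines the end of the visit nor, in general, its beginning.  The reason is a fact on nested
    events: for a countable chain of events \<open>A\<^sub>i\<close>, almost surely the probabilities \<open>P(A\<^sub>i | G)\<close> of those
    \<open>A\<^sub>i\<close> that occur are bounded away from zero (\<open>chain_cond_exp_pos\<close>).  For fixed \<open>r\<close> the events
    \<open>(Z\<^sub>s, J\<^sub>s) = (Z\<^sub>r, J\<^sub>r) = x\<close> form a chain in \<open>s \<le> r\<close> and another one in \<open>s \<ge> r\<close>.

  \<^item> The integral of \<open>I\<^sub>j(s-)\<close> against \<open>V\<^sub>j\<close> is the sum over the visits of \<open>N\<^sub>x / D\<^sub>x\<close> at the exit (or now)
    minus \<open>N\<^sub>x / D\<^sub>x\<close> at the entry.  It is adapted because \<open>\<zeta>\<^sub>x\<close> is known as soon as \<open>x\<close> has been entered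
    (\<open>history_trace\<close>).  At the exit \<open>D\<^sub>x\<close> may vanish and the quotient may fail to be right-continuous, so
    the values of \<open>N\<^sub>x\<close> and \<open>D\<^sub>x\<close> at the random times are approximated on dyadic grids separately.

  \<^item> Uniqueness: by the third property the increments of a state-wise reserve during a stay in \<open>j\<close> are
    given by measures, so the reserve is right-continuous there, and it is determined by its values at
    rational times, which the first property prescribes.
\<close>

section \<open>Pure jump paths and the numbering of visits\<close>

lemma left_val_eqI:
  fixes t :: real
  assumes "eventually (\<lambda>s. z s = j) (at_left t)"
  shows "left_val z t = j"
  unfolding left_val_def
proof (rule the_equality)
  fix k assume "eventually (\<lambda>s. z s = k) (at_left t)"
  with assms have "eventually (\<lambda>s. j = k) (at_left t)"
    by eventually_elim simp
  then show "k = j" by simp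
qed (fact assms)

lemma left_val_const:
  fixes s u :: real
  assumes "s < u" "\<And>r. s < r \<Longrightarrow> r < u \<Longrightarrow> z r = j"
  shows "left_val z u = j"
  by (rule left_val_eqI) (use assms in \<open>auto simp: eventually_at_left_field\<close>)

lemma pure_jump_right:
  assumes "pure_jump_path z" "0 \<le> t"
  obtains e where "t < e" "\<And>s. t \<le> s \<Longrightarrow> s < e \<Longrightarrow> z s = z t"
proof -
  have "eventually (\<lambda>s. z s = z t) (at_right t)"
    using assms by (auto simp: pure_jump_path_def)
  then obtain e where "t < e" "\<forall>s>t. s < e \<longrightarrow> z s = z t"
    by (auto simp: eventually_at_right_field)
  then show ?thesis by (intro that[of e]) (auto simp: le_less)
qed

lemma pure_jump_left:
  assumes "pure_jump_path z" "0 < t"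
  obtains e where "0 \<le> e" "e < t" "\<And>s. e < s \<Longrightarrow> s < t \<Longrightarrow> z s = left_val z t"
proof -
  obtain j where j: "eventually (\<lambda>s. z s = j) (at_left t)"
    using assms by (auto simp: pure_jump_path_def)
  then have "left_val z t = j" by (rule left_val_eqI)
  moreover from j obtain e where "e < t" "\<forall>s>e. s < t \<longrightarrow> z s = j"
    by (auto simp: eventually_at_left_field)
  ultimately show ?thesis using assms(2) by (intro that[of "max 0 e"]) auto
qed

text \<open>
  Induction along the path: the supremum of the times that have been reached is itself reached, because
  the path is constant just before it, and it is passed, because the path is constant just after it.
  This replaces an enumeration of the jump times.
\<close>

lemma pure_jump_induct:
  fixes t :: real
  assumes z: "pure_jump_path z" and t: "0 \<le> t"
    and base: "P 0"
    and step: "\<And>s u. 0 \<le> s \<Longrightarrow> s < u \<Longrightarrow> P s \<Longrightarrow> (\<And>r. s \<le> r \<Longrightarrow> r < u \<Longrightarrow> z r = z s) \<Longrightarrow> P u"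
  shows "P t"
proof -
  define K where "K = {u. 0 \<le> u \<and> u \<le> t \<and> P u}"
  have K0: "0 \<in> K" using base t by (auto simp: K_def)
  have bdd: "bdd_above K" by (auto simp: K_def intro!: bdd_aboveI[of _ t])
  define w where "w = Sup K"
  have w: "0 \<le> w" "w \<le> t"
  proof -
    show "0 \<le> w" using cSup_upper[OF K0 bdd] by (simp add: w_def)
    show "w \<le> t" unfolding w_def by (rule cSup_least) (use K0 in \<open>auto simp: K_def\<close>)
  qed
  have Pw: "P w"
  proof (rule ccontr)
    assume nP: "\<not> P w"
    with base w have "0 < w" by (cases "w = 0") auto
    then obtain e where e: "e < w" "0 \<le> e" "\<And>s. e < s \<Longrightarrow> s < w \<Longrightarrow> z s = left_val z w"
      using pure_jump_left[OF z] by metis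
    obtain s where s: "s \<in> K" "e < s"
      using e(1) less_cSup_iff[OF _ bdd] K0 by (auto simp: w_def)
    have "s \<le> w" using cSup_upper[OF s(1) bdd] by (simp add: w_def)
    moreover have "s \<noteq> w" using s nP by (auto simp: K_def)
    ultimately have "s < w" by simp
    moreover have "0 \<le> s" "P s" using s by (auto simp: K_def)
    moreover have "z r = z s" if "s \<le> r" "r < w" for r
      using e(3)[of r] e(3)[of s] s that \<open>s < w\<close> by auto
    ultimately have "P w" using step[of s w] by blast
    with nP show False ..
  qed
  have "\<not> w < t"
  proof
    assume "w < t"
    obtain e where e: "w < e" "\<And>s. w \<le> s \<Longrightarrow> s < e \<Longrightarrow> z s = z w"
      using pure_jump_right[OF z w(1)] by metis
    define u where "u = min e t"
    have "w < u" using e(1) \<open>w < t\<close> by (auto simp: u_def)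
    moreover have "P u"
      
    proof (rule step[OF w(1) \<open>w < u\<close> Pw])
      fix r assume "w \<le> r" "r < u"
      then show "z r = z w" by (intro e(2)) (simp_all add: u_def)
    qed
    moreover have "u \<le> t" by (simp add: u_def)
    ultimately have "u \<in> K" using w by (auto simp: K_def)
    from cSup_upper[OF this bdd] \<open>w < u\<close> show False by (simp add: w_def)
  qed
  with Pw w show ?thesis by simp
qed

definition exit_times :: "(real \<Rightarrow> 's) \<Rightarrow> 's \<Rightarrow> real set" where
  "exit_times z j = {s. 0 < s \<and> left_val z s = j \<and> z s \<noteq> j}"

lemma exit_times_stay:
  assumes "0 \<le> s" "\<And>r. s \<le> r \<Longrightarrow> r < u \<Longrightarrow> z r = k" "r \<in> exit_times z j" "s \<le> r" "r < u"
  shows "r = s"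
proof (rule ccontr)
  assume "r \<noteq> s"
  then have "left_val z r = k"
    using assms by (intro left_val_const[of s]) auto
  moreover have "z r = k" using assms by auto
  ultimately show False using assms(3) by (auto simp: exit_times_def)
qed

lemma finite_exit_times:
  assumes z: "pure_jump_path z"
  shows "finite (exit_times z j \<inter> {..t})"
proof (cases "0 \<le> t")
  case True
  from z True show ?thesis
  proof (induction t rule: pure_jump_induct[consumes 2])
    case 1
    have "exit_times z j \<inter> {..0} = {}" by (auto simp: exit_times_def)
    then show ?case by simp
  next
    case (2 s u)
    have "exit_times z j \<inter> {..u} \<subseteq> insert u (exit_times z j \<inter> {..s})"
    proof
      fix r assume r: "r \<in> exit_times z j \<inter> {..u}"
      have "r \<le> s" if "r \<noteq> u"
      proof (rule ccontr)
        assume "\<not> r \<le> s"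
        with r that have "r \<in> exit_times z j" "s \<le> r" "r < u" "r \<noteq> s" by auto
        moreover have "r = s"
        proof (rule exit_times_stay[of s u z "z s" r j])
          show "z v = z s" if "s \<le> v" "v < u" for v using that by (rule 2(3))
        qed (fact 2(1), fact+)
        ultimately show False by simp
      qed
      with r show "r \<in> insert u (exit_times z j \<inter> {..s})" by auto
    qed
    then show ?case using 2(4) finite_subset by blast
  qed
next
  case False
  then have "exit_times z j \<inter> {..t} = {}" by (auto simp: exit_times_def)
  then show ?thesis by simp
qed

lemma finite_exit_times': "pure_jump_path z \<Longrightarrow> finite (exit_times z j \<inter> {..<t})"
  by (rule finite_subset[OF _ finite_exit_times[of z j t]]) auto

definition exit_count :: "(real \<Rightarrow> 's) \<Rightarrow> 's \<Rightarrow> real \<Rightarrow> nat" where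
  "exit_count z j t = card (exit_times z j \<inter> {..<t})"

lemma exit_count_mono: "pure_jump_path z \<Longrightarrow> s \<le> t \<Longrightarrow> exit_count z j s \<le> exit_count z j t"
  unfolding exit_count_def by (intro card_mono finite_exit_times') auto

lemma exit_count_Suc_le:
  assumes z: "pure_jump_path z" and r: "r \<in> exit_times z j" "s \<le> r" "r < u"
  shows "Suc (exit_count z j s) \<le> exit_count z j u"
proof -
  have "exit_times z j \<inter> {..<s} \<subseteq> exit_times z j \<inter> {..<u}"
    "r \<in> exit_times z j \<inter> {..<u}" "r \<notin> exit_times z j \<inter> {..<s}"
    using r by auto
  then have "exit_times z j \<inter> {..<s} \<subset> exit_times z j \<inter> {..<u}" by blast
  from psubset_card_mono[OF finite_exit_times'[OF z] this] show ?thesis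
    by (simp add: exit_count_def)
qed

lemma exit_count_eqD:
  assumes "pure_jump_path z" "exit_count z j s = exit_count z j u" "s \<le> r" "r < u"
  shows "r \<notin> exit_times z j"
  using exit_count_Suc_le[OF assms(1) _ assms(3,4), of j] assms(2) by auto

lemma exit_count_stay:
  assumes "0 \<le> s" "\<And>r. s \<le> r \<Longrightarrow> r < u \<Longrightarrow> z r = j" "s \<le> r" "r \<le> u"
  shows "exit_count z j r = exit_count z j s"
proof -
  have "v < s" if v: "v \<in> exit_times z j" "v < r" for v
  proof (rule ccontr)
    assume "\<not> v < s"
    then have "z v = j" using assms v by auto
    with v show False by (auto simp: exit_times_def)
  qed
  then have "exit_times z j \<inter> {..<r} = exit_times z j \<inter> {..<s}" using assms(3) by fastforce
  then show ?thesis by (simp add: exit_count_def)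
qed

text \<open>
  At the infimum of the times after \<open>s\<close> with the path outside \<open>j\<close>, right-continuity puts the path
  outside \<open>j\<close> already, so that this time is an exit.
\<close>

lemma no_exit_stay:
  assumes z: "pure_jump_path z" and "0 \<le> s" "z s = j" 
    and no: "\<And>v. s < v \<Longrightarrow> v < u \<Longrightarrow> v \<notin> exit_times z j"
    and r: "s \<le> r" "r < u"
  shows "z r = j"
proof (rule ccontr)
  assume nr: "z r \<noteq> j"
  define K where "K = {v. s \<le> v \<and> z v \<noteq> j}"
  have rK: "r \<in> K" using nr r by (auto simp: K_def)
  have bdd: "bdd_below K" by (auto simp: K_def intro!: bdd_belowI[of _ s])
  define w where "w = Inf K"
  have w: "s \<le> w" "w \<le> r"
  proof -
    show "w \<le> r" using cInf_lower[OF rK bdd] by (simp add: w_def)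
    show "s \<le> w" unfolding w_def by (rule cInf_greatest) (use rK in \<open>auto simp: K_def\<close>)
  qed
  have before: "z v = j" if "s \<le> v" "v < w" for v
    using that cInf_lower[OF _ bdd, of v] by (force simp: w_def K_def)
  have "z w \<noteq> j"
  proof
    assume "z w = j"
    obtain e where e: "w < e" "\<And>v. w \<le> v \<Longrightarrow> v < e \<Longrightarrow> z v = z w"
      using pure_jump_right[OF z] w \<open>0 \<le> s\<close> by (metis order_trans)
    obtain v where v: "v \<in> K" "v < e"
      using e(1) cInf_less_iff[OF _ bdd] rK by (auto simp: w_def)
    have "w \<le> v" using cInf_lower[OF v(1) bdd] by (simp add: w_def)
    with e v \<open>z w = j\<close> show False by (auto simp: K_def)
  qed
  with \<open>z s = j\<close> w have "s < w" by (cases "s = w") auto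
  then have "left_val z w = j"
    using before by (intro left_val_const[of s]) auto
  with \<open>z w \<noteq> j\<close> \<open>s < w\<close> \<open>0 \<le> s\<close> have "w \<in> exit_times z j" by (auto simp: exit_times_def)
  with no[of w] \<open>s < w\<close> w r show False by auto
qed

text \<open>
  This is \<open>(Z\<^sub>t, J\<^sub>t)\<close> on a fixed path (\<open>ZJ_eq_numbered\<close>).
\<close>

definition numbered :: "(real \<Rightarrow> 's) \<Rightarrow> real \<Rightarrow> 's \<times> nat" where
  "numbered z t = (z t, exit_count z (z t) t)"

definition single_visits :: "(real \<Rightarrow> 'x) \<Rightarrow> bool" where
  "single_visits y \<longleftrightarrow> (\<forall>s t u. 0 \<le> s \<longrightarrow> s \<le> t \<longrightarrow> t \<le> u \<longrightarrow> y s = y u \<longrightarrow> y t = y s)"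

lemma single_visitsD: "single_visits y \<Longrightarrow> 0 \<le> s \<Longrightarrow> s \<le> t \<Longrightarrow> t \<le> u \<Longrightarrow> y s = x \<Longrightarrow> y u = x \<Longrightarrow> y t = x"
  unfolding single_visits_def by metis

lemma numbered_stay:
  assumes "0 \<le> s" "\<And>r. s \<le> r \<Longrightarrow> r < u \<Longrightarrow> z r = z s" "s \<le> r" "r < u"
  shows "numbered z r = numbered z s"
proof -
  have "z r = z s" using assms by blast
  moreover have "exit_count z (z s) r = exit_count z (z s) s"
    by (rule exit_count_stay[OF assms(1) assms(2) assms(3) less_imp_le[OF assms(4)]])
  ultimately show ?thesis by (simp add: numbered_def)
qed

lemma numbered_left_aux:
  assumes z: "pure_jump_path z" and t: "0 < t"
  obtains e where "0 \<le> e" "e < t"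
    "\<And>s. e < s \<Longrightarrow> s < t \<Longrightarrow> numbered z s = (left_val z t, exit_count z (left_val z t) t)"
proof -
  obtain e where e: "0 \<le> e" "e < t" "\<And>s. e < s \<Longrightarrow> s < t \<Longrightarrow> z s = left_val z t"
    using pure_jump_left[OF z t] by metis
  have "numbered z s = (left_val z t, exit_count z (left_val z t) t)" if "e < s" "s < t" for s
    using exit_count_stay[of s t z "left_val z t" t] e that by (auto simp: numbered_def)
  with e show ?thesis using that by blast
qed

text \<open>
  The exits are counted strictly before \<open>t\<close>, so the count for the state that is left at \<open>t\<close> does not
  change at \<open>t\<close>.
\<close>

lemma left_val_numbered:
  assumes "pure_jump_path z" "0 < t"
  shows "left_val (numbered z) t = (left_val z t, exit_count z (left_val z t) t)"
proof -
  obtain e where e: "0 \<le> e" "e < t"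
    "\<And>s. e < s \<Longrightarrow> s < t \<Longrightarrow> numbered z s = (left_val z t, exit_count z (left_val z t) t)"
    using numbered_left_aux[OF assms] by metis
  then show ?thesis by (intro left_val_const[of e]) auto
qed

lemma pure_jump_numbered:
  assumes z: "pure_jump_path z"
  shows "pure_jump_path (numbered z)"
  unfolding pure_jump_path_def
proof (intro conjI allI impI)
  fix t :: real assume "0 \<le> t"
  obtain e where e: "t < e" "\<And>s. t \<le> s \<Longrightarrow> s < e \<Longrightarrow> z s = z t"
    using pure_jump_right[OF z \<open>0 \<le> t\<close>] by metis
  then show "eventually (\<lambda>s. numbered z s = numbered z t) (at_right t)"
    using numbered_stay[of t e z] \<open>0 \<le> t\<close> unfolding eventually_at_right_field by (metis less_imp_le)
next
  fix t :: real assume "0 < t"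
  from numbered_left_aux[OF z this]
  show "\<exists>j. eventually (\<lambda>s. numbered z s = j) (at_left t)"
    unfolding eventually_at_left_field by metis
qed

text \<open>
  Between two different visits of \<open>j\<close> there is an exit from \<open>j\<close>, which raises the count.
\<close>

lemma single_visits_numbered:
  assumes z: "pure_jump_path z"
  shows "single_visits (numbered z)"
  unfolding single_visits_def
proof (intro allI impI)
  fix s t u :: real
  assume *: "0 \<le> s" "s \<le> t" "t \<le> u" "numbered z s = numbered z u"
  define j where "j = z s"
  have zu: "z u = j" and cnt: "exit_count z j s = exit_count z j u"
    using * by (auto simp: numbered_def j_def)
  have "z t = j"
  proof (cases "t < u")
    case True
    show ?thesis
      by (rule no_exit_stay[OF z \<open>0 \<le> s\<close> j_def[symmetric], of u])
         (use exit_count_eqD[OF z cnt] * True in auto)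
  qed (use * zu in auto)
  moreover have "exit_count z j t = exit_count z j s"
    using exit_count_mono[OF z \<open>s \<le> t\<close>, of j] exit_count_mono[OF z \<open>t \<le> u\<close>, of j] cnt by simp
  ultimately show "numbered z t = numbered z s"
    by (simp add: numbered_def j_def)
qed

text \<open>
  Just before \<open>t\<close> all exits before \<open>t\<close> have taken place, and every exit from \<open>j\<close> leads to exactly one
  state \<open>k \<noteq> j\<close>.
\<close>

lemma exits_before_eq:
  fixes Z :: "real \<Rightarrow> 'a \<Rightarrow> 's"
  assumes z: "pure_jump_path (\<lambda>u. Z u \<omega>)"
  shows "exits_before Z j t \<omega> = exit_count (\<lambda>u. Z u \<omega>) j t"
proof (cases "0 < t")
  case False
  then have "exit_times (\<lambda>u. Z u \<omega>) j \<inter> {..<t} = {}" by (auto simp: exit_times_def)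
  with False show ?thesis by (simp add: exits_before_def jump_count_left_def exit_count_def)
next
  case True
  let ?z = "\<lambda>u. Z u \<omega>"
  define A where "A = exit_times ?z j \<inter> {..<t}"
  have finA: "finite A" unfolding A_def by (rule finite_exit_times'[OF z])
  have left: "jump_count_left Z j k t \<omega> = card {s \<in> A. ?z s = k}" if "k \<noteq> j" for k
  proof -
    obtain e where e: "0 \<le> e" "e < t" "\<And>s. e < s \<Longrightarrow> s < t \<Longrightarrow> ?z s = left_val ?z t"
      using pure_jump_left[OF z True] by metis
    have "jump_count Z j k u \<omega> = card {s \<in> A. ?z s = k}" if u: "e < u" "u < t" for u
    proof -
      have "s \<le> u" if "s \<in> A" for s
      proof (rule ccontr)
        assume "\<not> s \<le> u"
        with that u have "s = u"
          using exit_times_stay[of u t ?z "left_val ?z t" s j] e(1,3) by (auto simp: A_def)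
        with \<open>\<not> s \<le> u\<close> show False by simp
      qed
      then have "{s. 0 < s \<and> s \<le> u \<and> left_val ?z s = j \<and> ?z s = k} = {s \<in> A. ?z s = k}"
        using u \<open>k \<noteq> j\<close> by (auto simp: A_def exit_times_def)
      then show ?thesis by (simp add: jump_count_def)
    qed
    then show ?thesis
      using True e by (auto simp: jump_count_left_def intro!: left_val_const[of e])
  qed
  have sub: "?z ` A \<subseteq> {k. k \<noteq> j}" by (auto simp: A_def exit_times_def)
  have "exits_before Z j t \<omega> = (\<Sum>\<^sub>\<infinity>k\<in>?z ` A. card {s \<in> A. ?z s = k})"
    unfolding exits_before_def
  proof (rule infsum_cong_neutral)
    fix k assume "k \<in> {k. k \<noteq> j} - ?z ` A"
    then have "{s \<in> A. ?z s = k} = {}" "k \<noteq> j" by auto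
    then show "jump_count_left Z j k t \<omega> = 0" using left[of k] by (metis card.empty)
  qed (use sub left in auto)
  also have "\<dots> = (\<Sum>k\<in>?z ` A. card {s \<in> A. ?z s = k})"
    using finA by (intro infsum_finite) auto
  also have "\<dots> = card A"
    using sum.image_gen[OF finA, of "\<lambda>_. 1::nat" ?z] by simp
  finally show ?thesis by (simp add: A_def exit_count_def)
qed

lemma ZJ_eq_numbered:
  assumes z: "pure_jump_path (\<lambda>u. Z u \<omega>)"
  shows "ZJ Z t \<omega> = numbered (\<lambda>u. Z u \<omega>) t"
proof -
  have "visit_number Z t \<omega> = (\<Sum>\<^sub>\<infinity>j\<in>{Z t \<omega>}. of_bool (Z t \<omega> = j) * exits_before Z j t \<omega>)"
    unfolding visit_number_def by (rule infsum_cong_neutral) auto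
  also have "\<dots> = exits_before Z (Z t \<omega>) t \<omega>" by (subst infsum_finite) auto
  finally show ?thesis by (simp add: ZJ_def numbered_def exits_before_eq[where Z = Z, OF z])
qed

section \<open>Measurability of the visit numbers and of the history\<close>

lemma space_augment [simp]: "space (augment M F) = space M"
  by (simp add: augment_def space_measure_of_conv)

lemma sets_augment:
  assumes "subalgebra M F"
  shows "sets (augment M F) = sigma_sets (space M) (sets F \<union> null_sets M)"
  using assms sets.space_closed[of M] unfolding augment_def subalgebra_def
  by (intro sets_measure_of) (auto dest: sets.sets_into_space)

lemma subalgebra_augment:
  assumes "subalgebra M F"
  shows "subalgebra M (augment M F)"
proof -
  have "sigma_sets (space M) (sets F \<union> null_sets M) \<subseteq> sets M"
    using assms by (intro sets.sigma_sets_subset) (auto simp: subalgebra_def)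
  then show ?thesis unfolding subalgebra_def sets_augment[OF assms] by simp
qed

lemma sets_augmentI:
  assumes "space F = space M" "A \<in> sets F"
  shows "A \<in> sets (augment M F)"
proof -
  have "sets F \<union> null_sets M \<subseteq> Pow (space M)"
    using assms(1) by (auto dest: sets.sets_into_space)
  with assms(2) show ?thesis by (auto simp: augment_def sets_measure_of_conv)
qed

text \<open>
  Measurability of a function on an event only needs the traces on that event.
\<close>

lemma borel_measurable_trace:
  fixes f :: "'a \<Rightarrow> real"
  assumes f: "f \<in> borel_measurable G" and sp: "space G = space F" and E: "{\<omega> \<in> space F. P \<omega>} \<in> sets F"
    and tr: "\<And>A. A \<in> sets G \<Longrightarrow> A \<inter> {\<omega> \<in> space F. P \<omega>} \<in> sets F"
  shows "(\<lambda>\<omega>. of_bool (P \<omega>) * f \<omega>) \<in> borel_measurable F"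
proof (rule measurableI)
  fix B :: "real set" assume B: "B \<in> sets borel"
  have "(\<lambda>\<omega>. of_bool (P \<omega>) * f \<omega>) -` B \<inter> space F =
      ((f -` B \<inter> space G) \<inter> {\<omega> \<in> space F. P \<omega>}) \<union>
      (if 0 \<in> B then space F - {\<omega> \<in> space F. P \<omega>} else {})"
    using sp by (cases "0 \<in> B") (auto simp: of_bool_def split: if_splits)
  also have "\<dots> \<in> sets F"
    using measurable_sets[OF f B] E by (auto intro!: sets.Un tr)
  finally show "(\<lambda>\<omega>. of_bool (P \<omega>) * f \<omega>) -` B \<inter> space F \<in> sets F" .
qed simp

locale jump_process = prob_space M for M :: "'a measure" +
  fixes Z :: "real \<Rightarrow> 'a \<Rightarrow> 's::countable"
  assumes Z_meas: "\<And>t. 0 \<le> t \<Longrightarrow> Z t \<in> measurable M (count_space UNIV)"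
    and Z_path: "\<And>\<omega>. \<omega> \<in> space M \<Longrightarrow> pure_jump_path (\<lambda>t. Z t \<omega>)"
begin

abbreviation path :: "'a \<Rightarrow> real \<Rightarrow> 's" where "path \<omega> \<equiv> (\<lambda>t. Z t \<omega>)"

lemma ZJ_path: "\<omega> \<in> space M \<Longrightarrow> (\<lambda>t. ZJ Z t \<omega>) = numbered (path \<omega>)"
  by (rule ext) (rule ZJ_eq_numbered[OF Z_path])

lemma ZJ_pure_jump: "\<omega> \<in> space M \<Longrightarrow> pure_jump_path (\<lambda>t. ZJ Z t \<omega>)"
  unfolding ZJ_path by (rule pure_jump_numbered[OF Z_path])

lemma ZJ_single: "\<omega> \<in> space M \<Longrightarrow> single_visits (\<lambda>t. ZJ Z t \<omega>)"
  unfolding ZJ_path by (rule single_visits_numbered[OF Z_path])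

abbreviation raw_info :: "real \<Rightarrow> 'a measure" where
  "raw_info t \<equiv> sigma (space M) {Z s -` A \<inter> space M | s A. 0 \<le> s \<and> s \<le> t}"

lemma sets_raw_info:
  "sets (raw_info t) = sigma_sets (space M) {Z s -` A \<inter> space M | s A. 0 \<le> s \<and> s \<le> t}"
  by (rule sets_measure_of) auto

lemma subalgebra_raw_info: "subalgebra M (raw_info t)"
  unfolding subalgebra_def sets_raw_info
  by (auto simp: space_measure_of_conv intro!: measurable_sets[OF Z_meas]
      elim!: subsetD[OF sets.sigma_sets_subset, rotated])

lemma space_full_info [simp]: "space (full_info M Z t) = space M"
  by (simp add: full_info_def)

lemma subalgebra_full_info: "subalgebra M (full_info M Z t)"
  unfolding full_info_def by (rule subalgebra_augment[OF subalgebra_raw_info])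

lemma full_info_mono:
  assumes "s \<le> t" shows "sets (full_info M Z s) \<subseteq> sets (full_info M Z t)"
proof -
  have "sets (raw_info s) \<subseteq> sets (raw_info t)"
    unfolding sets_raw_info using assms by (intro sigma_sets_mono') (auto intro: order_trans)
  then show ?thesis
    unfolding full_info_def sets_augment[OF subalgebra_raw_info]
    by (intro sigma_sets_mono') auto
qed

lemma Z_event:
  assumes "0 \<le> s" "s \<le> t"
  shows "{\<omega> \<in> space M. P (Z s \<omega>)} \<in> sets (full_info M Z t)"
proof -
  have "{\<omega> \<in> space M. P (Z s \<omega>)} = Z s -` Collect P \<inter> space M" by auto
  also have "\<dots> \<in> sets (raw_info t)" unfolding sets_raw_info
    by (intro sigma_sets.Basic CollectI exI[of _ s] exI[of _ "Collect P"]) (use assms in auto)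
  finally show ?thesis unfolding full_info_def by (intro sets_augmentI) (auto simp: space_measure_of_conv)
qed

text \<open>
  The last exit before \<open>t\<close> can be enclosed between a rational time at which the path is still in \<open>j\<close>
  and one at which it is outside.  Only countably many times occur, so measurability follows by
  induction on the count.
\<close>

lemma exit_count_iff:
  assumes \<omega>: "\<omega> \<in> space M"
  shows "Suc n \<le> exit_count (path \<omega>) j t \<longleftrightarrow>
    (\<exists>q\<in>\<rat>. \<exists>r\<in>\<rat>. 0 \<le> q \<and> q < r \<and> r < t \<and> n \<le> exit_count (path \<omega>) j q \<and> Z q \<omega> = j \<and> Z r \<omega> \<noteq> j)"
proof safe
  let ?z = "path \<omega>"
  note z = Z_path[OF \<omega>]
  assume n: "Suc n \<le> exit_count ?z j t"
  let ?S = "exit_times ?z j \<inter> {..<t}"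
  have fin: "finite ?S" by (rule finite_exit_times'[OF z])
  have ne: "?S \<noteq> {}" using n by (auto simp: exit_count_def)
  define w where "w = Max ?S"
  have w: "w \<in> ?S" unfolding w_def by (rule Max_in[OF fin ne])
  have "?S = insert w (exit_times ?z j \<inter> {..<w})"
    using w Max_ge[OF fin, folded w_def] by (auto simp: less_le)
  then have "exit_count ?z j t = Suc (exit_count ?z j w)"
    using finite_exit_times'[OF z, of j w] by (simp add: exit_count_def)
  with n have nw: "n \<le> exit_count ?z j w" by simp
  have w0: "0 < w" and lw: "left_val ?z w = j" and zw: "?z w \<noteq> j" and wt: "w < t"
    using w by (auto simp: exit_times_def)
  obtain e where e: "0 \<le> e" "e < w" "\<And>s. e < s \<Longrightarrow> s < w \<Longrightarrow> ?z s = j"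
    using pure_jump_left[OF z w0] lw by metis
  obtain e' where e': "w < e'" "\<And>s. w \<le> s \<Longrightarrow> s < e' \<Longrightarrow> ?z s = ?z w"
    using pure_jump_right[OF z] w0 by (metis less_imp_le)
  obtain q where q: "q \<in> \<rat>" "e < q" "q < w" using Rats_dense_in_real[OF e(2)] by auto
  obtain r where r: "r \<in> \<rat>" "w < r" "r < min e' t"
    using Rats_dense_in_real[of w "min e' t"] e'(1) wt by auto
  have "exit_count ?z j w = exit_count ?z j q"
    by (rule exit_count_stay[of q w]) (use e q in auto)
  moreover have "Z r \<omega> \<noteq> j" using e'(2)[of r] r zw by auto
  moreover have "Z q \<omega> = j" using e(3)[of q] q by auto
  ultimately show "\<exists>q\<in>\<rat>. \<exists>r\<in>\<rat>. 0 \<le> q \<and> q < r \<and> r < t \<and> n \<le> exit_count ?z j q \<and> Z q \<omega> = j \<and> Z r \<omega> \<noteq> j"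
    using q r e(1) nw by (intro bexI[of _ q] bexI[of _ r]) auto
next
  fix q r :: real
  let ?z = "path \<omega>"
  note z = Z_path[OF \<omega>]
  assume *: "0 \<le> q" "q < r" "r < t" "n \<le> exit_count ?z (Z q \<omega>) q" "Z r \<omega> \<noteq> Z q \<omega>" "j = Z q \<omega>"
  have "\<exists>v. q < v \<and> v < t \<and> v \<in> exit_times ?z (Z q \<omega>)"
  proof (rule ccontr)
    assume "\<not> ?thesis"
    then have "Z r \<omega> = Z q \<omega>"
      using * by (intro no_exit_stay[OF z \<open>0 \<le> q\<close> refl, of t r]) auto
    with * show False by simp
  qed
  then obtain v where "q < v" "v < t" "v \<in> exit_times ?z (Z q \<omega>)" by auto
  with exit_count_Suc_le[OF z this(3), of q t] * show "Suc n \<le> exit_count ?z (Z q \<omega>) t" by auto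
qed

lemma exit_count_event:
  "{\<omega> \<in> space M. n \<le> exit_count (path \<omega>) j t} \<in> sets (full_info M Z t)"
proof (induction n arbitrary: t)
  case 0
  then show ?case using sets.top[of "full_info M Z t"] by simp
next
  case (Suc n)
  have "{\<omega> \<in> space M. Suc n \<le> exit_count (path \<omega>) j t} =
    (\<Union>q\<in>\<rat> \<inter> {0..<t}. \<Union>r\<in>\<rat> \<inter> {q<..<t}. {\<omega> \<in> space M. n \<le> exit_count (path \<omega>) j q} \<inter>
      {\<omega> \<in> space M. Z q \<omega> = j} \<inter> {\<omega> \<in> space M. Z r \<omega> \<noteq> j})" (is "?L = ?R")
  proof (intro set_eqI iffI)
    fix \<omega> assume "\<omega> \<in> ?L"
    then have \<omega>: "\<omega> \<in> space M" "Suc n \<le> exit_count (path \<omega>) j t" by auto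
    then obtain q r where "q \<in> \<rat>" "r \<in> \<rat>" "0 \<le> q" "q < r" "r < t" "n \<le> exit_count (path \<omega>) j q" "Z q \<omega> = j" "Z r \<omega> \<noteq> j"
      using exit_count_iff[OF \<omega>(1)] by metis
    with \<omega>(1) show "\<omega> \<in> ?R" by (intro UN_I[of q] UN_I[of r]) auto
  next
    fix \<omega> assume "\<omega> \<in> ?R"
    then obtain q r where "\<omega> \<in> space M" "q \<in> \<rat>" "r \<in> \<rat>" "0 \<le> q" "q < r" "r < t" "n \<le> exit_count (path \<omega>) j q" "Z q \<omega> = j" "Z r \<omega> \<noteq> j"
      by auto
    then show "\<omega> \<in> ?L" using exit_count_iff[of \<omega> n j t] by blast
  qed
  also have "\<dots> \<in> sets (full_info M Z t)"
  proof (intro sets.countable_UN'' sets.Int countable_Int1 countable_rat)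
    fix q r assume "q \<in> \<rat> \<inter> {0..<t}" "r \<in> \<rat> \<inter> {q<..<t}"
    then have qr: "0 \<le> q" "q \<le> t" "0 \<le> r" "r \<le> t" by auto
    show "{\<omega> \<in> space M. n \<le> exit_count (path \<omega>) j q} \<in> sets (full_info M Z t)"
      using Suc.IH full_info_mono[OF qr(2)] by blast
    show "{\<omega> \<in> space M. Z q \<omega> = j} \<in> sets (full_info M Z t)"
      using Z_event[OF qr(1,2), of "\<lambda>k. k = j"] by simp
    show "{\<omega> \<in> space M. Z r \<omega> \<noteq> j} \<in> sets (full_info M Z t)"
      using Z_event[OF qr(3,4), of "\<lambda>k. k \<noteq> j"] by simp
  qed
  finally show ?case .
qed

lemma exit_count_eq_event:
  "{\<omega> \<in> space M. exit_count (path \<omega>) j t = n} \<in> sets (full_info M Z t)"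
proof -
  have "{\<omega> \<in> space M. exit_count (path \<omega>) j t = n} =
    {\<omega> \<in> space M. n \<le> exit_count (path \<omega>) j t} - {\<omega> \<in> space M. Suc n \<le> exit_count (path \<omega>) j t}"
    by auto
  also have "\<dots> \<in> sets (full_info M Z t)"
    by (intro sets.Diff exit_count_event)
  finally show ?thesis .
qed

lemma ZJ_event:
  assumes "0 \<le> s" "s \<le> t"
  shows "{\<omega> \<in> space M. ZJ Z s \<omega> = x} \<in> sets (full_info M Z t)"
proof -
  obtain j n where x: "x = (j, n)" by (cases x)
  have "{\<omega> \<in> space M. ZJ Z s \<omega> = x} =
    {\<omega> \<in> space M. Z s \<omega> = j} \<inter> {\<omega> \<in> space M. exit_count (path \<omega>) j s = n}"
    by (auto simp: ZJ_eq_numbered[OF Z_path] numbered_def x)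
  also have "\<dots> \<in> sets (full_info M Z t)"
    using Z_event[OF assms, of "\<lambda>k. k = j"] exit_count_eq_event[of j s n] full_info_mono[OF assms(2)]
    by (intro sets.Int) blast+
  finally show ?thesis .
qed

lemma ZJ_event': "0 \<le> s \<Longrightarrow> {\<omega> \<in> space M. ZJ Z s \<omega> = x} \<in> sets M"
  using ZJ_event[of s s x] subalgebra_full_info[of s] by (auto simp: subalgebra_def)

text \<open>
  The infimum is attained because the path is right-continuous.
\<close>

lemma entry_time_le_iff:
  assumes \<omega>: "\<omega> \<in> space M" and t: "0 \<le> t"
  shows "entry_time Z y \<omega> \<le> ereal t \<longleftrightarrow> (\<exists>s. 0 \<le> s \<and> s \<le> t \<and> ZJ Z s \<omega> = y)"
proof
  assume le: "entry_time Z y \<omega> \<le> ereal t"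
  show "\<exists>s. 0 \<le> s \<and> s \<le> t \<and> ZJ Z s \<omega> = y"
  proof (rule ccontr)
    assume no: "\<not> ?thesis"
    obtain e where e: "t < e" "\<And>s. t \<le> s \<Longrightarrow> s < e \<Longrightarrow> ZJ Z s \<omega> = ZJ Z t \<omega>"
      using pure_jump_right[OF ZJ_pure_jump[OF \<omega>] t] by metis
    have "ereal e \<le> entry_time Z y \<omega>"
      unfolding entry_time_def
    proof (rule Inf_greatest)
      fix a assume "a \<in> {ereal s | s. 0 \<le> s \<and> ZJ Z s \<omega> = y}"
      then obtain s where s: "a = ereal s" "0 \<le> s" "ZJ Z s \<omega> = y" by auto
      have "e \<le> s"
      proof (rule ccontr)
        assume "\<not> e \<le> s"
        show False
        proof (cases "s \<le> t")
          case False
          with e(2)[of s] \<open>\<not> e \<le> s\<close> s have "ZJ Z t \<omega> = y" by simp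
          with no t show False by blast
        qed (use no s in blast)
      qed
      with s show "ereal e \<le> a" by simp
    qed
    with le e(1) show False by (metis ereal_less_eq(3) leD order_trans)
  qed
next
  assume "\<exists>s. 0 \<le> s \<and> s \<le> t \<and> ZJ Z s \<omega> = y"
  then obtain s where s: "0 \<le> s" "s \<le> t" "ZJ Z s \<omega> = y" by auto
  then have "entry_time Z y \<omega> \<le> ereal s" unfolding entry_time_def by (intro Inf_lower) auto
  also have "\<dots> \<le> ereal t" using s by simp
  finally show "entry_time Z y \<omega> \<le> ereal t" .
qed

lemma entry_time_event:
  assumes t: "0 \<le> t"
  shows "{\<omega> \<in> space M. entry_time Z y \<omega> \<le> ereal t} \<in> sets (full_info M Z t)"
proof -
  have "{\<omega> \<in> space M. entry_time Z y \<omega> \<le> ereal t} =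
    {\<omega> \<in> space M. ZJ Z t \<omega> = y} \<union> (\<Union>q\<in>\<rat> \<inter> {0..t}. {\<omega> \<in> space M. ZJ Z q \<omega> = y})" (is "?L = ?R")
  proof (intro set_eqI iffI)
    fix \<omega> assume "\<omega> \<in> ?L"
    then have \<omega>: "\<omega> \<in> space M" and "entry_time Z y \<omega> \<le> ereal t" by auto
    then obtain s where s: "0 \<le> s" "s \<le> t" "ZJ Z s \<omega> = y" using entry_time_le_iff[OF \<omega> t] by auto
    show "\<omega> \<in> ?R"
    proof (cases "s = t")
      case False
      obtain e where e: "s < e" "\<And>r. s \<le> r \<Longrightarrow> r < e \<Longrightarrow> ZJ Z r \<omega> = ZJ Z s \<omega>"
        using pure_jump_right[OF ZJ_pure_jump[OF \<omega>] s(1)] by metis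
      obtain q where q: "q \<in> \<rat>" "s < q" "q < min e t"
        using Rats_dense_in_real[of s "min e t"] e(1) False s(2) by auto
      then have "ZJ Z q \<omega> = y" using e(2)[of q] s(3) by simp
      with q s \<omega> show ?thesis by auto
    qed (use s \<omega> in auto)
  next
    fix \<omega> assume "\<omega> \<in> ?R"
    then have "\<omega> \<in> space M" "\<exists>s. 0 \<le> s \<and> s \<le> t \<and> ZJ Z s \<omega> = y" using t by auto
    then show "\<omega> \<in> ?L" using entry_time_le_iff[of \<omega> t y] t by blast
  qed
  also have "\<dots> \<in> sets (full_info M Z t)"
    using t by (intro sets.Un sets.countable_UN'' countable_Int1 countable_rat ZJ_event) auto
  finally show ?thesis .
qed

lemma entry_time_nonneg: "0 \<le> entry_time Z y \<omega>"
  unfolding entry_time_def by (intro Inf_greatest) auto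

text \<open>
  Entry times as known at time \<open>u\<close>: those after \<open>u\<close> are replaced by \<open>\<infinity>\<close>.
\<close>

definition stopped_entry :: "real \<Rightarrow> 's \<times> nat \<Rightarrow> 'a \<Rightarrow> ereal" where
  "stopped_entry u y \<omega> = (if entry_time Z y \<omega> \<le> ereal u then entry_time Z y \<omega> else \<infinity>)"

lemma stopped_entry_measurable:
  assumes u: "0 \<le> u"
  shows "stopped_entry u y \<in> borel_measurable (full_info M Z u)"
proof (rule borel_measurableI_le)
  fix a :: ereal
  have "\<omega> \<in> space M \<Longrightarrow> a \<noteq> \<infinity> \<Longrightarrow> stopped_entry u y \<omega> \<le> a \<longleftrightarrow> entry_time Z y \<omega> \<le> min a u" for \<omega>
    by (auto simp: stopped_entry_def)
  moreover have "{\<omega> \<in> space M. entry_time Z y \<omega> \<le> min a u} \<in> sets (full_info M Z u)"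
  proof (cases "0 \<le> a")
    case False
    then have "min a (ereal u) < 0" by (simp add: not_le min_less_iff_disj)
    then have "\<not> entry_time Z y \<omega> \<le> min a (ereal u)" for \<omega>
      using entry_time_nonneg[of y \<omega>] by (meson leD order_trans)
    then have "{\<omega> \<in> space M. entry_time Z y \<omega> \<le> min a u} = {}" by blast
    then show ?thesis by (simp only: sets.empty_sets)
  next
    case True
    define v where "v = real_of_ereal (min a u)"
    have v: "min a (ereal u) = ereal v" "0 \<le> v" "v \<le> u"
      using True u unfolding v_def by (cases a; simp add: min_def)+
    then show ?thesis using entry_time_event[OF v(2), of y] full_info_mono[OF v(3)] by auto
  qed
  ultimately show "{\<omega> \<in> space (full_info M Z u). stopped_entry u y \<omega> \<le> a} \<in> sets (full_info M Z u)"
    using sets.top[of "full_info M Z u"] by (cases "a = \<infinity>") (simp_all cong: conj_cong)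
qed

text \<open>
  If \<open>x\<close> is occupied at time \<open>u\<close>, it has been entered by then, so the history at entry into \<open>x\<close> involves
  only entry times up to \<open>u\<close> and can be computed from the entry times known at time \<open>u\<close>.
\<close>

lemma history_trace:
  assumes u: "0 \<le> u" and A: "A \<in> sets (sigma_history M Z x)"
  shows "A \<inter> {\<omega> \<in> space M. ZJ Z u \<omega> = x} \<in> sets (full_info M Z u)"
proof -
  define h where "h \<omega> = (\<lambda>y. if stopped_entry u y \<omega> \<le> stopped_entry u x \<omega> then stopped_entry u y \<omega> else 0)" for \<omega>
  obtain B where B: "B \<in> sets (Pi\<^sub>M UNIV (\<lambda>_. borel :: ereal measure))"
    and A: "A = history_at_entry Z x -` B \<inter> space M"
    using A unfolding sigma_history_def by (subst (asm) sets_vimage_algebra2) (auto simp: space_PiM)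
  have h: "h \<in> measurable (full_info M Z u) (Pi\<^sub>M UNIV (\<lambda>_. borel))"
  proof (rule measurable_PiM_single')
    fix y
    note [measurable] = stopped_entry_measurable[OF u]
    show "(\<lambda>\<omega>. h \<omega> y) \<in> borel_measurable (full_info M Z u)"
      unfolding h_def by measurable
  qed (simp add: space_PiM)
  have "history_at_entry Z x \<omega> = h \<omega>" if "\<omega> \<in> space M" "ZJ Z u \<omega> = x" for \<omega>
  proof
    fix y
    have "entry_time Z x \<omega> \<le> ereal u" using entry_time_le_iff[OF that(1) u, of x] that u by auto
    then show "history_at_entry Z x \<omega> y = h \<omega> y"
      by (auto simp: history_at_entry_def h_def stopped_entry_def)
  qed
  then have "A \<inter> {\<omega> \<in> space M. ZJ Z u \<omega> = x} = (h -` B \<inter> space (full_info M Z u)) \<inter> {\<omega> \<in> space M. ZJ Z u \<omega> = x}"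
    unfolding A by auto
  also have "\<dots> \<in> sets (full_info M Z u)"
    using u by (intro sets.Int measurable_sets[OF h B] ZJ_event) auto
  finally show ?thesis .
qed

lemma measurable_on_visit:
  fixes f :: "'a \<Rightarrow> real"
  assumes f: "f \<in> borel_measurable G" and G: "space G = space M" "sets G \<subseteq> sets (sigma_history M Z x)"
    and u: "0 \<le> u" "u \<le> t"
  shows "(\<lambda>\<omega>. of_bool (ZJ Z u \<omega> = x) * f \<omega>) \<in> borel_measurable (full_info M Z t)"
proof (rule borel_measurable_trace[OF f])
  fix A assume "A \<in> sets G"
  then have "A \<in> sets (sigma_history M Z x)" using G by auto
  from history_trace[OF u(1) this] full_info_mono[OF u(2)]
  show "A \<inter> {\<omega> \<in> space (full_info M Z t). ZJ Z u \<omega> = x} \<in> sets (full_info M Z t)" by auto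
qed (use G ZJ_event[OF u] in auto)

end

section \<open>Functions dominated by an increasing right-continuous function\<close>

definition control :: "(real \<Rightarrow> real) \<Rightarrow> bool" where
  "control m \<longleftrightarrow> mono m \<and> (\<forall>t. continuous (at_right t) m)"

text \<open>
  The increments of \<open>f\<close> on \<open>[a, b]\<close> are dominated by those of \<open>m\<close>.  With an increasing right-continuous
  \<open>m\<close> this gives right-continuity, left limits and finite variation of \<open>f\<close> together, and such an \<open>m\<close> can
  be written down for sums, quotients and conditional expectations, which is awkward for the variation
  of \<open>f\<close> itself.
\<close>

definition controlled :: "(real \<Rightarrow> real) \<Rightarrow> (real \<Rightarrow> real) \<Rightarrow> real \<Rightarrow> real \<Rightarrow> bool" where
  "controlled f m a b \<longleftrightarrow> (\<forall>s u. a \<le> s \<longrightarrow> s \<le> u \<longrightarrow> u \<le> b \<longrightarrow> \<bar>f u - f s\<bar> \<le> m u - m s)"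

lemma controlD: "control m \<Longrightarrow> s \<le> u \<Longrightarrow> m s \<le> m u"
  by (auto simp: control_def mono_def)

lemma control_cont: "control m \<Longrightarrow> continuous (at_right t) m"
  by (auto simp: control_def)

lemma controlledD: "controlled f m a b \<Longrightarrow> a \<le> s \<Longrightarrow> s \<le> u \<Longrightarrow> u \<le> b \<Longrightarrow> \<bar>f u - f s\<bar> \<le> m u - m s"
  by (auto simp: controlled_def)

lemma controlled_subset: "controlled f m a b \<Longrightarrow> a \<le> a' \<Longrightarrow> b' \<le> b \<Longrightarrow> controlled f m a' b'"
  by (auto simp: controlled_def)

lemma control_const: "control (\<lambda>_. c)"
  by (auto simp: control_def mono_def)

lemma control_add: "control m \<Longrightarrow> control m' \<Longrightarrow> control (\<lambda>t. m t + m' t)"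
  by (auto simp: control_def mono_def intro!: add_mono continuous_add)

lemma control_cmult: "control m \<Longrightarrow> 0 \<le> c \<Longrightarrow> control (\<lambda>t. c * m t)"
  by (auto simp: control_def mono_def intro!: mult_left_mono continuous_mult continuous_const)

lemma controlled_add_control:
  assumes "controlled f m a b" "control m'"
  shows "controlled f (\<lambda>t. m t + m' t) a b"
  unfolding controlled_def
proof (intro allI impI)
  fix s u assume "a \<le> s" "s \<le> u" "u \<le> b"
  with controlledD[OF assms(1) this] controlD[OF assms(2), of s u]
  show "\<bar>f u - f s\<bar> \<le> m u + m' u - (m s + m' s)" by linarith
qed

lemma tendsto_right_cong:
  assumes "t < b" "\<And>u. t < u \<Longrightarrow> u < b \<Longrightarrow> f u = g u" "(g \<longlongrightarrow> l) (at_right (t::real))"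
  shows "(f \<longlongrightarrow> l) (at_right t)"
proof -
  have "eventually (\<lambda>u. g u = f u) (at_right t)"
    using assms(1,2) by (auto simp: eventually_at_right_field)
  from Lim_transform_eventually[OF assms(3) this] show ?thesis .
qed

lemma control_min:
  assumes "control m" shows "control (\<lambda>t. m (min t b))"
  unfolding control_def continuous_within
proof (intro conjI allI)
  show "mono (\<lambda>t. m (min t b))" using assms by (auto simp: control_def mono_def min_def)
  fix t
  show "((\<lambda>t. m (min t b)) \<longlongrightarrow> m (min t b)) (at_right t)"
  proof (cases "t < b")
    case True
    from control_cont[OF assms, of t] have "(m \<longlongrightarrow> m (min t b)) (at_right t)"
      using True by (simp add: continuous_within min_absorb1)
    then show ?thesis by (rule tendsto_right_cong[OF True, rotated]) (simp add: min_absorb1)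
  next
    case False
    then have mb: "min t b = b" "\<And>u. t < u \<Longrightarrow> min u b = b" by auto
    show ?thesis unfolding mb(1)
      by (rule tendsto_right_cong[of t "t+1" _ "\<lambda>_. m b"]) (simp_all add: mb(2))
  qed
qed

lemma control_max:
  assumes "control m" shows "control (\<lambda>t. m (max t b))"
  unfolding control_def continuous_within
proof (intro conjI allI)
  show "mono (\<lambda>t. m (max t b))" using assms by (auto simp: control_def mono_def max_def)
  fix t
  show "((\<lambda>t. m (max t b)) \<longlongrightarrow> m (max t b)) (at_right t)"
  proof (cases "t < b")
    case False
    from control_cont[OF assms, of t] have "(m \<longlongrightarrow> m (max t b)) (at_right t)"
      using False by (simp add: continuous_within max_absorb1)
    then show ?thesis by (rule tendsto_right_cong[of t "t+1", rotated 2]) (use False in \<open>simp_all add: max_absorb1\<close>)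
  next
    case True
    then have mb: "max t b = b" "\<And>u. u < b \<Longrightarrow> max u b = b" by auto
    show ?thesis unfolding mb(1)
      by (rule tendsto_right_cong[OF True, of _ "\<lambda>_. m b"]) (simp_all add: mb(2))
  qed
qed

lemma control_step:
  assumes "0 \<le> J" shows "control (\<lambda>t. if b \<le> t then J else 0)"
  unfolding control_def continuous_within
proof (intro conjI allI)
  show "mono (\<lambda>t. if b \<le> t then J else 0)" using assms by (auto simp: mono_def)
  fix t
  show "((\<lambda>t. if b \<le> t then J else 0) \<longlongrightarrow> (if b \<le> t then J else 0)) (at_right t)"
  proof (cases "t < b")
    case True
    then show ?thesis by (intro tendsto_right_cong[where b = b and g = "\<lambda>_. 0", OF _ _ tendsto_eq_rhs[OF tendsto_const]]) auto
  next
    case False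
    then have "b \<le> t" "\<And>u. t < u \<Longrightarrow> b \<le> u" by auto
    then show ?thesis
      by (intro tendsto_right_cong[where b = "t + 1" and g = "\<lambda>_. J", OF _ _ tendsto_eq_rhs[OF tendsto_const]]) auto
  qed
qed

text \<open>
  Freezing \<open>m\<close> after \<open>b\<close> and \<open>m'\<close> before \<open>b\<close> gives two functions on the whole line whose sum controls
  \<open>f\<close> on both sides.
\<close>

lemma controlled_glue:
  assumes "control m" "control m'" "controlled f m a b" "controlled f m' b c" "a \<le> b" "b \<le> c"
  shows "\<exists>M. control M \<and> controlled f M a c"
proof (intro exI conjI)
  let ?M = "\<lambda>t. m (min t b) + m' (max t b)"
  show "control ?M" by (intro control_add control_min control_max assms)
  show "controlled f ?M a c"
    unfolding controlled_def
  proof (intro allI impI)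
    fix s u assume *: "a \<le> s" "s \<le> u" "u \<le> c"
    consider "u \<le> b" | "b \<le> s" | "s \<le> b" "b \<le> u" by linarith
    then show "\<bar>f u - f s\<bar> \<le> ?M u - ?M s"
    proof cases
      case 1 then show ?thesis using controlledD[OF assms(3), of s u] *
        by (simp add: min_absorb1 max_absorb2)
    next
      case 2 then show ?thesis using controlledD[OF assms(4), of s u] *
        by (simp add: min_absorb2 max_absorb1)
    next
      case 3
      have "\<bar>f b - f s\<bar> \<le> m b - m s" using controlledD[OF assms(3), of s b] * 3 by simp
      moreover have "\<bar>f u - f b\<bar> \<le> m' u - m' b" using controlledD[OF assms(4), of b u] * 3 by simp
      ultimately show ?thesis using 3 by (simp add: min_absorb1 min_absorb2 max_absorb1 max_absorb2)
    qed
  qed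
qed

lemma controlled_tendsto_right:
  assumes "control m" "controlled f m t b" "t < b"
  shows "(f \<longlongrightarrow> f t) (at_right t)"
proof -
  have "((\<lambda>u. m u - m t) \<longlongrightarrow> m t - m t) (at_right t)"
    using control_cont[OF assms(1), of t] by (intro tendsto_diff tendsto_const) (simp add: continuous_within)
  then have "((\<lambda>u. m u - m t) \<longlongrightarrow> 0) (at_right t)" by simp
  moreover have "eventually (\<lambda>u. norm (f u - f t) \<le> m u - m t) (at_right t)"
    unfolding eventually_at_right_field using assms(3) controlledD[OF assms(2), of t]
    by (intro exI[of _ b]) auto
  ultimately have "((\<lambda>u. f u - f t) \<longlongrightarrow> 0) (at_right t)" by (rule Lim_null_comparison[rotated])
  then show ?thesis by (simp add: LIM_zero_iff)
qed

lemma mono_tendsto_left: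
  fixes m :: "real \<Rightarrow> real"
  assumes "a < t" "\<And>s u. a \<le> s \<Longrightarrow> s \<le> u \<Longrightarrow> u < t \<Longrightarrow> m s \<le> m u" "\<And>s. a \<le> s \<Longrightarrow> s < t \<Longrightarrow> m s \<le> K"
  shows "\<exists>l. (m \<longlongrightarrow> l) (at_left t)"
proof -
  have "(m \<longlongrightarrow> Sup (m ` ({..<t} \<inter> {a..}))) (at t within ({..<t} \<inter> {a..}))"
    by (rule Lim_left_bound) (use assms in auto)
  moreover have "at t within ({..<t} \<inter> {a..}) = at_left t"
    using assms(1) by (intro at_within_nhd[of _ "{a<..}"]) auto
  ultimately show ?thesis by auto
qed

text \<open>
  Both \<open>f + m\<close> and \<open>m\<close> increase, and \<open>f\<close> is their difference.
\<close>

lemma controlled_tendsto_left: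
  assumes "control m" and c: "\<And>u. u < t \<Longrightarrow> controlled f m a u" and "a < t"
  shows "\<exists>l. (f \<longlongrightarrow> l) (at_left t)"
proof -
  have d: "\<bar>f u - f s\<bar> \<le> m u - m s" if "a \<le> s" "s \<le> u" "u < t" for s u
    using controlledD[OF c[OF that(3)], of s u] that by simp
  have "\<exists>l. ((\<lambda>u. f u + m u) \<longlongrightarrow> l) (at_left t)"
  proof (rule mono_tendsto_left[of a t _ "f a + 2 * m t - m a"])
    fix s u assume "a \<le> s" "s \<le> u" "u < t"
    from d[OF this] show "f s + m s \<le> f u + m u" by (simp add: abs_le_iff)
  next
    fix s assume "a \<le> s" "s < t"
    then have "\<bar>f s - f a\<bar> \<le> m s - m a" "m s \<le> m t"
      using d[of a s] controlD[OF assms(1), of s t] by auto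
    then show "f s + m s \<le> f a + 2 * m t - m a" by (simp add: abs_le_iff)
  qed fact
  then obtain l where l: "((\<lambda>u. f u + m u) \<longlongrightarrow> l) (at_left t)" by auto
  have "\<exists>l. (m \<longlongrightarrow> l) (at_left t)"
    using controlD[OF assms(1)] by (intro mono_tendsto_left[OF \<open>a < t\<close>, of _ "m t"]) auto
  then obtain l' where l': "(m \<longlongrightarrow> l') (at_left t)" by auto
  from tendsto_diff[OF l l'] show ?thesis by auto
qed

lemma controlled_variation:
  assumes m: "control m" and c: "controlled f m a b"
  shows "variation f a b < \<infinity>"
proof -
  have "variation f a b \<le> ennreal (m b - m a)"
    unfolding variation_def
  proof (rule SUP_least)
    fix xs assume "xs \<in> {xs. sorted xs \<and> set xs \<subseteq> {a..b}}"
    then have xs: "sorted xs" "set xs \<subseteq> {a..b}" by auto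
    show "(\<Sum>i<length xs - 1. ennreal \<bar>f (xs ! Suc i) - f (xs ! i)\<bar>) \<le> ennreal (m b - m a)"
    proof (cases "xs = []")
      case False
      define n where "n = length xs - 1"
      have n: "length xs = Suc n" using False by (simp add: n_def)
      have in': "a \<le> xs ! i" "xs ! i \<le> b" if "i \<le> n" for i
        using that n subsetD[OF xs(2) nth_mem[of i xs]] by auto
      have "(\<Sum>i<n. \<bar>f (xs ! Suc i) - f (xs ! i)\<bar>) \<le> (\<Sum>i<n. m (xs ! Suc i) - m (xs ! i))"
        using xs(1) n in' by (intro sum_mono controlledD[OF c]) (auto simp: sorted_iff_nth_mono)
      also have "\<dots> = m (xs ! n) - m (xs ! 0)" by (rule sum_lessThan_telescope)
      also have "\<dots> \<le> m b - m a" using in'[of n] in'[of 0] controlD[OF m] by (intro diff_mono) auto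
      finally show ?thesis unfolding n_def[symmetric] by (simp add: sum_ennreal ennreal_leI)
    qed simp
  qed
  then show ?thesis using le_less_trans[OF _ ennreal_less_top] by (simp add: less_top)
qed

lemma controlled_cadlag_fv:
  assumes "\<And>t. 0 \<le> t \<Longrightarrow> \<exists>m. control m \<and> controlled f m 0 t"
  shows "cadlag f" "fv_on_compacts f"
proof -
  show "fv_on_compacts f" unfolding fv_on_compacts_def using assms controlled_variation by blast
  show "cadlag f"
    unfolding cadlag_def
  proof (intro conjI allI impI)
    fix t :: real assume "0 \<le> t"
    obtain m where m: "control m" "controlled f m 0 (t + 1)" using assms[of "t + 1"] \<open>0 \<le> t\<close> by auto
    show "(f \<longlongrightarrow> f t) (at_right t)"
      by (rule controlled_tendsto_right[OF m(1) controlled_subset[OF m(2)], of t "t+1"]) (use \<open>0 \<le> t\<close> in auto)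
  next
    fix t :: real assume "0 < t"
    obtain m where m: "control m" "controlled f m 0 t" using assms[of t] \<open>0 < t\<close> by auto
    show "\<exists>l. (f \<longlongrightarrow> l) (at_left t)"
      by (rule controlled_tendsto_left[OF m(1) _ \<open>0 < t\<close>]) (rule controlled_subset[OF m(2)], auto)
  qed
qed

lemma controlled_divide:
  assumes N: "controlled N m a b" and D: "controlled D m a b" and eps: "0 < e" "\<And>s. a \<le> s \<Longrightarrow> s \<le> b \<Longrightarrow> e \<le> D s"
    and bd: "\<And>s. a \<le> s \<Longrightarrow> s \<le> b \<Longrightarrow> \<bar>N s\<bar> \<le> C" and m: "control m" and C: "0 \<le> C"
  shows "controlled (\<lambda>s. N s / D s) (\<lambda>s. (1 / e + C / e\<^sup>2) * m s) a b"
  unfolding controlled_def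
proof (intro allI impI)
  fix s u assume *: "a \<le> s" "s \<le> u" "u \<le> b"
  define d where "d = m u - m s"
  have d: "\<bar>N u - N s\<bar> \<le> d" "\<bar>D u - D s\<bar> \<le> d" 
    using controlledD[OF N *] controlledD[OF D *] by (auto simp: d_def)
  have Ds: "e \<le> D s" "e \<le> D u" and Nu: "\<bar>N s\<bar> \<le> C" using eps(2) bd * by auto
  have "N u / D u - N s / D s = (N u - N s) / D u + N s * (D s - D u) / (D u * D s)"
    using Ds eps(1) by (simp add: field_simps)
  also have "\<bar>\<dots>\<bar> \<le> \<bar>N u - N s\<bar> / D u + \<bar>N s\<bar> * \<bar>D u - D s\<bar> / (D u * D s)"
    using Ds eps(1) by (intro order_trans[OF abs_triangle_ineq]) (simp add: abs_mult abs_minus_commute)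
  also have "\<dots> \<le> d / e + C * d / (e * e)"
    using Ds eps(1) d Nu by (intro add_mono frac_le mult_mono) auto
  also have "\<dots> = (1 / e + C / e\<^sup>2) * m u - (1 / e + C / e\<^sup>2) * m s"
    by (simp add: d_def power2_eq_square algebra_simps diff_divide_distrib add_divide_distrib)
  finally show "\<bar>N u / D u - N s / D s\<bar> \<le> (1 / e + C / e\<^sup>2) * m u - (1 / e + C / e\<^sup>2) * m s" .
qed

text \<open>
  The value at the right end point may be arbitrary: a large enough jump of the dominating function at
  \<open>b\<close> absorbs it.
\<close>

lemma controlled_end_jump:
  assumes m: "control m" and c: "\<And>u. u < b \<Longrightarrow> controlled f m a u" and "a < b"
  shows "\<exists>M. control M \<and> controlled f M a b"
proof -
  define J where "J = \<bar>f b - f a\<bar> + (m b - m a)"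
  have J: "0 \<le> J" using controlD[OF m, of a b] \<open>a < b\<close> by (simp add: J_def)
  let ?M = "\<lambda>t. m t + (if b \<le> t then J else 0)"
  have "controlled f ?M a b"
    unfolding controlled_def
  proof (intro allI impI)
    fix s u assume *: "a \<le> s" "s \<le> u" "u \<le> b"
    consider "u < b" | "u = b" "s = b" | "u = b" "s < b" using * by linarith
    then show "\<bar>f u - f s\<bar> \<le> ?M u - ?M s"
    proof cases
      case 1 then show ?thesis using controlledD[OF c[OF 1], of s u] * by simp
    next
      case 3
      have "\<bar>f s - f a\<bar> \<le> m s - m a" using controlledD[OF c[OF 3(2)], of a s] * by simp
      then have "\<bar>f b - f s\<bar> \<le> J" 
        using controlD[OF m, of s b] 3 unfolding J_def by linarith
      then show ?thesis using 3 controlD[OF m, of s b] by simp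
    qed simp
  qed
  moreover have "control ?M" by (intro control_add m control_step J)
  ultimately show ?thesis by blast
qed

subsection \<open>Stieltjes integrals along the stays in a state\<close>

lemma measure_Ioc_tendsto_0:
  assumes s: "sets \<mu> = sets borel" and f: "emeasure \<mu> {c<..d} < \<infinity>" and "c < (d::real)"
  shows "((\<lambda>u. measure \<mu> {c<..u}) \<longlongrightarrow> 0) (at_right c)"
proof (rule tendsto_at_right_sequentially[OF \<open>c < d\<close>])
  fix S :: "nat \<Rightarrow> real"
  assume S: "\<And>n. c < S n" "\<And>n. S n < d" "decseq S" "S \<longlonglongrightarrow> c"
  have "(\<lambda>n. measure \<mu> {c<..S n}) \<longlonglongrightarrow> measure \<mu> (\<Inter>n. {c<..S n})"
  proof (rule Lim_measure_decseq)
    show "range (\<lambda>n. {c<..S n}) \<subseteq> sets \<mu>" unfolding s by (rule image_subsetI) simp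
    show "decseq (\<lambda>n. {c<..S n})"
    proof (rule decseq_SucI)
      fix n show "{c<..S (Suc n)} \<subseteq> {c<..S n}" using decseq_SucD[OF S(3), of n] by auto
    qed
    fix i
    have "emeasure \<mu> {c<..S i} \<le> emeasure \<mu> {c<..d}" using S(2)[of i] s by (intro emeasure_mono) auto
    with f show "emeasure \<mu> {c<..S i} \<noteq> \<infinity>" by auto
  qed
  moreover have "x \<notin> (\<Inter>n. {c<..S n})" for x
  proof
    assume x: "x \<in> (\<Inter>n. {c<..S n})"
    then have "c < x" by auto
    with S(4) have "eventually (\<lambda>n. S n < x) sequentially" by (rule order_tendstoD)
    then obtain n where "S n < x" by (auto simp: eventually_sequentially)
    with x show False by (auto dest: spec[of _ n])
  qed
  then have "(\<Inter>n. {c<..S n}) = {}" by blast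
  ultimately show "(\<lambda>n. measure \<mu> {c<..S n}) \<longlonglongrightarrow> 0" by simp
qed

text \<open>
  The increments of \<open>F\<close> after \<open>c\<close> are measures of intervals that shrink to the empty set.
\<close>

lemma has_LS_integral_right_cont:
  assumes LS: "has_LS_integral f F A y" and sub: "{c<..d} \<subseteq> {s \<in> A. f s \<noteq> 0}" and "c < d"
  shows "(F \<longlongrightarrow> F c) (at_right c)"
proof -
  obtain \<mu> \<nu> where s: "sets \<mu> = sets borel" "sets \<nu> = sets borel"
    and I: "\<And>c d. c < d \<Longrightarrow> {c<..d} \<subseteq> {s \<in> A. f s \<noteq> 0} \<Longrightarrow>
           emeasure \<mu> {c<..d} < \<infinity> \<and> emeasure \<nu> {c<..d} < \<infinity> \<and>
           F d - F c = measure \<mu> {c<..d} - measure \<nu> {c<..d}"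
    using LS unfolding has_LS_integral_def by metis
  have "((\<lambda>u. F c + (measure \<mu> {c<..u} - measure \<nu> {c<..u})) \<longlongrightarrow> F c + (0 - 0)) (at_right c)"
    using I[OF \<open>c < d\<close> sub] s \<open>c < d\<close> by (intro tendsto_intros measure_Ioc_tendsto_0[of _ _ d]) auto
  then have "((\<lambda>u. F c + (measure \<mu> {c<..u} - measure \<nu> {c<..u})) \<longlongrightarrow> F c) (at_right c)" by simp
  note lim = this
  show ?thesis
  proof (rule tendsto_right_cong[OF \<open>c < d\<close> _ lim])
    fix u assume "c < u" "u < d"
    then have "{c<..u} \<subseteq> {c<..d}" by auto
    with sub have "{c<..u} \<subseteq> {s \<in> A. f s \<noteq> 0}" by (rule subset_trans[rotated])
    from I[OF \<open>c < u\<close> this] show "F u = F c + (measure \<mu> {c<..u} - measure \<nu> {c<..u})" by simp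
  qed
qed

lemma left_val_Ioc_state:
  assumes z: "pure_jump_path z" and "0 \<le> c" and l: "\<And>v. c < v \<Longrightarrow> v \<le> d \<Longrightarrow> left_val z v = j"
    and s: "c \<le> s" "s < d"
  shows "z s = j"
proof -
  obtain e where e: "s < e" "\<And>v. s \<le> v \<Longrightarrow> v < e \<Longrightarrow> z v = z s"
    using pure_jump_right[OF z] s \<open>0 \<le> c\<close> by (metis order_trans)
  obtain v where v: "s < v" "v < min e d" using dense[of s "min e d"] e s by auto
  have "left_val z v = z s"
    by (rule left_val_const[OF v(1)], rule e(2)) (use v in auto)
  with l[of v] v s show ?thesis by simp
qed

text \<open>
  Stop \<open>X\<close> and \<open>m\<close> at \<open>0\<close> and \<open>t\<close>.  Then \<open>m + X\<close> and \<open>m\<close> are increasing and right-continuous, and the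
  measures that they generate represent the increments of \<open>W\<close> during the stays in \<open>j\<close>.  By induction
  along the path, their difference on the part of \<open>(0, t]\<close> spent in \<open>j\<close> is \<open>X t\<close>.
\<close>

lemma has_LS_integral_left_val:
  assumes z: "pure_jump_path z" and t: "0 \<le> t" and m: "control m" "controlled X m 0 t" and X0: "X 0 = 0"
    and stay: "\<And>s u. 0 \<le> s \<Longrightarrow> s < u \<Longrightarrow> u \<le> t \<Longrightarrow> (\<And>r. s \<le> r \<Longrightarrow> r < u \<Longrightarrow> z r = j) \<Longrightarrow> X u - X s = W u - W s"
    and away: "\<And>s u k. 0 \<le> s \<Longrightarrow> s < u \<Longrightarrow> u \<le> t \<Longrightarrow> k \<noteq> j \<Longrightarrow> (\<And>r. s \<le> r \<Longrightarrow> r < u \<Longrightarrow> z r = k) \<Longrightarrow> X u = X s"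
  shows "has_LS_integral (\<lambda>s. of_bool (left_val z s = j)) W {0<..t} (X t)"
proof -
  \<comment> \<open>Stopping at both ends makes the generating functions constant outside \<open>[0, t]\<close>.\<close>
  define cl where "cl s = max (min s t) 0" for s
  define p where "p s = m (cl s) + X (cl s)" for s
  define q where "q s = m (cl s)" for s
  have cl: "0 \<le> cl s" "cl s \<le> t" for s using t by (auto simp: cl_def)
  have cl_id: "cl s = s" if "0 \<le> s" "s \<le> t" for s using that by (auto simp: cl_def)
  have clm: "cl s \<le> cl u" if "s \<le> u" for s u using that by (auto simp: cl_def)
  have q: "control q"
    unfolding q_def cl_def by (rule control_min[OF control_max[OF m(1)]])
  have Xcl: "\<bar>X (cl u) - X (cl s)\<bar> \<le> q u - q s" if "s \<le> u" for s u
    unfolding q_def using cl clm[OF that] by (intro controlledD[OF m(2)]) auto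
  have pm: "p s \<le> p u" if "s \<le> u" for s u
    using Xcl[OF that] by (simp add: p_def q_def abs_le_iff)
  have pc: "continuous (at_right s) p" for s
  proof -
    have "((\<lambda>u. X (cl u)) \<longlongrightarrow> X (cl s)) (at_right s)"
      by (rule controlled_tendsto_right[OF q, of _ s "s+1"]) (auto simp: controlled_def Xcl)
    moreover have "(q \<longlongrightarrow> q s) (at_right s)"
      using control_cont[OF q, of s] by (simp add: continuous_within)
    ultimately have "((\<lambda>u. q u + X (cl u)) \<longlongrightarrow> q s + X (cl s)) (at_right s)" by (intro tendsto_add)
    then show ?thesis by (simp add: p_def[abs_def] q_def continuous_within)
  qed
  define \<mu> where "\<mu> = interval_measure p"
  define \<nu> where "\<nu> = interval_measure q"
  have se: "sets \<mu> = sets borel" "sets \<nu> = sets borel" by (simp_all add: \<mu>_def \<nu>_def)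
  have em: "emeasure \<mu> {c<..d} = ennreal (p d - p c)" "emeasure \<nu> {c<..d} = ennreal (q d - q c)"
    and me: "measure \<mu> {c<..d} = p d - p c" "measure \<nu> {c<..d} = q d - q c" if "c \<le> d" for c d
    unfolding \<mu>_def \<nu>_def
    using that pm pc controlD[OF q] control_cont[OF q]
    by (auto intro!: emeasure_interval_measure_Ioc measure_interval_measure_Ioc)
  define A where "A r = {s. 0 < s \<and> s \<le> r \<and> left_val z s = j}" for r
  have fin: "emeasure \<mu> E < \<infinity>" "emeasure \<nu> E < \<infinity>" if "E \<subseteq> {0<..t}" for E
    using emeasure_mono[of E "{0<..t}" \<mu>] emeasure_mono[of E "{0<..t}" \<nu>] that em[of 0 t] se t
    by (auto simp: less_top[symmetric] top_unique)
  have A: "r \<le> t \<longrightarrow> A r \<in> sets borel \<and> measure \<mu> (A r) - measure \<nu> (A r) = X r" if "0 \<le> r" for r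
    using z that
  proof (induction r rule: pure_jump_induct[consumes 2, case_names base step])
    case base
    have "A 0 = {}" by (auto simp: A_def)
    then show ?case using X0 by simp
  next
    case (step s u)
    note su = step(1,2)
    have const: "\<And>r. s \<le> r \<Longrightarrow> r < u \<Longrightarrow> z r = z s" by fact
    have lv: "left_val z v = z s" if "s < v" "v \<le> u" for v
      by (rule left_val_const[OF that(1)]) (rule const, use that in auto)
    show ?case
    proof (intro impI)
      assume ut: "u \<le> t"
      then have IH: "A s \<in> sets borel" "measure \<mu> (A s) - measure \<nu> (A s) = X s"
        using step(4) su by auto
      show "A u \<in> sets borel \<and> measure \<mu> (A u) - measure \<nu> (A u) = X u"
      proof (cases "z s = j")
        case True
        have Au: "A u = A s \<union> {s<..u}" using lv True su by (force simp: A_def)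
        have dis: "A s \<inter> {s<..u} = {}" by (auto simp: A_def)
        have sub: "A s \<subseteq> {0<..t}" "{s<..u} \<subseteq> {0<..t}" using su ut by (auto simp: A_def)
        have "measure \<mu> (A u) = measure \<mu> (A s) + (p u - p s)" 
          unfolding Au using fin(1)[OF sub(1)] fin(1)[OF sub(2)] se IH su
          by (subst measure_Union[OF _ _ _ _ dis]) (auto simp: me)
        moreover have "measure \<nu> (A u) = measure \<nu> (A s) + (q u - q s)" 
          unfolding Au using fin(2)[OF sub(1)] fin(2)[OF sub(2)] se IH su
          by (subst measure_Union[OF _ _ _ _ dis]) (auto simp: me)
        moreover have "p u - p s - (q u - q s) = X u - X s"
          using su ut by (simp add: p_def q_def cl_id)
        ultimately show ?thesis using IH Au by auto
      next
        case False
        have "v \<le> s" if "v \<le> u" "left_val z v = j" for v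
          using lv[of v] that False by force
        then have "A u = A s" using su by (auto simp: A_def)
        moreover have "X u = X s" by (rule away[OF su ut False const])
        ultimately show ?thesis using IH by simp
      qed
    qed
  qed
  have At: "A t \<in> sets borel" "measure \<mu> (A t) - measure \<nu> (A t) = X t" using A[OF t] by auto
  have ind: "(\<lambda>s. indicator {0<..t} s *\<^sub>R of_bool (left_val z s = j)) = (\<lambda>s. indicator (A t) s :: real)"
    by (auto simp: A_def indicator_def)
  have sub: "A t \<subseteq> {0<..t}" by (auto simp: A_def)
  have main: "W d - W c = measure \<mu> {c<..d} - measure \<nu> {c<..d} \<and> emeasure \<mu> {c<..d} < \<infinity> \<and> emeasure \<nu> {c<..d} < \<infinity>"
    if cd: "c < d" and s: "{c<..d} \<subseteq> {s \<in> {0<..t}. of_bool (left_val z s = j) \<noteq> (0::real)}" for c d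
  proof -
    have s': "0 < v \<and> v \<le> t \<and> left_val z v = j" if "c < v" "v \<le> d" for v
      using s that by (auto simp: subset_iff)
    have c0: "0 \<le> c"
    proof (rule ccontr)
      assume "\<not> 0 \<le> c"
      then obtain v where "c < v" "v < min 0 d" using dense[of c "min 0 d"] cd by auto
      with s'[of v] show False by auto
    qed
    have dt: "d \<le> t" using s'[of d] cd by simp
    have "X d - X c = W d - W c"
      by (rule stay[OF c0 cd dt]) (rule left_val_Ioc_state[OF z c0], use s' in auto)
    moreover have "measure \<mu> {c<..d} - measure \<nu> {c<..d} = X d - X c"
      using cd c0 dt by (simp add: me p_def q_def cl_id)
    ultimately show ?thesis using cd by (simp add: em)
  qed
  have int: "integrable \<mu> (indicator (A t) :: real \<Rightarrow> real)" "integrable \<nu> (indicator (A t) :: real \<Rightarrow> real)"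
    using se fin[OF sub] At(1) by auto
  show ?thesis
    unfolding has_LS_integral_def
  proof (rule exI[of _ \<mu>], rule exI[of _ \<nu>], intro conjI allI impI se)
    fix c d :: real
    assume "c < d" "{c<..d} \<subseteq> {s \<in> {0<..t}. of_bool (left_val z s = j) \<noteq> (0::real)}"
    from main[OF this] show "emeasure \<mu> {c<..d} < \<infinity>" "emeasure \<nu> {c<..d} < \<infinity>"
      "W d - W c = measure \<mu> {c<..d} - measure \<nu> {c<..d}" by auto
  next
    show "set_integrable \<mu> {0<..t} (\<lambda>s. of_bool (left_val z s = j) :: real)"
      "set_integrable \<nu> {0<..t} (\<lambda>s. of_bool (left_val z s = j) :: real)"
      unfolding set_integrable_def ind by (fact int)+
    show "X t = (LINT s:{0<..t}|\<mu>. of_bool (left_val z s = j)) - (LINT s:{0<..t}|\<nu>. of_bool (left_val z s = j))"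
      unfolding set_lebesgue_integral_def ind using At int by (simp add: \<mu>_def \<nu>_def)
  qed
qed

section \<open>Right-continuity of the discounted payments\<close>

text \<open>
  The sum turns \<open>\<mu> - \<nu> = \<mu>' - \<nu>'\<close> into an equality \<open>\<mu> + \<nu>' = \<mu>' + \<nu>\<close> of measures.
\<close>

definition sum_measure :: "real measure \<Rightarrow> real measure \<Rightarrow> real measure" where
  "sum_measure \<mu> \<nu> = measure_of UNIV (sets borel) (\<lambda>E. emeasure \<mu> E + emeasure \<nu> E)"

lemma sets_sum_measure [simp]: "sets (sum_measure \<mu> \<nu>) = sets borel"
  unfolding sum_measure_def by (simp add: sets_measure_of_conv sets.sigma_sets_eq[of borel, simplified])

lemma emeasure_sum_measure:
  assumes s: "sets \<mu> = sets borel" "sets \<nu> = sets borel" and E: "E \<in> sets borel"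
  shows "emeasure (sum_measure \<mu> \<nu>) E = emeasure \<mu> E + emeasure \<nu> E"
proof (rule emeasure_measure_of[OF sum_measure_def])
  show "countably_additive (sets (sum_measure \<mu> \<nu>)) (\<lambda>E. emeasure \<mu> E + emeasure \<nu> E)"
  proof (rule countably_additiveI)
    fix A :: "nat \<Rightarrow> real set"
    assume A: "range A \<subseteq> sets (sum_measure \<mu> \<nu>)" "disjoint_family A"
    have "(\<Sum>i. emeasure \<mu> (A i) + emeasure \<nu> (A i)) = (\<Sum>i. emeasure \<mu> (A i)) + (\<Sum>i. emeasure \<nu> (A i))"
      by (rule suminf_add[symmetric]) auto
    also have "\<dots> = emeasure \<mu> (\<Union>i. A i) + emeasure \<nu> (\<Union>i. A i)"
      using A s by (simp add: suminf_emeasure)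
    finally show "(\<Sum>i. emeasure \<mu> (A i) + emeasure \<nu> (A i)) = \<dots>" .
  qed
qed (use E in \<open>auto simp: positive_def\<close>)

lemma nn_integral_sum_measure:
  assumes s: "sets \<mu> = sets borel" "sets \<nu> = sets borel" and f: "f \<in> borel_measurable borel"
  shows "(\<integral>\<^sup>+x. f x \<partial>sum_measure \<mu> \<nu>) = (\<integral>\<^sup>+x. f x \<partial>\<mu>) + (\<integral>\<^sup>+x. f x \<partial>\<nu>)"
  using f
proof (induction rule: borel_measurable_induct)
  case (cong f g)
  then have "f = g" by (auto simp: space_borel)
  with cong show ?case by simp
next
  case (set A)
  then show ?case using s by (simp add: emeasure_sum_measure)
next
  case (mult u c)
  have "u \<in> borel_measurable \<mu>" "u \<in> borel_measurable \<nu>" "u \<in> borel_measurable (sum_measure \<mu> \<nu>)"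
    using mult(2) s by (auto cong: measurable_cong_sets)
  with mult show ?case by (simp add: nn_integral_cmult distrib_left)
next
  case (add u v)
  have "u \<in> borel_measurable \<mu>" "u \<in> borel_measurable \<nu>" "u \<in> borel_measurable (sum_measure \<mu> \<nu>)"
    "v \<in> borel_measurable \<mu>" "v \<in> borel_measurable \<nu>" "v \<in> borel_measurable (sum_measure \<mu> \<nu>)"
    using add s by (auto cong: measurable_cong_sets)
  with add show ?case by (simp add: nn_integral_add add_ac)
next
  case (seq U)
  have U: "U i \<in> borel_measurable \<mu>" "U i \<in> borel_measurable \<nu>" "U i \<in> borel_measurable (sum_measure \<mu> \<nu>)" for i
    using seq(1) s by (auto cong: measurable_cong_sets)
  have inc: "incseq (\<lambda>i. \<integral>\<^sup>+x. U i x \<partial>M)" for M :: "real measure"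
    using \<open>incseq U\<close> by (auto simp: incseq_def le_fun_def intro!: nn_integral_mono)
  have "(\<integral>\<^sup>+x. (SUP i. U i) x \<partial>M) = (SUP i. \<integral>\<^sup>+x. U i x \<partial>M)" if "\<And>i. U i \<in> borel_measurable M" for M
    using nn_integral_monotone_convergence_SUP[OF \<open>incseq U\<close> that] by (simp add: image_comp)
  with U seq inc show ?case by (simp add: ennreal_SUP_add)
qed

lemma has_LS_integralE:
  assumes "has_LS_integral f F A y"
  obtains \<mu> \<nu> where "sets \<mu> = sets borel" "sets \<nu> = sets borel"
    "\<forall>c d. c < d \<longrightarrow> {c<..d} \<subseteq> {s \<in> A. f s \<noteq> 0} \<longrightarrow>
       emeasure \<mu> {c<..d} < \<infinity> \<and> emeasure \<nu> {c<..d} < \<infinity> \<and>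
       F d - F c = measure \<mu> {c<..d} - measure \<nu> {c<..d}"
    "set_integrable \<mu> A f" "set_integrable \<nu> A f"
    "y = (LINT s:A|\<mu>. f s) - (LINT s:A|\<nu>. f s)"
  using assms unfolding has_LS_integral_def by (elim exE conjE) (rule that)

text \<open>
  Two representations of the increments of \<open>F\<close> satisfy \<open>\<mu> + \<nu>' = \<mu>' + \<nu>\<close> on the intervals \<open>(c, d]\<close> with
  \<open>t \<le> c\<close>, hence on all Borel subsets of \<open>(t, \<infinity>)\<close>, and the positive function \<open>f\<close> can be integrated
  against both sides.
\<close>

lemma has_LS_integral_unique_tail:
  assumes LS: "has_LS_integral f F {t<..} y" "has_LS_integral f F {t<..} y'"
    and pos: "\<And>s. t < s \<Longrightarrow> 0 < f s"
  shows "y = y'"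
proof -
  have *: "\<exists>\<mu> \<nu>. sets \<mu> = sets borel \<and> sets \<nu> = sets borel \<and>
      (\<forall>c d. t \<le> c \<longrightarrow> c \<le> d \<longrightarrow> emeasure \<mu> {c<..d} < \<infinity> \<and> emeasure \<nu> {c<..d} < \<infinity> \<and>
           F d - F c = measure \<mu> {c<..d} - measure \<nu> {c<..d}) \<and>
      set_integrable \<mu> {t<..} f \<and> set_integrable \<nu> {t<..} f \<and>
      y = (LINT s:{t<..}|\<mu>. f s) - (LINT s:{t<..}|\<nu>. f s)" if LSy: "has_LS_integral f F {t<..} y" for y
  proof -
    obtain \<mu> \<nu> where s: "sets \<mu> = sets borel" "sets \<nu> = sets borel"
      and I: "\<forall>c d. c < d \<longrightarrow> {c<..d} \<subseteq> {s \<in> {t<..}. f s \<noteq> 0} \<longrightarrow>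
           emeasure \<mu> {c<..d} < \<infinity> \<and> emeasure \<nu> {c<..d} < \<infinity> \<and>
           F d - F c = measure \<mu> {c<..d} - measure \<nu> {c<..d}"
      and i: "set_integrable \<mu> {t<..} f" "set_integrable \<nu> {t<..} f"
        "y = (LINT s:{t<..}|\<mu>. f s) - (LINT s:{t<..}|\<nu>. f s)"
      using LSy by (rule has_LS_integralE)
    have "emeasure \<mu> {c<..d} < \<infinity> \<and> emeasure \<nu> {c<..d} < \<infinity> \<and>
           F d - F c = measure \<mu> {c<..d} - measure \<nu> {c<..d}" if "t \<le> c" "c \<le> d" for c d
    proof (cases "c = d")
      case False
      have "{c<..d} \<subseteq> {s \<in> {t<..}. f s \<noteq> 0}"
      proof
        fix s assume "s \<in> {c<..d}"
        then have "t < s" using that by auto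
        with pos[of s] show "s \<in> {s \<in> {t<..}. f s \<noteq> 0}" by simp
      qed
      with I[rule_format, of c d] False that show ?thesis by simp
    qed simp
    with s i show ?thesis by blast
  qed
  obtain \<mu> \<nu> where s: "sets \<mu> = sets borel" "sets \<nu> = sets borel"
      and I: "\<And>c d. t \<le> c \<Longrightarrow> c \<le> d \<Longrightarrow> emeasure \<mu> {c<..d} < \<infinity> \<and> emeasure \<nu> {c<..d} < \<infinity> \<and>
           F d - F c = measure \<mu> {c<..d} - measure \<nu> {c<..d}"
      and i: "set_integrable \<mu> {t<..} f" "set_integrable \<nu> {t<..} f"
        and y: "y = (LINT s:{t<..}|\<mu>. f s) - (LINT s:{t<..}|\<nu>. f s)"
    using *[OF LS(1)] by metis
  obtain \<mu>' \<nu>' where s': "sets \<mu>' = sets borel" "sets \<nu>' = sets borel"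
      and I': "\<And>c d. t \<le> c \<Longrightarrow> c \<le> d \<Longrightarrow> emeasure \<mu>' {c<..d} < \<infinity> \<and> emeasure \<nu>' {c<..d} < \<infinity> \<and>
           F d - F c = measure \<mu>' {c<..d} - measure \<nu>' {c<..d}"
      and i': "set_integrable \<mu>' {t<..} f" "set_integrable \<nu>' {t<..} f"
        and y': "y' = (LINT s:{t<..}|\<mu>'. f s) - (LINT s:{t<..}|\<nu>'. f s)"
    using *[OF LS(2)] by metis
  define R where "R \<mu> = density \<mu> (indicator {t<..})" for \<mu> :: "real measure"
  have R: "sets (R \<mu>) = sets \<mu>" for \<mu> by (simp add: R_def)
  have Rem: "emeasure (R \<mu>) {a<..b} = emeasure \<mu> {max a t<..max (max a t) b}" if "sets \<mu> = sets borel" for \<mu> a b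
  proof -
    have "{t<..} \<inter> {a<..b} = {max a t<..max (max a t) b}" by auto
    then show ?thesis
      using that unfolding R_def
      by (subst emeasure_density)
         (auto simp: indicator_inter_arith[symmetric] cong: measurable_cong_sets)
  qed
  have fin: "emeasure \<mu> {c<..d} \<noteq> \<top>" "emeasure \<nu>' {c<..d} \<noteq> \<top>" if "t \<le> c" "c \<le> d" for c d
    using I[OF that, THEN conjunct1] I'[OF that, THEN conjunct2, THEN conjunct1] by auto
  have sum_eq: "sum_measure (R \<mu>) (R \<nu>') = sum_measure (R \<mu>') (R \<nu>)" (is "?L = ?R'")
  proof (rule measure_eqI_generator_eq[where E = "range (\<lambda>(a, b). {a<..b})" and \<Omega> = UNIV and A = "\<lambda>n::nat. {- real n<..real n}"])
    show "Int_stable (range (\<lambda>(a, b). {a<..b::real}))"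
    proof (rule Int_stableI)
      fix a b :: "real set" assume "a \<in> range (\<lambda>(a, b). {a<..b})" "b \<in> range (\<lambda>(a, b). {a<..b})"
      then obtain a1 a2 b1 b2 where "a = {a1<..a2}" "b = {b1<..b2}" by auto
      then have "a \<inter> b = {max a1 b1<..min a2 b2}" by auto
      then show "a \<inter> b \<in> range (\<lambda>(a, b). {a<..b})" by auto
    qed
    show "sets ?L = sigma_sets UNIV (range (\<lambda>(a, b). {a<..b}))"
      "sets ?R' = sigma_sets UNIV (range (\<lambda>(a, b). {a<..b}))"
      unfolding sets_sum_measure by (subst borel_sigma_sets_Ioc, simp add: sets_measure_of_conv)+
    have eq: "emeasure \<mu> {c<..d} + emeasure \<nu>' {c<..d} = emeasure \<mu>' {c<..d} + emeasure \<nu> {c<..d}"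
      if "t \<le> c" "c \<le> d" for c d
    proof -
      have "measure \<mu> {c<..d} + measure \<nu>' {c<..d} = measure \<mu>' {c<..d} + measure \<nu> {c<..d}"
        using I[OF that] I'[OF that] by linarith
      then show ?thesis
        using I[OF that, THEN conjunct1] I[OF that, THEN conjunct2, THEN conjunct1]
          I'[OF that, THEN conjunct1] I'[OF that, THEN conjunct2, THEN conjunct1]
        by (simp add: emeasure_eq_ennreal_measure less_top ennreal_plus[symmetric] del: ennreal_plus)
    qed
    fix X assume "X \<in> range (\<lambda>(a, b). {a<..b::real})"
    then obtain a b where X: "X = {a<..b}" by auto
    show "emeasure ?L X = emeasure ?R' X"
      unfolding X using s s' eq[of "max a t" "max (max a t) b"] by (simp add: emeasure_sum_measure R Rem)
  next
    show "(\<Union>n. {- real n<..real n}) = (UNIV :: real set)"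
    proof (intro set_eqI iffI UNIV_I)
      fix x :: real
      obtain n where "\<bar>x\<bar> < real n" using reals_Archimedean2 by blast
      then show "x \<in> (\<Union>n. {- real n<..real n})" by (intro UN_I[of n]) auto
    qed
    fix n :: nat
    show "emeasure ?L {- real n<..real n} \<noteq> \<infinity>"
      using s s' fin[of "max (- real n) t" "max (max (- real n) t) (real n)"]
      by (simp add: emeasure_sum_measure R Rem)
  qed auto
  define g where "g x = ennreal (indicator {t<..} x *\<^sub>R f x)" for x
  have "(\<lambda>x. indicator {t<..} x *\<^sub>R f x) \<in> borel_measurable borel"
    using i(1) s(1) unfolding set_integrable_def by (auto cong: measurable_cong_sets)
  then have g: "g \<in> borel_measurable borel" unfolding g_def by measurable
  have Rint: "(\<integral>\<^sup>+x. g x \<partial>R \<mu>) = ennreal (LINT s:{t<..}|\<mu>. f s)" 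
    if "sets \<mu> = sets borel" "set_integrable \<mu> {t<..} f" for \<mu>
  proof -
    have "(\<integral>\<^sup>+x. g x \<partial>R \<mu>) = (\<integral>\<^sup>+x. indicator {t<..} x * g x \<partial>\<mu>)"
      unfolding R_def using g that(1) by (intro nn_integral_density) (auto cong: measurable_cong_sets)
    also have "\<dots> = (\<integral>\<^sup>+x. ennreal (indicator {t<..} x *\<^sub>R f x) \<partial>\<mu>)"
      by (intro nn_integral_cong) (auto simp: g_def indicator_def)
    also have "\<dots> = ennreal (LINT s:{t<..}|\<mu>. f s)"
      unfolding set_lebesgue_integral_def
      using that(2) pos by (intro nn_integral_eq_integral) (auto simp: set_integrable_def indicator_def less_imp_le)
    finally show ?thesis .
  qed
  have nn: "0 \<le> (LINT s:{t<..}|\<mu>. f s)" for \<mu>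
    unfolding set_lebesgue_integral_def using pos by (intro Bochner_Integration.integral_nonneg) (auto simp: indicator_def less_imp_le)
  have "(\<integral>\<^sup>+x. g x \<partial>sum_measure (R \<mu>) (R \<nu>')) = (\<integral>\<^sup>+x. g x \<partial>sum_measure (R \<mu>') (R \<nu>))"
    by (simp only: sum_eq)
  then have "ennreal (LINT s:{t<..}|\<mu>. f s) + ennreal (LINT s:{t<..}|\<nu>'. f s) =
      ennreal (LINT s:{t<..}|\<mu>'. f s) + ennreal (LINT s:{t<..}|\<nu>. f s)"
    using s s' i i' g by (simp add: nn_integral_sum_measure R Rint)
  then have "(LINT s:{t<..}|\<mu>. f s) + (LINT s:{t<..}|\<nu>'. f s) = (LINT s:{t<..}|\<mu>'. f s) + (LINT s:{t<..}|\<nu>. f s)"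
    using nn by (simp add: ennreal_plus[symmetric] del: ennreal_plus)
  then show ?thesis using y y' by simp
qed

lemma tail_integral_right_cont:
  fixes h :: "real \<Rightarrow> real"
  assumes h: "set_integrable \<mu> {0<..} h" and s: "sets \<mu> = sets borel" and t: "0 \<le> t"
  shows "((\<lambda>u. LINT s:{u<..}|\<mu>. h s) \<longlongrightarrow> (LINT s:{t<..}|\<mu>. h s)) (at_right t)"
proof (rule tendsto_at_right_sequentially[of t "t + 1"])
  fix S :: "nat \<Rightarrow> real"
  assume S: "\<And>n. t < S n" "\<And>n. S n < t + 1" "decseq S" "S \<longlonglongrightarrow> t"
  have sub: "set_integrable \<mu> {u<..} h" if "0 \<le> u" for u
    using that s by (intro set_integrable_subset[OF h]) auto
  show "(\<lambda>n. LINT s:{S n<..}|\<mu>. h s) \<longlonglongrightarrow> (LINT s:{t<..}|\<mu>. h s)"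
    unfolding set_lebesgue_integral_def
  proof (rule integral_dominated_convergence[where w = "\<lambda>x. norm (indicator {0<..} x *\<^sub>R h x)"])
    show "integrable \<mu> (\<lambda>x. norm (indicator {0<..} x *\<^sub>R h x))"
      using h unfolding set_integrable_def by (rule integrable_norm)
    show "(\<lambda>x. indicator {t<..} x *\<^sub>R h x) \<in> borel_measurable \<mu>"
      using sub[OF t] by (auto simp: set_integrable_def)
    show "(\<lambda>x. indicator {S n<..} x *\<^sub>R h x) \<in> borel_measurable \<mu>" for n
      using sub[of "S n"] S(1)[of n] t by (auto simp: set_integrable_def)
    show "AE x in \<mu>. (\<lambda>n. indicator {S n<..} x *\<^sub>R h x) \<longlonglongrightarrow> indicator {t<..} x *\<^sub>R h x"
    proof (rule AE_I2, rule tendsto_eventually)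
      fix x
      show "eventually (\<lambda>n. indicator {S n<..} x *\<^sub>R h x = indicator {t<..} x *\<^sub>R h x) sequentially"
      proof (cases "t < x")
        case True
        with S(4) have "eventually (\<lambda>n. S n < x) sequentially" by (rule order_tendstoD)
        then show ?thesis by eventually_elim (use True in auto)
      next
        case False
        then have "\<not> S n < x" for n using S(1)[of n] by simp
        with False show ?thesis by simp
      qed
    qed
    show "AE x in \<mu>. norm (indicator {S n<..} x *\<^sub>R h x) \<le> norm (indicator {0<..} x *\<^sub>R h x)" for n
      using S(1)[of n] t by (intro AE_I2) (auto simp: indicator_def)
  qed
qed simp

text \<open>
  The measures that represent \<open>F\<close> may depend on \<open>t\<close>.  By uniqueness, those for \<open>t = 0\<close> serve for all \<open>t\<close>,
  so \<open>Y t\<close> is \<open>\<kappa> t / \<kappa> 0\<close> times a difference of tail integrals of one function.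
\<close>

lemma discounted_payments_right_cont:
  assumes \<kappa>: "cadlag \<kappa>" "0 < e" "\<And>t. 0 \<le> t \<Longrightarrow> e \<le> \<kappa> t"
    and Y: "\<And>t. 0 \<le> t \<Longrightarrow> has_LS_integral (\<lambda>s. \<kappa> t / \<kappa> s) F {t<..} (Y t)" and t: "0 \<le> t"
  shows "(Y \<longlongrightarrow> Y t) (at_right t)"
proof -
  have pos: "0 < \<kappa> t" if "0 \<le> t" for t using \<kappa>(2) \<kappa>(3)[OF that] by simp
  obtain \<mu> \<nu> where s: "sets \<mu> = sets borel" "sets \<nu> = sets borel"
    and I: "\<forall>c d. c < d \<longrightarrow> {c<..d} \<subseteq> {s \<in> {0<..}. \<kappa> 0 / \<kappa> s \<noteq> 0} \<longrightarrow>
         emeasure \<mu> {c<..d} < \<infinity> \<and> emeasure \<nu> {c<..d} < \<infinity> \<and>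
         F d - F c = measure \<mu> {c<..d} - measure \<nu> {c<..d}"
    and i: "set_integrable \<mu> {0<..} (\<lambda>s. \<kappa> 0 / \<kappa> s)" "set_integrable \<nu> {0<..} (\<lambda>s. \<kappa> 0 / \<kappa> s)"
    and Y0: "Y 0 = (LINT s:{0<..}|\<mu>. \<kappa> 0 / \<kappa> s) - (LINT s:{0<..}|\<nu>. \<kappa> 0 / \<kappa> s)"
    using Y[OF order_refl] by (rule has_LS_integralE)
  define G where "G u = (LINT s:{u<..}|\<mu>. \<kappa> 0 / \<kappa> s) - (LINT s:{u<..}|\<nu>. \<kappa> 0 / \<kappa> s)" for u
  have Yeq: "Y u = \<kappa> u / \<kappa> 0 * G u" if u: "0 \<le> u" for u
  proof (rule has_LS_integral_unique_tail[OF Y[OF u]])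
    show "0 < \<kappa> u / \<kappa> s" if "u < s" for s using pos[of u] pos[of s] u that by simp
    have sub: "set_integrable \<mu> {u<..} (\<lambda>s. \<kappa> 0 / \<kappa> s)" "set_integrable \<nu> {u<..} (\<lambda>s. \<kappa> 0 / \<kappa> s)"
      using u s by (simp_all add: set_integrable_subset[OF i(1)] set_integrable_subset[OF i(2)])
    have f: "(\<lambda>s. \<kappa> u / \<kappa> s) = (\<lambda>s. \<kappa> u / \<kappa> 0 * (\<kappa> 0 / \<kappa> s))"
      using pos[of 0] by auto
    show "has_LS_integral (\<lambda>s. \<kappa> u / \<kappa> s) F {u<..} (\<kappa> u / \<kappa> 0 * G u)"
      unfolding has_LS_integral_def
    proof (rule exI[of _ \<mu>], rule exI[of _ \<nu>], intro conjI allI impI s)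
      fix c d :: real assume cd: "c < d" "{c<..d} \<subseteq> {s \<in> {u<..}. \<kappa> u / \<kappa> s \<noteq> 0}"
      have "{c<..d} \<subseteq> {s \<in> {0<..}. \<kappa> 0 / \<kappa> s \<noteq> 0}"
      proof
        fix s assume "s \<in> {c<..d}"
        with cd(2) have "u < s" by auto
        then show "s \<in> {s \<in> {0<..}. \<kappa> 0 / \<kappa> s \<noteq> 0}" using u pos[of s] pos[of 0] by simp
      qed
      from I[rule_format, OF cd(1) this] show "emeasure \<mu> {c<..d} < \<infinity>" "emeasure \<nu> {c<..d} < \<infinity>"
        "F d - F c = measure \<mu> {c<..d} - measure \<nu> {c<..d}" by auto
    next
      show "set_integrable \<mu> {u<..} (\<lambda>s. \<kappa> u / \<kappa> s)" "set_integrable \<nu> {u<..} (\<lambda>s. \<kappa> u / \<kappa> s)"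
        unfolding f by (intro set_integrable_mult_right sub)+
      show "\<kappa> u / \<kappa> 0 * G u = (LINT s:{u<..}|\<mu>. \<kappa> u / \<kappa> s) - (LINT s:{u<..}|\<nu>. \<kappa> u / \<kappa> s)"
        unfolding f G_def set_integral_mult_right by (simp only: right_diff_distrib)
    qed
  qed
  have "((\<lambda>u. \<kappa> u / \<kappa> 0 * G u) \<longlongrightarrow> \<kappa> t / \<kappa> 0 * G t) (at_right t)"
    unfolding G_def using \<kappa>(1) t pos[of 0]
    by (intro tendsto_intros tail_integral_right_cont i s) (auto simp: cadlag_def)
  then show ?thesis unfolding Yeq[OF t]
    by (rule tendsto_right_cong[of t "t + 1", rotated 2]) (use t Yeq in auto)
qed

section \<open>Conditional expectation processes and nested events\<close>

text \<open>
  Rational times strictly above \<open>t\<close> that tend to \<open>t\<close>.  Fixing one sequence makes right limits along the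
  rationals measurable in the sample point.
\<close>

definition dyadic_above :: "nat \<Rightarrow> real \<Rightarrow> real" where
  "dyadic_above n t = (of_int \<lfloor>2 ^ n * t\<rfloor> + 1) / 2 ^ n"

lemma dyadic_above_rat: "dyadic_above n t \<in> \<rat>"
  by (simp add: dyadic_above_def)

lemma dyadic_above_gt: "t < dyadic_above n t"
  unfolding dyadic_above_def by (simp add: field_simps) linarith

lemma dyadic_above_le: "dyadic_above n t \<le> t + 1 / 2 ^ n"
  unfolding dyadic_above_def by (simp add: field_simps)

lemma dyadic_above_tendsto: "(\<lambda>n. dyadic_above n t) \<longlonglongrightarrow> t"
proof (rule tendsto_sandwich[of "\<lambda>_. t" _ _ "\<lambda>n. t + 1 / 2 ^ n"])
  have "(\<lambda>n. t + (1 / 2) ^ n) \<longlonglongrightarrow> t + 0" by (intro tendsto_intros LIMSEQ_power_zero) simp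
  then show "(\<lambda>n. t + 1 / 2 ^ n) \<longlonglongrightarrow> t" by (simp add: power_one_over)
qed (auto intro!: always_eventually dyadic_above_le less_imp_le[OF dyadic_above_gt])

lemma dyadic_above_at_right: "filterlim (\<lambda>n. dyadic_above n t) (at_right t) sequentially"
  using dyadic_above_tendsto dyadic_above_gt by (auto intro!: tendsto_imp_filterlim_at_right always_eventually)

lemma right_cont_eq_on_rats:
  fixes f g :: "real \<Rightarrow> real"
  assumes "(f \<longlongrightarrow> f t) (at_right t)" "(g \<longlongrightarrow> g t) (at_right t)"
    and "\<And>q. q \<in> \<rat> \<Longrightarrow> t < q \<Longrightarrow> f q = g q"
  shows "f t = g t"
proof (rule LIMSEQ_unique)
  show "(\<lambda>n. f (dyadic_above n t)) \<longlonglongrightarrow> f t"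
    by (rule filterlim_compose[OF assms(1) dyadic_above_at_right])
  have "(\<lambda>n. g (dyadic_above n t)) \<longlonglongrightarrow> g t"
    by (rule filterlim_compose[OF assms(2) dyadic_above_at_right])
  then show "(\<lambda>n. f (dyadic_above n t)) \<longlonglongrightarrow> g t"
    using assms(3)[OF dyadic_above_rat dyadic_above_gt] by simp
qed

definition right_limit_of :: "(real \<Rightarrow> real) \<Rightarrow> real \<Rightarrow> real" where
  "right_limit_of p t = (INF r\<in>{r \<in> \<rat>. max t 0 < r}. p r)"

lemma
  assumes p: "\<And>q r. q \<in> \<rat> \<Longrightarrow> r \<in> \<rat> \<Longrightarrow> 0 \<le> q \<Longrightarrow> q \<le> r \<Longrightarrow> p q \<le> p r"
  shows control_right_limit_of: "control (right_limit_of p)"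
    and right_limit_of_dyadic: "0 \<le> t \<Longrightarrow> (\<lambda>n. p (dyadic_above n t)) \<longlonglongrightarrow> right_limit_of p t"
proof -
  have bdd: "bdd_below (p ` {r \<in> \<rat>. max t 0 < r})" for t
    by (rule bdd_belowI2[of _ "p 0"]) (auto intro!: p)
  have ne: "{r \<in> \<rat>. max t 0 < r} \<noteq> {}" for t :: real
    using Rats_dense_in_real[of "max t 0" "max t 0 + 1"] by auto
  have near: "\<exists>r\<in>\<rat>. max t 0 < r \<and> p r < a" if "right_limit_of p t < a" for t a
    using that cINF_less_iff[OF ne bdd] unfolding right_limit_of_def by auto
  have low: "right_limit_of p t \<le> p r" if "r \<in> \<rat>" "max t 0 < r" for t r
    unfolding right_limit_of_def using that by (intro cINF_lower bdd) auto
  have m: "right_limit_of p s \<le> right_limit_of p u" if "s \<le> u" for s u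
    unfolding right_limit_of_def[of p u] using that by (intro cINF_greatest ne low) auto
  show "control (right_limit_of p)"
    unfolding control_def continuous_within
  proof (intro conjI allI)
    show "mono (right_limit_of p)" by (rule monoI) (rule m)
    fix t
    show "(right_limit_of p \<longlongrightarrow> right_limit_of p t) (at_right t)"
    proof (rule order_tendstoI)
      fix a assume a: "a < right_limit_of p t"
      have "a < right_limit_of p u" if "t < u" for u
        using a m[OF less_imp_le[OF that]] by (rule less_le_trans)
      then show "eventually (\<lambda>u. a < right_limit_of p u) (at_right t)"
        unfolding eventually_at_right_field by (intro exI[of _ "t+1"]) simp
    next
      fix a assume "right_limit_of p t < a"
      then obtain r where r: "r \<in> \<rat>" "max t 0 < r" "p r < a" using near by blast
      then show "eventually (\<lambda>u. right_limit_of p u < a) (at_right t)"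
        unfolding eventually_at_right_field
        by (intro exI[of _ r] conjI allI impI le_less_trans[OF low r(3)]) auto
    qed
  qed
  assume t: "0 \<le> t"
  show "(\<lambda>n. p (dyadic_above n t)) \<longlonglongrightarrow> right_limit_of p t"
  proof (rule order_tendstoI)
    fix a assume "a < right_limit_of p t"
    also have "right_limit_of p t \<le> p (dyadic_above n t)" for n
      using t dyadic_above_gt[of t n] by (intro low dyadic_above_rat) auto
    finally show "eventually (\<lambda>n. a < p (dyadic_above n t)) sequentially" by simp
  next
    fix a assume "right_limit_of p t < a"
    then obtain r where r: "r \<in> \<rat>" "max t 0 < r" "p r < a" using near by blast
    have "eventually (\<lambda>n. dyadic_above n t < r) sequentially"
      using dyadic_above_tendsto r(2) by (intro order_tendstoD(2)) auto
    then show "eventually (\<lambda>n. p (dyadic_above n t) < a) sequentially"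
    proof eventually_elim
      case (elim n)
      then have "p (dyadic_above n t) \<le> p r"
        using t dyadic_above_gt[of t n] r(1) by (intro p dyadic_above_rat) auto
      with r(3) show ?case by simp
    qed
  qed
qed

context finite_measure_subalgebra
begin

text \<open>
  The conditional expectations of \<open>P q\<close> and of \<open>Q q\<close> almost surely increase along the rational \<open>q\<close>, so
  their right limits exist at all times simultaneously.  The difference of the two limits is the
  required process and their sum controls it.  Dominated convergence along \<^const>\<open>dyadic_above\<close>
  identifies the process at time \<open>t\<close> with the conditional expectation of \<open>X t\<close>.
\<close>

lemma cond_exp_process_exists:
  assumes X: "\<And>t. 0 \<le> t \<Longrightarrow> integrable M (X t)"
    and P: "\<And>q. q \<in> \<rat> \<Longrightarrow> 0 \<le> q \<Longrightarrow> integrable M (P q)"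
    and Q: "\<And>q. q \<in> \<rat> \<Longrightarrow> 0 \<le> q \<Longrightarrow> integrable M (Q q)"
    and mono: "AE \<omega> in M. \<forall>q\<in>\<rat>. \<forall>r\<in>\<rat>. 0 \<le> q \<longrightarrow> q \<le> r \<longrightarrow> P q \<omega> \<le> P r \<omega> \<and> Q q \<omega> \<le> Q r \<omega>"
    and eq: "AE \<omega> in M. \<forall>q\<in>\<rat>. 0 \<le> q \<longrightarrow> X q \<omega> = P q \<omega> - Q q \<omega>"
    and rc: "AE \<omega> in M. \<forall>t\<ge>0. ((\<lambda>s. X s \<omega>) \<longlongrightarrow> X t \<omega>) (at_right t)"
  shows "\<exists>C. is_cond_exp_process M F X C \<and> (AE \<omega> in M. \<exists>m. control m \<and> (\<forall>b. controlled (\<lambda>t. C t \<omega>) m 0 b))"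
proof -
  define p where "p q = real_cond_exp M F (P q)" for q
  define n where "n q = real_cond_exp M F (Q q)" for q
  define C where "C t \<omega> = lim (\<lambda>k. p (dyadic_above k t) \<omega> - n (dyadic_above k t) \<omega>)" for t \<omega>
  have C_meas: "C t \<in> borel_measurable F" for t
    unfolding C_def p_def n_def by (intro borel_measurable_lim_metric) auto
  have rat_mono: "AE \<omega> in M. \<forall>q\<in>\<rat>. \<forall>r\<in>\<rat>. 0 \<le> q \<longrightarrow> q \<le> r \<longrightarrow>
      real_cond_exp M F (R q) \<omega> \<le> real_cond_exp M F (R r) \<omega>"
    if int: "\<And>q. q \<in> \<rat> \<Longrightarrow> 0 \<le> q \<Longrightarrow> integrable M (R q)"
      and R: "AE \<omega> in M. \<forall>q\<in>\<rat>. \<forall>r\<in>\<rat>. 0 \<le> q \<longrightarrow> q \<le> r \<longrightarrow> R q \<omega> \<le> R r \<omega>" for R :: "real \<Rightarrow> 'a \<Rightarrow> real"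
  proof (intro AE_ball_countable' countable_rat)
    fix q r :: real assume qr: "q \<in> \<rat>" "r \<in> \<rat>"
    show "AE \<omega> in M. 0 \<le> q \<longrightarrow> q \<le> r \<longrightarrow> real_cond_exp M F (R q) \<omega> \<le> real_cond_exp M F (R r) \<omega>"
    proof (cases "0 \<le> q \<and> q \<le> r")
      case True
      have "AE \<omega> in M. R q \<omega> \<le> R r \<omega>" using R by eventually_elim (use qr True in auto)
      then have "AE \<omega> in M. real_cond_exp M F (R q) \<omega> \<le> real_cond_exp M F (R r) \<omega>"
        using int qr True by (intro real_cond_exp_mono) auto
      then show ?thesis by eventually_elim simp
    qed auto
  qed
  have "AE \<omega> in M. \<forall>q\<in>\<rat>. \<forall>r\<in>\<rat>. 0 \<le> q \<longrightarrow> q \<le> r \<longrightarrow> p q \<omega> \<le> p r \<omega>"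
    unfolding p_def by (rule rat_mono[OF P]) (use mono in \<open>auto elim: eventually_mono\<close>)
  moreover have "AE \<omega> in M. \<forall>q\<in>\<rat>. \<forall>r\<in>\<rat>. 0 \<le> q \<longrightarrow> q \<le> r \<longrightarrow> n q \<omega> \<le> n r \<omega>"
    unfolding n_def by (rule rat_mono[OF Q]) (use mono in \<open>auto elim: eventually_mono\<close>)
  ultimately have good: "AE \<omega> in M. \<forall>q\<in>\<rat>. \<forall>r\<in>\<rat>. 0 \<le> q \<longrightarrow> q \<le> r \<longrightarrow> p q \<omega> \<le> p r \<omega> \<and> n q \<omega> \<le> n r \<omega>"
    by eventually_elim blast
  have lim: "AE \<omega> in M. control (right_limit_of (\<lambda>q. p q \<omega>)) \<and> control (right_limit_of (\<lambda>q. n q \<omega>)) \<and>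
     (\<forall>t\<ge>0. (\<lambda>k. p (dyadic_above k t) \<omega> - n (dyadic_above k t) \<omega>) \<longlonglongrightarrow> C t \<omega> \<and>
       C t \<omega> = right_limit_of (\<lambda>q. p q \<omega>) t - right_limit_of (\<lambda>q. n q \<omega>) t)"
    using good
  proof eventually_elim
    case (elim \<omega>)
    have *: "(\<lambda>k. p (dyadic_above k t) \<omega> - n (dyadic_above k t) \<omega>) \<longlonglongrightarrow>
        right_limit_of (\<lambda>q. p q \<omega>) t - right_limit_of (\<lambda>q. n q \<omega>) t" if "0 \<le> t" for t
      using elim that by (intro tendsto_diff right_limit_of_dyadic) auto
    with limI[OF this] show ?case
      using elim by (auto simp: C_def intro!: control_right_limit_of)
  qed
  have ctrl: "AE \<omega> in M. \<exists>m. control m \<and> (\<forall>b. controlled (\<lambda>t. C t \<omega>) m 0 b)"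
    using lim
  proof eventually_elim
    case (elim \<omega>)
    let ?p = "right_limit_of (\<lambda>q. p q \<omega>)" and ?n = "right_limit_of (\<lambda>q. n q \<omega>)"
    have "controlled (\<lambda>t. C t \<omega>) (\<lambda>t. ?p t + ?n t) 0 b" for b
      unfolding controlled_def
    proof (intro allI impI)
      fix s u :: real assume "0 \<le> s" "s \<le> u" "u \<le> b"
      moreover from this have "?p s \<le> ?p u" "?n s \<le> ?n u" using elim by (auto intro: controlD)
      moreover have "C s \<omega> = ?p s - ?n s" "C u \<omega> = ?p u - ?n u" using elim calculation by auto
      ultimately show "\<bar>C u \<omega> - C s \<omega>\<bar> \<le> ?p u + ?n u - (?p s + ?n s)" by linarith
    qed
    moreover have "control (\<lambda>t. ?p t + ?n t)" using elim by (intro control_add) auto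
    ultimately show ?case by blast
  qed
  have version: "AE \<omega> in M. C t \<omega> = real_cond_exp M F (X t) \<omega>" if t: "0 \<le> t" for t
  proof -
    define r where "r k = dyadic_above k t" for k
    obtain K where K: "K \<in> \<rat>" "t + 1 < K" using Rats_dense_in_real[of "t+1" "t+2"] by auto
    have r: "r k \<in> \<rat>" "0 \<le> r k" "r k \<le> K" "t < r k" for k
    proof -
      show "r k \<in> \<rat>" "t < r k" by (simp_all add: r_def dyadic_above_rat dyadic_above_gt)
      then show "0 \<le> r k" using t by simp
      have "1 / 2 ^ k \<le> (1 :: real)" by simp
      then show "r k \<le> K" using dyadic_above_le[of k t] K unfolding r_def by linarith
    qed
    have Kint: "integrable M (P 0)" "integrable M (P K)" "integrable M (Q 0)" "integrable M (Q K)"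
      using P Q K t by auto
    have cint: "integrable M (p 0)" "integrable M (p K)" "integrable M (n 0)" "integrable M (n K)"
      unfolding p_def n_def using Kint by auto
    have Xr: "(\<lambda>k. X (r k) \<omega>) \<longlonglongrightarrow> X t \<omega>" if "((\<lambda>s. X s \<omega>) \<longlongrightarrow> X t \<omega>) (at_right t)" for \<omega>
      unfolding r_def by (rule filterlim_compose[OF that dyadic_above_at_right])
    have bnd: "\<bar>a - b\<bar> \<le> \<bar>a0\<bar> + \<bar>a1\<bar> + \<bar>b0\<bar> + \<bar>b1\<bar>" if "a0 \<le> a" "a \<le> a1" "b0 \<le> b" "b \<le> b1"
      for a b a0 a1 b0 b1 :: real using that by linarith
    have rint: "integrable M (P (r k))" "integrable M (Q (r k))" for k using P Q r by auto
    have rcint: "integrable M (p (r k))" "integrable M (n (r k))" for k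
      unfolding p_def n_def using rint by auto
    have Cint: "integrable M (C t)"
    proof (rule integrable_dominated_convergence[where s = "\<lambda>k \<omega>. p (r k) \<omega> - n (r k) \<omega>"
          and w = "\<lambda>\<omega>. \<bar>p 0 \<omega>\<bar> + \<bar>p K \<omega>\<bar> + \<bar>n 0 \<omega>\<bar> + \<bar>n K \<omega>\<bar>"])
      show "C t \<in> borel_measurable M" using C_meas measurable_from_subalg[OF subalg] by blast
      show "(\<lambda>\<omega>. p (r k) \<omega> - n (r k) \<omega>) \<in> borel_measurable M" for k
        using rcint by (intro borel_measurable_diff) auto
      show "AE \<omega> in M. (\<lambda>k. p (r k) \<omega> - n (r k) \<omega>) \<longlonglongrightarrow> C t \<omega>"
        using lim
      proof eventually_elim
        case (elim \<omega>)
        with t show ?case unfolding r_def by blast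
      qed
      show "AE \<omega> in M. norm (p (r k) \<omega> - n (r k) \<omega>) \<le> \<bar>p 0 \<omega>\<bar> + \<bar>p K \<omega>\<bar> + \<bar>n 0 \<omega>\<bar> + \<bar>n K \<omega>\<bar>" for k
        using good by eventually_elim (use r[of k] K in \<open>auto intro!: bnd\<close>)
      show "integrable M (\<lambda>\<omega>. \<bar>p 0 \<omega>\<bar> + \<bar>p K \<omega>\<bar> + \<bar>n 0 \<omega>\<bar> + \<bar>n K \<omega>\<bar>)" using cint by auto
    qed
    have "AE \<omega> in M. real_cond_exp M F (X t) \<omega> = C t \<omega>"
    proof (rule real_cond_exp_charact[OF _ X[OF t] Cint C_meas])
      fix A assume A: "A \<in> sets F"
      then have AM: "A \<in> sets M" using subalg by (auto simp: subalgebra_def)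
      have "(\<lambda>k. LINT \<omega>:A|M. X (r k) \<omega>) \<longlonglongrightarrow> (LINT \<omega>:A|M. X t \<omega>)"
        unfolding set_lebesgue_integral_def
      proof (rule integral_dominated_convergence[where w = "\<lambda>\<omega>. \<bar>P 0 \<omega>\<bar> + \<bar>P K \<omega>\<bar> + \<bar>Q 0 \<omega>\<bar> + \<bar>Q K \<omega>\<bar>"])
        show "(\<lambda>\<omega>. indicator A \<omega> *\<^sub>R X t \<omega>) \<in> borel_measurable M"
          "\<And>k. (\<lambda>\<omega>. indicator A \<omega> *\<^sub>R X (r k) \<omega>) \<in> borel_measurable M"
          using X[OF t] X[OF r(2)] AM by auto
        show "AE \<omega> in M. (\<lambda>k. indicator A \<omega> *\<^sub>R X (r k) \<omega>) \<longlonglongrightarrow> indicator A \<omega> *\<^sub>R X t \<omega>"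
          using rc
        proof eventually_elim
          case (elim \<omega>)
          with t show ?case by (intro tendsto_scaleR tendsto_const Xr) blast
        qed
        show "AE \<omega> in M. norm (indicator A \<omega> *\<^sub>R X (r k) \<omega>) \<le> \<bar>P 0 \<omega>\<bar> + \<bar>P K \<omega>\<bar> + \<bar>Q 0 \<omega>\<bar> + \<bar>Q K \<omega>\<bar>" for k
          using mono eq
        proof eventually_elim
          case (elim \<omega>)
          have "\<bar>X (r k) \<omega>\<bar> \<le> \<bar>P 0 \<omega>\<bar> + \<bar>P K \<omega>\<bar> + \<bar>Q 0 \<omega>\<bar> + \<bar>Q K \<omega>\<bar>"
            using elim r[of k] K by (simp add: bnd)
          then show ?case by (auto simp: indicator_def)
        qed
        show "integrable M (\<lambda>\<omega>. \<bar>P 0 \<omega>\<bar> + \<bar>P K \<omega>\<bar> + \<bar>Q 0 \<omega>\<bar> + \<bar>Q K \<omega>\<bar>)" using Kint by auto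
      qed
      moreover have "(\<lambda>k. LINT \<omega>:A|M. p (r k) \<omega> - n (r k) \<omega>) \<longlonglongrightarrow> (LINT \<omega>:A|M. C t \<omega>)"
        unfolding set_lebesgue_integral_def
      proof (rule integral_dominated_convergence[where w = "\<lambda>\<omega>. \<bar>p 0 \<omega>\<bar> + \<bar>p K \<omega>\<bar> + \<bar>n 0 \<omega>\<bar> + \<bar>n K \<omega>\<bar>"])
        show "(\<lambda>\<omega>. indicator A \<omega> *\<^sub>R C t \<omega>) \<in> borel_measurable M"
          "\<And>k. (\<lambda>\<omega>. indicator A \<omega> *\<^sub>R (p (r k) \<omega> - n (r k) \<omega>)) \<in> borel_measurable M"
          using Cint rcint AM by auto
        show "AE \<omega> in M. (\<lambda>k. indicator A \<omega> *\<^sub>R (p (r k) \<omega> - n (r k) \<omega>)) \<longlonglongrightarrow> indicator A \<omega> *\<^sub>R C t \<omega>"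
          using lim
        proof eventually_elim
          case (elim \<omega>)
          with t show ?case unfolding r_def by (intro tendsto_scaleR tendsto_const) blast
        qed
        show "AE \<omega> in M. norm (indicator A \<omega> *\<^sub>R (p (r k) \<omega> - n (r k) \<omega>)) \<le> \<bar>p 0 \<omega>\<bar> + \<bar>p K \<omega>\<bar> + \<bar>n 0 \<omega>\<bar> + \<bar>n K \<omega>\<bar>" for k
          using good
        proof eventually_elim
          case (elim \<omega>)
          have "\<bar>p (r k) \<omega> - n (r k) \<omega>\<bar> \<le> \<bar>p 0 \<omega>\<bar> + \<bar>p K \<omega>\<bar> + \<bar>n 0 \<omega>\<bar> + \<bar>n K \<omega>\<bar>"
            using elim r[of k] K by (intro bnd) auto
          then show ?case by (auto simp: indicator_def)
        qed
        show "integrable M (\<lambda>\<omega>. \<bar>p 0 \<omega>\<bar> + \<bar>p K \<omega>\<bar> + \<bar>n 0 \<omega>\<bar> + \<bar>n K \<omega>\<bar>)" using cint by auto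
      qed
      moreover have "(LINT \<omega>:A|M. X (r k) \<omega>) = (LINT \<omega>:A|M. p (r k) \<omega> - n (r k) \<omega>)" for k
      proof -
        have XX: "integrable M (X (r k))" using X r by auto
        have "AE \<omega> in M. X (r k) \<omega> = P (r k) \<omega> - Q (r k) \<omega>" using eq by eventually_elim (use r[of k] in auto)
        then have "AE \<omega> in M. real_cond_exp M F (X (r k)) \<omega> = real_cond_exp M F (\<lambda>\<omega>. P (r k) \<omega> - Q (r k) \<omega>) \<omega>"
          using XX rint by (intro real_cond_exp_cong) auto
        moreover have "AE \<omega> in M. real_cond_exp M F (\<lambda>\<omega>. P (r k) \<omega> - Q (r k) \<omega>) \<omega> = p (r k) \<omega> - n (r k) \<omega>"
          unfolding p_def n_def using rint by auto
        ultimately have "AE \<omega> in M. real_cond_exp M F (X (r k)) \<omega> = p (r k) \<omega> - n (r k) \<omega>" by eventually_elim simp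
        then have "(LINT \<omega>:A|M. real_cond_exp M F (X (r k)) \<omega>) = (LINT \<omega>:A|M. p (r k) \<omega> - n (r k) \<omega>)"
          using AM rcint by (intro set_lebesgue_integral_cong_AE) (auto intro!: borel_measurable_diff)
        then show ?thesis using real_cond_exp_intA[OF XX A] by simp
      qed
      ultimately show "(LINT \<omega>:A|M. X t \<omega>) = (LINT \<omega>:A|M. C t \<omega>)"
        by (simp add: LIMSEQ_unique)
    qed
    then show ?thesis by eventually_elim simp
  qed
  have "AE \<omega> in M. cadlag (\<lambda>t. C t \<omega>)"
    using ctrl by eventually_elim (auto intro: controlled_cadlag_fv)
  with version C_meas ctrl show ?thesis unfolding is_cond_exp_process_def by blast
qed

text \<open>
  Two versions agree at all rational times, hence at all times by right-continuity.  So the version that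
  the choice operator picks inherits the control.
\<close>

lemma cond_exp_process_version:
  assumes "is_cond_exp_process M F X C" "AE \<omega> in M. \<exists>m. control m \<and> (\<forall>b. controlled (\<lambda>t. C t \<omega>) m 0 b)"
  shows "is_cond_exp_process M F X (cond_exp_process M F X)"
    and "AE \<omega> in M. \<exists>m. control m \<and> (\<forall>b. controlled (\<lambda>t. cond_exp_process M F X t \<omega>) m 0 b)"
proof -
  let ?D = "cond_exp_process M F X"
  show D: "is_cond_exp_process M F X ?D"
    unfolding cond_exp_process_def by (rule someI[of _ C]) (rule assms)
  have "AE \<omega> in M. \<forall>q\<in>\<rat>. 0 \<le> q \<longrightarrow> C q \<omega> = ?D q \<omega>"
  proof (intro AE_ball_countable' countable_rat)
    fix q :: real
    show "AE \<omega> in M. 0 \<le> q \<longrightarrow> C q \<omega> = ?D q \<omega>"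
    proof (cases "0 \<le> q")
      case True
      then have "AE \<omega> in M. C q \<omega> = real_cond_exp M F (X q) \<omega>" "AE \<omega> in M. ?D q \<omega> = real_cond_exp M F (X q) \<omega>"
        using assms(1) D unfolding is_cond_exp_process_def by auto
      then show ?thesis by eventually_elim simp
    qed simp
  qed
  moreover have "AE \<omega> in M. cadlag (\<lambda>t. C t \<omega>)" "AE \<omega> in M. cadlag (\<lambda>t. ?D t \<omega>)"
    using assms(1) D unfolding is_cond_exp_process_def by auto
  ultimately show "AE \<omega> in M. \<exists>m. control m \<and> (\<forall>b. controlled (\<lambda>t. ?D t \<omega>) m 0 b)"
    using assms(2)
  proof eventually_elim
    case (elim \<omega>)
    have "C t \<omega> = ?D t \<omega>" if "0 \<le> t" for t
      by (rule right_cont_eq_on_rats) (use elim that in \<open>auto simp: cadlag_def\<close>)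
    then have "controlled (\<lambda>t. ?D t \<omega>) m 0 b" if "controlled (\<lambda>t. C t \<omega>) m 0 b" for m b
      using that unfolding controlled_def by simp
    with elim(4) show ?case by blast
  qed
qed

text \<open>
  Let \<open>A i0\<close> be the largest event.  Where its conditional probability is below \<open>e\<close>, which is an event of
  \<open>F\<close>, the set in question lies inside \<open>A i0\<close>, so its mass there is at most \<open>e\<close> times that of the
  \<open>F\<close>-event.  On the complement \<open>i0\<close> can be dropped from the chain.  The auxiliary event \<open>D\<close> of \<open>F\<close>
  carries this restriction through the induction.
\<close>

lemma chain_finite:
  assumes "finite J" and A: "\<And>i. i \<in> J \<Longrightarrow> A i \<in> sets M"
    and chain: "\<And>i j. i \<in> J \<Longrightarrow> j \<in> J \<Longrightarrow> A i \<subseteq> A j \<or> A j \<subseteq> A i"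
    and D: "D \<in> sets F" and "0 \<le> e"
  shows "measure M {\<omega> \<in> D. \<exists>i\<in>J. \<omega> \<in> A i \<and> real_cond_exp M F (indicator (A i)) \<omega> < e} \<le> e * measure M D"
  using assms(1-4)
proof (induction J arbitrary: D rule: finite_psubset_induct)
  case (psubset J)
  define H where "H i = real_cond_exp M F (indicator (A i))" for i
  have H: "H i \<in> borel_measurable F" for i by (simp add: H_def)
  have sp: "space F = space M" and FM: "sets F \<subseteq> sets M" using subalg by (auto simp: subalgebra_def)
  have meas: "{\<omega> \<in> D. \<exists>i\<in>K. \<omega> \<in> A i \<and> H i \<omega> < e} \<in> sets M" if "K \<subseteq> J" "D \<in> sets F" for K D
  proof -
    have "{\<omega> \<in> D. \<exists>i\<in>K. \<omega> \<in> A i \<and> H i \<omega> < e} = D \<inter> (\<Union>i\<in>K. A i \<inter> {\<omega> \<in> space F. H i \<omega> < e})"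
      using sets.sets_into_space[OF that(2)] by auto
    moreover have "{\<omega> \<in> space F. H i \<omega> < e} \<in> sets F" for i using H by measurable
    moreover have "finite K" using that psubset(1) finite_subset by blast
    ultimately show ?thesis
      using psubset(3) that FM by (auto intro!: sets.Int sets.finite_UN)
  qed
  show ?case
  proof (cases "J = {}")
    case True
    then show ?thesis using \<open>0 \<le> e\<close> by simp
  next
    case False
    then have "finite (A ` J)" "A ` J \<noteq> {}" using psubset(1) by auto
    from finite_has_maximal[OF this] obtain i0 where i0: "i0 \<in> J" "\<And>j. j \<in> J \<Longrightarrow> A i0 \<subseteq> A j \<Longrightarrow> A i0 = A j"
      by auto
    have top: "A j \<subseteq> A i0" if "j \<in> J" for j using psubset(4)[OF i0(1) that] i0(2)[OF that] by auto
    have lt: "{\<omega> \<in> space F. H i0 \<omega> < e} \<in> sets F" using H by measurable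
    define D1 where "D1 = D \<inter> {\<omega> \<in> space F. H i0 \<omega> < e}"
    define D2 where "D2 = D - {\<omega> \<in> space F. H i0 \<omega> < e}"
    have D12: "D1 \<in> sets F" "D2 \<in> sets F" using psubset(5) lt by (auto simp: D1_def D2_def)
    have DM: "D1 \<in> sets M" "D2 \<in> sets M" using D12 FM by auto
    have A0: "A i0 \<in> sets M" using psubset(3) i0 by auto
    let ?B = "\<lambda>K D. {\<omega> \<in> D. \<exists>i\<in>K. \<omega> \<in> A i \<and> H i \<omega> < e}"
    have "?B J D \<subseteq> (A i0 \<inter> D1) \<union> ?B (J - {i0}) D2"
      using top sets.sets_into_space[OF psubset(5)] by (auto simp: D1_def D2_def)
    then have "measure M (?B J D) \<le> measure M ((A i0 \<inter> D1) \<union> ?B (J - {i0}) D2)"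
      using A0 DM meas[of "J - {i0}" D2] D12 by (intro finite_measure_mono) auto
    also have "\<dots> \<le> measure M (A i0 \<inter> D1) + measure M (?B (J - {i0}) D2)"
      using A0 DM meas[of "J - {i0}" D2] D12 by (intro measure_Un_le) auto
    also have "measure M (A i0 \<inter> D1) \<le> e * measure M D1"
    proof -
      have int: "integrable M (indicator (A i0) :: 'a \<Rightarrow> real)" using A0 by (simp add: emeasure_finite less_top[symmetric])
      have "measure M (A i0 \<inter> D1) = (LINT \<omega>:D1|M. indicator (A i0) \<omega>)"
        unfolding set_lebesgue_integral_def using A0 DM sets.sets_into_space[OF A0]
        by (simp add: indicator_inter_arith[symmetric] Int_commute Int_absorb1 Int_assoc)
      also have "\<dots> = (LINT \<omega>:D1|M. H i0 \<omega>)" unfolding H_def by (rule real_cond_exp_intA[OF int D12(1)])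
      also have "\<dots> \<le> (LINT \<omega>:D1|M. e)"
      proof (rule set_integral_mono)
        show "set_integrable M D1 (H i0)" unfolding set_integrable_def H_def
          by (rule integrable_mult_indicator[OF DM(1) real_cond_exp_int(1)[OF int]])
        show "set_integrable M D1 (\<lambda>_. e)" unfolding set_integrable_def
          by (rule integrable_mult_indicator[OF DM(1)]) simp
      qed (auto simp: D1_def)
      also have "\<dots> = e * measure M D1" using DM by (simp add: set_lebesgue_integral_def sets.sets_into_space Int_absorb2)
      finally show ?thesis .
    qed
    also have "measure M (?B (J - {i0}) D2) \<le> e * measure M D2"
      unfolding H_def using i0 psubset(3,4) D12 by (intro psubset(2)) auto
    also have "e * measure M D1 + e * measure M D2 = e * measure M D"
    proof -
      have "measure M D = measure M (D1 \<union> D2)" by (rule arg_cong[of _ _ "measure M"]) (auto simp: D1_def D2_def)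
      also have "\<dots> = measure M D1 + measure M D2"
        using DM by (intro finite_measure_Union) (auto simp: D1_def D2_def)
      finally show ?thesis by (simp add: distrib_left)
    qed
    finally show ?thesis by (simp add: H_def)
  qed
qed

text \<open>
  The bound of \<open>chain_finite\<close> does not depend on the length of the chain, so by continuity of the measure
  it holds for the countable chain.  Then let \<open>e\<close> tend to zero.
\<close>

lemma chain_cond_exp_pos:
  assumes I: "countable I" and A: "\<And>i. i \<in> I \<Longrightarrow> A i \<in> sets M"
    and chain: "\<And>i j. i \<in> I \<Longrightarrow> j \<in> I \<Longrightarrow> A i \<subseteq> A j \<or> A j \<subseteq> A i"
  shows "AE \<omega> in M. \<exists>e>0. \<forall>i\<in>I. \<omega> \<in> A i \<longrightarrow> e \<le> real_cond_exp M F (indicator (A i)) \<omega>"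
proof (cases "I = {}")
  case False
  define H where "H i = real_cond_exp M F (indicator (A i))" for i
  have H: "H i \<in> borel_measurable M" for i by (simp add: H_def)
  define B where "B e J = {\<omega> \<in> space M. \<exists>i\<in>J. \<omega> \<in> A i \<and> H i \<omega> < e}" for e J
  have meas: "B e J \<in> sets M" if "J \<subseteq> I" for e J
  proof -
    have "B e J = (\<Union>i\<in>J. A i \<inter> {\<omega> \<in> space M. H i \<omega> < e})" by (auto simp: B_def)
    moreover have "{\<omega> \<in> space M. H i \<omega> < e} \<in> sets M" for i using H by measurable
    ultimately show ?thesis
      using A that countable_subset[OF that I] by (auto intro!: sets.countable_UN'')
  qed
  have le: "measure M (B e I) \<le> e * measure M (space M)" if e: "0 \<le> e" for e
  proof -
    define J where "J k = from_nat_into I ` {..k}" for k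
    have JI: "J k \<subseteq> I" for k using from_nat_into[OF False] by (auto simp: J_def)
    have "(\<Union>k. J k) = I"
    proof -
      have "(\<Union>k. J k) = range (from_nat_into I)" unfolding J_def by blast
      then show ?thesis using range_from_nat_into[OF False I] by simp
    qed
    then have "B e I = (\<Union>k. B e (J k))" unfolding B_def by blast
    moreover have "(\<lambda>k. measure M (B e (J k))) \<longlonglongrightarrow> measure M (\<Union>k. B e (J k))"
      using meas[OF JI] by (intro finite_Lim_measure_incseq) (force simp: B_def J_def incseq_def)+
    moreover have "measure M (B e (J k)) \<le> e * measure M (space M)" for k
    proof -
      have "space M \<in> sets F" using subalg sets.top[of F] by (simp add: subalgebra_def)
      note top = this
      show ?thesis unfolding B_def H_def
      proof (rule chain_finite[OF _ _ _ top e])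
        show "finite (J k)" by (simp add: J_def)
        show "A i \<in> sets M" if "i \<in> J k" for i using that JI[of k] A by blast
        show "A i \<subseteq> A j \<or> A j \<subseteq> A i" if "i \<in> J k" "j \<in> J k" for i j using that JI[of k] chain by blast
      qed
    qed
    ultimately show ?thesis by (auto intro: LIMSEQ_le_const2)
  qed
  define N where "N = (\<Inter>k. B (1 / Suc k) I)"
  have N: "N \<in> sets M" unfolding N_def using meas by (intro sets.countable_INT) auto
  have "measure M N \<le> 0"
  proof (rule LIMSEQ_le_const)
    have "(\<lambda>k. 1 / Suc k * measure M (space M)) \<longlonglongrightarrow> 0 * measure M (space M)"
      by (intro tendsto_mult_right) (rule lim_inverse_n'[THEN LIMSEQ_Suc])
    then show "(\<lambda>k. 1 / Suc k * measure M (space M)) \<longlonglongrightarrow> 0" by simp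
    have "measure M N \<le> 1 / Suc k * measure M (space M)" for k
    proof -
      have "measure M N \<le> measure M (B (1 / Suc k) I)"
        using meas by (intro finite_measure_mono) (auto simp: N_def)
      also have "\<dots> \<le> 1 / Suc k * measure M (space M)" by (rule le) simp
      finally show ?thesis .
    qed
    then show "\<exists>n. \<forall>k\<ge>n. measure M N \<le> 1 / Suc k * measure M (space M)" by blast
  qed
  then have "N \<in> null_sets M"
    using N by (auto simp: null_sets_def emeasure_eq_measure ennreal_eq_0_iff)
  then show ?thesis
  proof (rule AE_I'[of N], intro subsetI)
    fix \<omega> assume *: "\<omega> \<in> {\<omega> \<in> space M. \<not> (\<exists>e>0. \<forall>i\<in>I. \<omega> \<in> A i \<longrightarrow> e \<le> real_cond_exp M F (indicator (A i)) \<omega>)}"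
    have "\<omega> \<in> B (1 / Suc k) I" for k
    proof -
      have "(0::real) < 1 / Suc k" by simp
      with * obtain i where "i \<in> I" "\<omega> \<in> A i" "\<not> 1 / Suc k \<le> H i \<omega>" unfolding H_def by blast
      with * show ?thesis by (auto simp: B_def not_le)
    qed
    then show "\<omega> \<in> N" by (auto simp: N_def)
  qed
qed (auto intro!: exI[of _ 1])

end

section \<open>Numerator and denominator of the sojourn reserve\<close>

text \<open>
  The variation over rational partitions is a supremum over a countable set and hence measurable in the
  sample point.
\<close>

definition rat_variation :: "(real \<Rightarrow> real) \<Rightarrow> real \<Rightarrow> ennreal" where
  "rat_variation f q =
     (SUP xs \<in> {xs. sorted xs \<and> set xs \<subseteq> {0..q} \<inter> \<rat>}.
        \<Sum>i<length xs - 1. ennreal \<bar>f (xs ! Suc i) - f (xs ! i)\<bar>)"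

lemma rat_variation_le: "rat_variation f q \<le> variation f 0 q"
  unfolding rat_variation_def variation_def by (intro SUP_subset_mono) auto

lemma rat_variation_step:
  assumes "q \<in> \<rat>" "r \<in> \<rat>" "0 \<le> q" "q \<le> r"
  shows "rat_variation f q + ennreal \<bar>f r - f q\<bar> \<le> rat_variation f r"
proof -
  let ?S = "\<lambda>xs. \<Sum>i<length xs - 1. ennreal \<bar>f (xs ! Suc i) - f (xs ! i)\<bar>"
  let ?L = "\<lambda>q. {xs. sorted xs \<and> set xs \<subseteq> {0..q} \<inter> \<rat>}"
  have ne: "?L q \<noteq> {}" by (intro ex_in_conv[THEN iffD1] exI[of _ "[]"]) auto
  have "rat_variation f q + ennreal \<bar>f r - f q\<bar> = (SUP xs\<in>?L q. ?S xs + ennreal \<bar>f r - f q\<bar>)"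
    unfolding rat_variation_def by (rule ennreal_SUP_add_left[OF ne, symmetric])
  also have "\<dots> \<le> rat_variation f r"
  proof (rule SUP_least)
    fix xs assume xs: "xs \<in> ?L q"
    let ?y = "xs @ [q, r]"
    let ?n = "length xs"
    have y: "?y \<in> ?L r"
      using xs assms by (auto simp: sorted_append subset_iff intro: order_trans)
    have "?S xs = (\<Sum>i<?n - 1. ennreal \<bar>f (?y ! Suc i) - f (?y ! i)\<bar>)"
      by (intro sum.cong) (auto simp: nth_append)
    also have "\<dots> \<le> (\<Sum>i<?n. ennreal \<bar>f (?y ! Suc i) - f (?y ! i)\<bar>)"
      by (intro sum_mono2) auto
    finally have "?S xs + ennreal \<bar>f r - f q\<bar> \<le> (\<Sum>i<?n. ennreal \<bar>f (?y ! Suc i) - f (?y ! i)\<bar>) + ennreal \<bar>f r - f q\<bar>"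
      by (rule add_right_mono)
    also have "\<dots> = ?S ?y" by (simp add: nth_append)
    also have "\<dots> \<le> rat_variation f r" unfolding rat_variation_def using y by (rule SUP_upper)
    finally show "?S xs + ennreal \<bar>f r - f q\<bar> \<le> rat_variation f r" .
  qed
  finally show ?thesis .
qed

lemma countable_rat_lists: "countable {xs. sorted xs \<and> set xs \<subseteq> {0..q::real} \<inter> \<rat>}"
  by (rule countable_subset[of _ "lists \<rat>"]) (auto simp: countable_rat intro!: countable_lists)

locale reserve_model = jump_process M Z for M :: "'a measure" and Z :: "real \<Rightarrow> 'a \<Rightarrow> 's::countable" +
  fixes \<zeta> :: "'s \<times> nat \<Rightarrow> 'a \<Rightarrow> 'e::polish_space" and Y :: "real \<Rightarrow> 'a \<Rightarrow> real"
  assumes \<zeta>_meas: "\<And>x. \<zeta> x \<in> borel_measurable M"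
    and \<zeta>_info: "\<And>x. sets (sigma_info M (\<zeta> x)) \<subseteq> sets (sigma_history M Z x)"
    and Y_var: "finite_expected_variation M Y"
    and Y_right_cont: "AE \<omega> in M. \<forall>t\<ge>0. ((\<lambda>s. Y s \<omega>) \<longlongrightarrow> Y t \<omega>) (at_right t)"
begin

abbreviation "info x \<equiv> sigma_info M (\<zeta> x)"

lemma space_info [simp]: "space (info x) = space M"
  by (simp add: sigma_info_def)

lemma subalgebra_info: "subalgebra M (info x)"
  unfolding subalgebra_def sigma_info_def
  using measurable_sets[OF \<zeta>_meas[of x]] by (auto simp: sets_vimage_algebra2)

lemma info_finite: "finite_measure_subalgebra M (info x)"
  by unfold_locales (rule subalgebra_info)

lemma Y_integrable: "0 \<le> t \<Longrightarrow> integrable M (Y t)"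
  using Y_var by (auto simp: finite_expected_variation_def)

definition here :: "'s \<times> nat \<Rightarrow> real \<Rightarrow> 'a \<Rightarrow> real" where
  "here x t \<omega> = of_bool (ZJ Z t \<omega> = x)"

lemma here_measurable: "0 \<le> t \<Longrightarrow> here x t \<in> borel_measurable M"
proof -
  assume t: "0 \<le> t"
  have "Measurable.pred M (\<lambda>\<omega>. ZJ Z t \<omega> = x)" using ZJ_event'[OF t, of x] by (simp add: pred_def)
  then show ?thesis unfolding here_def by measurable
qed

lemma here_integrable: "0 \<le> t \<Longrightarrow> integrable M (here x t)"
  by (rule integrable_const_bound[of _ 1]) (auto simp: here_measurable, auto simp: here_def)

lemma here_mult_integrable:
  assumes t: "0 \<le> t" and f: "integrable M f"
  shows "integrable M (\<lambda>\<omega>. here x t \<omega> * f \<omega>)"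
proof (rule Bochner_Integration.integrable_bound[OF f])
  show "(\<lambda>\<omega>. here x t \<omega> * f \<omega>) \<in> borel_measurable M"
    using here_measurable[OF t, of x] f by auto
qed (auto simp: here_def)

lemma here_right_cont:
  assumes "\<omega> \<in> space M" "0 \<le> t"
  obtains e where "t < e" "\<And>s. t \<le> s \<Longrightarrow> s < e \<Longrightarrow> here x s \<omega> = here x t \<omega>"
  using pure_jump_right[OF ZJ_pure_jump[OF assms(1)] assms(2)] unfolding here_def by metis

definition entered :: "'s \<times> nat \<Rightarrow> real \<Rightarrow> 'a \<Rightarrow> real" where
  "entered x q \<omega> = of_bool (\<exists>s\<in>\<rat>. 0 \<le> s \<and> s \<le> q \<and> ZJ Z s \<omega> = x)"

text \<open>
  At rational times the indicator of the visit is \<open>entered - departed\<close>, a difference of two increasing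
  processes.
\<close>

definition departed :: "'s \<times> nat \<Rightarrow> real \<Rightarrow> 'a \<Rightarrow> real" where
  "departed x q \<omega> = entered x q \<omega> * (1 - here x q \<omega>)"

lemma entered_measurable: "entered x q \<in> borel_measurable M"
proof -
  have "{\<omega> \<in> space M. \<exists>s\<in>\<rat>. 0 \<le> s \<and> s \<le> q \<and> ZJ Z s \<omega> = x} = (\<Union>s\<in>\<rat> \<inter> {0..q}. {\<omega> \<in> space M. ZJ Z s \<omega> = x})"
    by auto
  also have "\<dots> \<in> sets M"
    by (intro sets.countable_UN'' countable_Int1 countable_rat ZJ_event') auto
  finally have "Measurable.pred M (\<lambda>\<omega>. \<exists>s\<in>\<rat>. 0 \<le> s \<and> s \<le> q \<and> ZJ Z s \<omega> = x)" by (simp add: pred_def)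
  then show ?thesis unfolding entered_def by measurable
qed

lemma departed_measurable: "0 \<le> q \<Longrightarrow> departed x q \<in> borel_measurable M"
  unfolding departed_def using entered_measurable here_measurable by measurable

lemma entered_01: "entered x q \<omega> \<in> {0, 1}" and departed_01: "departed x q \<omega> \<in> {0, 1}"
  by (auto simp: entered_def departed_def here_def)

lemma entered_mono: "q \<le> r \<Longrightarrow> entered x q \<omega> \<le> entered x r \<omega>"
  unfolding entered_def by (auto simp: of_bool_def intro: order_trans)

lemma departed_mono:
  assumes \<omega>: "\<omega> \<in> space M" and "0 \<le> q" "q \<le> r"
  shows "departed x q \<omega> \<le> departed x r \<omega>"
proof (cases "departed x q \<omega> = 0")
  case False
  then obtain s where s: "0 \<le> s" "s \<le> q" "ZJ Z s \<omega> = x" "ZJ Z q \<omega> \<noteq> x" and e: "entered x q \<omega> = 1"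
    by (auto simp: departed_def entered_def here_def split: if_splits)
  have "ZJ Z r \<omega> \<noteq> x"
    using single_visitsD[OF ZJ_single[OF \<omega>], of s q r x] s \<open>q \<le> r\<close> by auto
  moreover have "entered x r \<omega> = 1" using entered_mono[OF \<open>q \<le> r\<close>, of x \<omega>] e entered_01[of x r \<omega>] by auto
  ultimately show ?thesis using departed_01[of x q \<omega>] by (auto simp: departed_def here_def)
qed (use departed_01[of x r \<omega>] in auto)

lemma here_eq: "q \<in> \<rat> \<Longrightarrow> 0 \<le> q \<Longrightarrow> here x q \<omega> = entered x q \<omega> - departed x q \<omega>"
  by (auto simp: departed_def entered_def here_def)

lemma mult_01_integrable:
  assumes "f \<in> borel_measurable M" "\<And>\<omega>. f \<omega> \<in> {0, 1::real}" "integrable M g"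
  shows "integrable M (\<lambda>\<omega>. f \<omega> * g \<omega>)"
proof (rule Bochner_Integration.integrable_bound[OF assms(3)])
  show "(\<lambda>\<omega>. f \<omega> * g \<omega>) \<in> borel_measurable M" using assms(1,3) by auto
  have "norm (f \<omega> * g \<omega>) \<le> norm (g \<omega>)" for \<omega>
    using assms(2)[of \<omega>] by auto
  then show "AE \<omega> in M. norm (f \<omega> * g \<omega>) \<le> norm (g \<omega>)" by simp
qed

text \<open>
  Along the rationals \<open>growth\<close> increases at least as fast as \<open>Y\<close> moves.  So \<open>growth\<close> and \<open>growth - Y\<close>
  increase; starting from \<open>\<bar>Y 0\<bar>\<close> makes both nonnegative.
\<close>

definition growth :: "real \<Rightarrow> 'a \<Rightarrow> real" where
  "growth q \<omega> = \<bar>Y 0 \<omega>\<bar> + enn2real (rat_variation (\<lambda>s. Y s \<omega>) q)"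

lemma rat_variation_measurable: "(\<lambda>\<omega>. rat_variation (\<lambda>s. Y s \<omega>) q) \<in> borel_measurable M"
proof -
  have "(\<lambda>\<omega>. \<Sum>i<length xs - 1. ennreal \<bar>Y (xs ! Suc i) \<omega> - Y (xs ! i) \<omega>\<bar>) \<in> borel_measurable M"
    if "set xs \<subseteq> {0..q} \<inter> \<rat>" for xs
  proof (rule borel_measurable_sum)
    fix i assume "i \<in> {..<length xs - 1}"
    then have "xs ! i \<in> set xs" "xs ! Suc i \<in> set xs" by auto
    then have "0 \<le> xs ! i" "0 \<le> xs ! Suc i" using that by auto
    then have "Y (xs ! i) \<in> borel_measurable M" "Y (xs ! Suc i) \<in> borel_measurable M"
      using Y_integrable by auto
    then show "(\<lambda>\<omega>. ennreal \<bar>Y (xs ! Suc i) \<omega> - Y (xs ! i) \<omega>\<bar>) \<in> borel_measurable M" by measurable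
  qed
  then show ?thesis unfolding rat_variation_def
    by (intro borel_measurable_SUP countable_rat_lists) auto
qed

lemma rat_variation_nn: "0 \<le> q \<Longrightarrow> (\<integral>\<^sup>+\<omega>. rat_variation (\<lambda>s. Y s \<omega>) q \<partial>M) < \<infinity>"
proof -
  assume "0 \<le> q"
  then have "(\<integral>\<^sup>+\<omega>. variation (\<lambda>s. Y s \<omega>) 0 q \<partial>M) < \<infinity>"
    using Y_var by (auto simp: finite_expected_variation_def)
  moreover have "(\<integral>\<^sup>+\<omega>. rat_variation (\<lambda>s. Y s \<omega>) q \<partial>M) \<le> (\<integral>\<^sup>+\<omega>. variation (\<lambda>s. Y s \<omega>) 0 q \<partial>M)"
    by (intro nn_integral_mono rat_variation_le)
  ultimately show ?thesis by (rule le_less_trans[rotated])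
qed

lemma growth_integrable:
  assumes q: "0 \<le> q" shows "integrable M (growth q)"
proof -
  have "integrable M (\<lambda>\<omega>. enn2real (rat_variation (\<lambda>s. Y s \<omega>) q))"
  proof (rule integrableI_bounded)
    show "(\<lambda>\<omega>. enn2real (rat_variation (\<lambda>s. Y s \<omega>) q)) \<in> borel_measurable M"
      using rat_variation_measurable by measurable
    have "(\<integral>\<^sup>+\<omega>. ennreal (norm (enn2real (rat_variation (\<lambda>s. Y s \<omega>) q))) \<partial>M) \<le>
        (\<integral>\<^sup>+\<omega>. rat_variation (\<lambda>s. Y s \<omega>) q \<partial>M)"
      by (intro nn_integral_mono) (auto simp: ennreal_enn2real_if)
    also have "\<dots> < \<infinity>" by (rule rat_variation_nn[OF q])
    finally show "(\<integral>\<^sup>+\<omega>. ennreal (norm (enn2real (rat_variation (\<lambda>s. Y s \<omega>) q))) \<partial>M) < \<infinity>" .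
  qed
  then show ?thesis unfolding growth_def using Y_integrable[of 0] by auto
qed

lemma growth_step:
  "AE \<omega> in M. \<forall>q\<in>\<rat>. \<forall>r\<in>\<rat>. 0 \<le> q \<longrightarrow> q \<le> r \<longrightarrow> \<bar>Y r \<omega> - Y q \<omega>\<bar> \<le> growth r \<omega> - growth q \<omega>"
proof -
  have "AE \<omega> in M. \<forall>r\<in>\<rat>. 0 \<le> r \<longrightarrow> rat_variation (\<lambda>s. Y s \<omega>) r \<noteq> \<infinity>"
  proof (intro AE_ball_countable' countable_rat)
    fix r :: real
    show "AE \<omega> in M. 0 \<le> r \<longrightarrow> rat_variation (\<lambda>s. Y s \<omega>) r \<noteq> \<infinity>"
    proof (cases "0 \<le> r")
      case True
      have "AE \<omega> in M. rat_variation (\<lambda>s. Y s \<omega>) r \<noteq> \<infinity>"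
        using rat_variation_nn[OF True] by (intro nn_integral_PInf_AE rat_variation_measurable) auto
      then show ?thesis by eventually_elim simp
    qed simp
  qed
  then show ?thesis
  proof eventually_elim
    case (elim \<omega>)
    show ?case
    proof (intro ballI impI)
      fix q r :: real assume *: "q \<in> \<rat>" "r \<in> \<rat>" "0 \<le> q" "q \<le> r"
      let ?v = "rat_variation (\<lambda>s. Y s \<omega>)"
      have fin: "?v q < \<top>" "?v r < \<top>" using elim * by (auto simp: less_top)
      have "enn2real (?v q + ennreal \<bar>Y r \<omega> - Y q \<omega>\<bar>) \<le> enn2real (?v r)"
        using rat_variation_step[OF *, of "\<lambda>s. Y s \<omega>"] fin(2) by (intro enn2real_mono) auto
      then have "enn2real (?v q) + \<bar>Y r \<omega> - Y q \<omega>\<bar> \<le> enn2real (?v r)"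
        using fin by (simp add: enn2real_plus)
      then show "\<bar>Y r \<omega> - Y q \<omega>\<bar> \<le> growth r \<omega> - growth q \<omega>" by (simp add: growth_def)
    qed
  qed
qed

definition Den :: "'s \<times> nat \<Rightarrow> real \<Rightarrow> 'a \<Rightarrow> real" where
  "Den x = cond_exp_process M (info x) (here x)"

definition Num :: "'s \<times> nat \<Rightarrow> real \<Rightarrow> 'a \<Rightarrow> real" where
  "Num x = cond_exp_process M (info x) (\<lambda>t \<omega>. here x t \<omega> * Y t \<omega>)"

lemma Den_process:
  shows "is_cond_exp_process M (info x) (here x) (Den x)"
    and "AE \<omega> in M. \<exists>m. control m \<and> (\<forall>b. controlled (\<lambda>t. Den x t \<omega>) m 0 b)"
proof -
  interpret F: finite_measure_subalgebra M "info x" by (rule info_finite)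
  have "\<exists>C. is_cond_exp_process M (info x) (here x) C \<and> (AE \<omega> in M. \<exists>m. control m \<and> (\<forall>b. controlled (\<lambda>t. C t \<omega>) m 0 b))"
  proof (rule F.cond_exp_process_exists[where P = "entered x" and Q = "departed x"])
    show "integrable M (entered x q)" "integrable M (departed x q)" if "0 \<le> q" for q
      using mult_01_integrable[OF entered_measurable entered_01, of "\<lambda>_. 1" x q]
        mult_01_integrable[OF departed_measurable[OF that] departed_01, of "\<lambda>_. 1" x] by auto
    show "AE \<omega> in M. \<forall>q\<in>\<rat>. \<forall>r\<in>\<rat>. 0 \<le> q \<longrightarrow> q \<le> r \<longrightarrow> entered x q \<omega> \<le> entered x r \<omega> \<and> departed x q \<omega> \<le> departed x r \<omega>"
      using AE_space by eventually_elim (auto intro: entered_mono departed_mono)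
    show "AE \<omega> in M. \<forall>q\<in>\<rat>. 0 \<le> q \<longrightarrow> here x q \<omega> = entered x q \<omega> - departed x q \<omega>"
      by (auto simp: here_eq)
    show "AE \<omega> in M. \<forall>t\<ge>0. ((\<lambda>s. here x s \<omega>) \<longlongrightarrow> here x t \<omega>) (at_right t)"
      using AE_space
    proof eventually_elim
      case (elim \<omega>)
      show ?case
      proof (intro allI impI)
        fix t :: real assume t: "0 \<le> t"
        obtain e where e: "t < e" "\<And>s. t \<le> s \<Longrightarrow> s < e \<Longrightarrow> here x s \<omega> = here x t \<omega>"
          using here_right_cont[OF elim t] by metis
        show "((\<lambda>s. here x s \<omega>) \<longlongrightarrow> here x t \<omega>) (at_right t)"
          by (rule tendsto_right_cong[OF e(1) _ tendsto_const]) (rule e(2), auto)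
      qed
    qed
  qed (auto intro: here_integrable)
  then obtain C where "is_cond_exp_process M (info x) (here x) C"
    "AE \<omega> in M. \<exists>m. control m \<and> (\<forall>b. controlled (\<lambda>t. C t \<omega>) m 0 b)" by blast
  from F.cond_exp_process_version[OF this]
  show "is_cond_exp_process M (info x) (here x) (Den x)"
    "AE \<omega> in M. \<exists>m. control m \<and> (\<forall>b. controlled (\<lambda>t. Den x t \<omega>) m 0 b)"
    by (auto simp: Den_def)
qed

lemma product_mono: 
  fixes a b :: real
  assumes "0 \<le> a" "a \<le> a'" "0 \<le> b" "b \<le> b'" shows "a * b \<le> a' * b'"
  using assms by (intro mult_mono) auto

text \<open>
  Multiply \<open>here = entered - departed\<close> by \<open>Y = growth - (growth - Y)\<close>: all four processes are nonnegative
  and increasing, and so are their products.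
\<close>

lemma Num_process:
  shows "is_cond_exp_process M (info x) (\<lambda>t \<omega>. here x t \<omega> * Y t \<omega>) (Num x)"
    and "AE \<omega> in M. \<exists>m. control m \<and> (\<forall>b. controlled (\<lambda>t. Num x t \<omega>) m 0 b)"
proof -
  interpret F: finite_measure_subalgebra M "info x" by (rule info_finite)
  define dn where "dn q \<omega> = growth q \<omega> - Y q \<omega>" for q \<omega>
  have dn_int: "integrable M (dn q)" if "0 \<le> q" for q
    unfolding dn_def using growth_integrable[OF that] Y_integrable[OF that] by auto
  have ent: "integrable M (\<lambda>\<omega>. entered x q \<omega> * f \<omega>)" if "integrable M f" for f q
    by (rule mult_01_integrable[OF entered_measurable entered_01 that])
  have lft: "integrable M (\<lambda>\<omega>. departed x q \<omega> * f \<omega>)" if "integrable M f" "0 \<le> q" for f q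
    by (rule mult_01_integrable[OF departed_measurable[OF that(2)] departed_01 that(1)])
  define P where "P q \<omega> = entered x q \<omega> * growth q \<omega> + departed x q \<omega> * dn q \<omega>" for q \<omega>
  define Q where "Q q \<omega> = entered x q \<omega> * dn q \<omega> + departed x q \<omega> * growth q \<omega>" for q \<omega>
  have "\<exists>C. is_cond_exp_process M (info x) (\<lambda>t \<omega>. here x t \<omega> * Y t \<omega>) C \<and> (AE \<omega> in M. \<exists>m. control m \<and> (\<forall>b. controlled (\<lambda>t. C t \<omega>) m 0 b))"
  proof (rule F.cond_exp_process_exists[where P = P and Q = Q])
    show "integrable M (P q)" "integrable M (Q q)" if "0 \<le> q" for q
      unfolding P_def Q_def using that
      by (auto intro!: Bochner_Integration.integrable_add ent lft growth_integrable dn_int)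
    show "AE \<omega> in M. \<forall>q\<in>\<rat>. \<forall>r\<in>\<rat>. 0 \<le> q \<longrightarrow> q \<le> r \<longrightarrow> P q \<omega> \<le> P r \<omega> \<and> Q q \<omega> \<le> Q r \<omega>"
      using growth_step AE_space
    proof eventually_elim
      case (elim \<omega>)
      show ?case
      proof (intro ballI impI)
        fix q r :: real assume *: "q \<in> \<rat>" "r \<in> \<rat>" "0 \<le> q" "q \<le> r"
        have s: "\<bar>Y r \<omega> - Y q \<omega>\<bar> \<le> growth r \<omega> - growth q \<omega>" "\<bar>Y q \<omega> - Y 0 \<omega>\<bar> \<le> growth q \<omega> - growth 0 \<omega>"
          using elim * Rats_0 by blast+
        have u0: "\<bar>Y 0 \<omega>\<bar> \<le> growth 0 \<omega>" by (simp add: growth_def)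
        have u: "0 \<le> growth q \<omega>" "growth q \<omega> \<le> growth r \<omega>" "0 \<le> dn q \<omega>" "dn q \<omega> \<le> dn r \<omega>"
          using s u0 unfolding dn_def by linarith+
        have e: "0 \<le> entered x q \<omega>" "entered x q \<omega> \<le> entered x r \<omega>" "0 \<le> departed x q \<omega>" "departed x q \<omega> \<le> departed x r \<omega>"
          using * elim entered_01[of x q \<omega>] departed_01[of x q \<omega>] by (auto intro: entered_mono departed_mono)
        show "P q \<omega> \<le> P r \<omega> \<and> Q q \<omega> \<le> Q r \<omega>"
          unfolding P_def Q_def using u e by (intro conjI add_mono product_mono)
      qed
    qed
    show "AE \<omega> in M. \<forall>q\<in>\<rat>. 0 \<le> q \<longrightarrow> here x q \<omega> * Y q \<omega> = P q \<omega> - Q q \<omega>"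
      by (auto simp: here_eq P_def Q_def dn_def algebra_simps)
    show "AE \<omega> in M. \<forall>t\<ge>0. ((\<lambda>s. here x s \<omega> * Y s \<omega>) \<longlongrightarrow> here x t \<omega> * Y t \<omega>) (at_right t)"
      using AE_space Y_right_cont
    proof eventually_elim
      case (elim \<omega>)
      show ?case
      proof (intro allI impI)
        fix t :: real assume t: "0 \<le> t"
        obtain e where e: "t < e" "\<And>s. t \<le> s \<Longrightarrow> s < e \<Longrightarrow> here x s \<omega> = here x t \<omega>"
          using here_right_cont[OF elim(1) t] by metis
        have "((\<lambda>s. here x t \<omega> * Y s \<omega>) \<longlongrightarrow> here x t \<omega> * Y t \<omega>) (at_right t)"
          using elim(2) t by (intro tendsto_mult_left) auto
        then show "((\<lambda>s. here x s \<omega> * Y s \<omega>) \<longlongrightarrow> here x t \<omega> * Y t \<omega>) (at_right t)"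
        proof (rule tendsto_right_cong[OF e(1), rotated])
          fix u assume "t < u" "u < e"
          then have "here x u \<omega> = here x t \<omega>" by (intro e(2)) auto
          then show "here x u \<omega> * Y u \<omega> = here x t \<omega> * Y u \<omega>" by (rule arg_cong)
        qed
      qed
    qed
  qed (auto intro: here_mult_integrable Y_integrable)
  then obtain C where "is_cond_exp_process M (info x) (\<lambda>t \<omega>. here x t \<omega> * Y t \<omega>) C"
    "AE \<omega> in M. \<exists>m. control m \<and> (\<forall>b. controlled (\<lambda>t. C t \<omega>) m 0 b)" by blast
  from F.cond_exp_process_version[OF this]
  show "is_cond_exp_process M (info x) (\<lambda>t \<omega>. here x t \<omega> * Y t \<omega>) (Num x)"
    "AE \<omega> in M. \<exists>m. control m \<and> (\<forall>b. controlled (\<lambda>t. Num x t \<omega>) m 0 b)"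
    by (auto simp: Num_def)
qed

text \<open>
  The events that \<open>x\<close> is occupied both at \<open>s\<close> and at \<open>r\<close> increase in \<open>s \<le> r\<close> and decrease in \<open>s \<ge> r\<close>,
  because a visit is an interval.  So their conditional probabilities are bounded away from zero over
  all \<open>s\<close> during the visit, and \<open>Den x s\<close> dominates them.
\<close>

lemma Den_pos:
  "AE \<omega> in M. \<forall>r\<in>\<rat>. 0 \<le> r \<longrightarrow> ZJ Z r \<omega> = x \<longrightarrow> (\<exists>e>0. \<forall>s\<in>\<rat>. 0 \<le> s \<longrightarrow> ZJ Z s \<omega> = x \<longrightarrow> e \<le> Den x s \<omega>)"
proof (intro AE_ball_countable' countable_rat)
  fix r :: real
  interpret F: finite_measure_subalgebra M "info x" by (rule info_finite)
  show "AE \<omega> in M. 0 \<le> r \<longrightarrow> ZJ Z r \<omega> = x \<longrightarrow> (\<exists>e>0. \<forall>s\<in>\<rat>. 0 \<le> s \<longrightarrow> ZJ Z s \<omega> = x \<longrightarrow> e \<le> Den x s \<omega>)"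
  proof (cases "0 \<le> r")
    case r: True
    define A where "A s = {\<omega> \<in> space M. ZJ Z s \<omega> = x \<and> ZJ Z r \<omega> = x}" for s
    have A: "A s \<in> sets M" if "0 \<le> s" for s
    proof -
      have "A s = {\<omega> \<in> space M. ZJ Z s \<omega> = x} \<inter> {\<omega> \<in> space M. ZJ Z r \<omega> = x}" by (auto simp: A_def)
      then show ?thesis using ZJ_event'[OF that] ZJ_event'[OF r] by auto
    qed
    have A1: "A s \<subseteq> A u" if "0 \<le> s" "s \<le> u" "u \<le> r" for s u
      using single_visitsD[OF ZJ_single, of _ s u r x] that by (auto simp: A_def)
    have A2: "A u \<subseteq> A s" if "r \<le> s" "s \<le> u" for s u
      using single_visitsD[OF ZJ_single, of _ r s u x] that r by (auto simp: A_def)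
    have c: "countable (\<rat> \<inter> B)" for B :: "real set" by (intro countable_Int1 countable_rat)
    have c1: "AE \<omega> in M. \<exists>e>0. \<forall>i\<in>\<rat> \<inter> {0..r}. \<omega> \<in> A i \<longrightarrow> e \<le> real_cond_exp M (info x) (indicator (A i)) \<omega>"
    proof (rule F.chain_cond_exp_pos[OF c])
      fix i j assume "i \<in> \<rat> \<inter> {0..r}" "j \<in> \<rat> \<inter> {0..r}"
      then show "A i \<subseteq> A j \<or> A j \<subseteq> A i" using A1[of i j] A1[of j i] by (cases "i \<le> j") auto
    qed (auto intro: A)
    have c2: "AE \<omega> in M. \<exists>e>0. \<forall>i\<in>\<rat> \<inter> {r..}. \<omega> \<in> A i \<longrightarrow> e \<le> real_cond_exp M (info x) (indicator (A i)) \<omega>"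
    proof (rule F.chain_cond_exp_pos[OF c])
      fix i j assume "i \<in> \<rat> \<inter> {r..}" "j \<in> \<rat> \<inter> {r..}"
      then show "A i \<subseteq> A j \<or> A j \<subseteq> A i" using A2[of i j] A2[of j i] by (cases "i \<le> j") auto
    qed (use r in \<open>auto intro: A\<close>)
    have le: "AE \<omega> in M. \<forall>s\<in>\<rat>. 0 \<le> s \<longrightarrow> real_cond_exp M (info x) (indicator (A s)) \<omega> \<le> Den x s \<omega>"
    proof (intro AE_ball_countable' countable_rat)
      fix s :: real
      show "AE \<omega> in M. 0 \<le> s \<longrightarrow> real_cond_exp M (info x) (indicator (A s)) \<omega> \<le> Den x s \<omega>"
      proof (cases "0 \<le> s")
        case True
        have "AE \<omega> in M. real_cond_exp M (info x) (indicator (A s)) \<omega> \<le> real_cond_exp M (info x) (here x s) \<omega>"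
          using A[OF True] by (intro F.real_cond_exp_mono here_integrable[OF True])
            (auto simp: A_def here_def indicator_def emeasure_finite less_top[symmetric])
        moreover have "AE \<omega> in M. Den x s \<omega> = real_cond_exp M (info x) (here x s) \<omega>"
          using Den_process(1)[of x] True by (auto simp: is_cond_exp_process_def)
        ultimately show ?thesis by eventually_elim simp
      qed simp
    qed
    from c1 c2 le AE_space show ?thesis
    proof eventually_elim
      case (elim \<omega>)
      obtain e1 where e1: "0 < e1" "\<And>i. i \<in> \<rat> \<inter> {0..r} \<Longrightarrow> \<omega> \<in> A i \<Longrightarrow> e1 \<le> real_cond_exp M (info x) (indicator (A i)) \<omega>"
        using elim(1) by blast
      obtain e2 where e2: "0 < e2" "\<And>i. i \<in> \<rat> \<inter> {r..} \<Longrightarrow> \<omega> \<in> A i \<Longrightarrow> e2 \<le> real_cond_exp M (info x) (indicator (A i)) \<omega>"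
        using elim(2) by blast
      show ?case
      proof (intro impI)
        assume xr: "ZJ Z r \<omega> = x"
        show "\<exists>e>0. \<forall>s\<in>\<rat>. 0 \<le> s \<longrightarrow> ZJ Z s \<omega> = x \<longrightarrow> e \<le> Den x s \<omega>"
        proof (intro exI[of _ "min e1 e2"] conjI ballI impI)
          show "0 < min e1 e2" using e1 e2 by simp
          fix s :: real assume s: "s \<in> \<rat>" "0 \<le> s" "ZJ Z s \<omega> = x"
          then have "\<omega> \<in> A s" using xr elim(4) by (auto simp: A_def)
          then have "min e1 e2 \<le> real_cond_exp M (info x) (indicator (A s)) \<omega>"
            using e1(2)[of s] e2(2)[of s] s by (cases "s \<le> r") auto
          also have "\<dots> \<le> Den x s \<omega>" using elim(3) s by blast
          finally show "min e1 e2 \<le> Den x s \<omega>" .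
        qed
      qed
    qed
  qed simp
qed

definition regular :: "'a \<Rightarrow> bool" where
  "regular \<omega> \<longleftrightarrow> \<omega> \<in> space M \<and>
     (\<forall>x. \<exists>m. control m \<and> (\<forall>b. controlled (\<lambda>t. Num x t \<omega>) m 0 b) \<and> (\<forall>b. controlled (\<lambda>t. Den x t \<omega>) m 0 b)) \<and>
     (\<forall>x t. 0 \<le> t \<longrightarrow> ZJ Z t \<omega> = x \<longrightarrow> (\<exists>e>0. \<forall>s\<ge>0. ZJ Z s \<omega> = x \<longrightarrow> e \<le> Den x s \<omega>))"

lemma AE_regular: "AE \<omega> in M. regular \<omega>"
proof -
  have "AE \<omega> in M. \<forall>x. (\<exists>m. control m \<and> (\<forall>b. controlled (\<lambda>t. Num x t \<omega>) m 0 b)) \<and>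
      (\<exists>m. control m \<and> (\<forall>b. controlled (\<lambda>t. Den x t \<omega>) m 0 b)) \<and>
      (\<forall>r\<in>\<rat>. 0 \<le> r \<longrightarrow> ZJ Z r \<omega> = x \<longrightarrow> (\<exists>e>0. \<forall>s\<in>\<rat>. 0 \<le> s \<longrightarrow> ZJ Z s \<omega> = x \<longrightarrow> e \<le> Den x s \<omega>))"
    unfolding AE_all_countable AE_conj_iff using Num_process(2) Den_process(2) Den_pos by blast
  with AE_space show ?thesis
  proof eventually_elim
    case (elim \<omega>)
    note \<omega> = elim(1)
    have "\<exists>m. control m \<and> (\<forall>b. controlled (\<lambda>t. Num x t \<omega>) m 0 b) \<and> (\<forall>b. controlled (\<lambda>t. Den x t \<omega>) m 0 b)" for x
    proof -
      obtain m m' where m: "control m" "\<And>b. controlled (\<lambda>t. Num x t \<omega>) m 0 b"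
        "control m'" "\<And>b. controlled (\<lambda>t. Den x t \<omega>) m' 0 b"
        using elim(2) by blast
      have "controlled (\<lambda>t. Num x t \<omega>) (\<lambda>t. m t + m' t) 0 b" for b
        by (rule controlled_add_control[OF m(2,3)])
      moreover have "controlled (\<lambda>t. Den x t \<omega>) (\<lambda>t. m t + m' t) 0 b" for b
        using controlled_add_control[OF m(4,1)] by (simp add: add.commute)
      ultimately show ?thesis using control_add[OF m(1,3)] by blast
    qed
    note ctrl = this
    have "\<exists>e>0. \<forall>s\<ge>0. ZJ Z s \<omega> = x \<longrightarrow> e \<le> Den x s \<omega>" if t: "0 \<le> t" "ZJ Z t \<omega> = x" for x t
    proof -
      have near: "\<exists>d>s. \<forall>u. s \<le> u \<longrightarrow> u < d \<longrightarrow> ZJ Z u \<omega> = x" if "0 \<le> s" "ZJ Z s \<omega> = x" for s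
        using pure_jump_right[OF ZJ_pure_jump[OF \<omega>] that(1)] that(2) by metis
      obtain d where d: "t < d" "\<And>u. t \<le> u \<Longrightarrow> u < d \<Longrightarrow> ZJ Z u \<omega> = x" using near[OF t] by blast
      obtain r where r: "r \<in> \<rat>" "t < r" "r < d" using Rats_dense_in_real[OF d(1)] by blast
      then have rx: "ZJ Z r \<omega> = x" "0 \<le> r" using d(2)[of r] t by auto
      have "\<exists>e>0. \<forall>s\<in>\<rat>. 0 \<le> s \<longrightarrow> ZJ Z s \<omega> = x \<longrightarrow> e \<le> Den x s \<omega>"
        using elim(2)[THEN spec[of _ x], THEN conjunct2, THEN conjunct2, THEN bspec[OF _ r(1)]] rx by simp
      then obtain e where e: "0 < e" "\<And>s. s \<in> \<rat> \<Longrightarrow> 0 \<le> s \<Longrightarrow> ZJ Z s \<omega> = x \<Longrightarrow> e \<le> Den x s \<omega>"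
        by blast
      have "e \<le> Den x s \<omega>" if s: "0 \<le> s" "ZJ Z s \<omega> = x" for s
      proof -
        obtain m where m: "control m" "\<And>b. controlled (\<lambda>t. Den x t \<omega>) m 0 b" using ctrl[of x] by blast
        have "((\<lambda>t. Den x t \<omega>) \<longlongrightarrow> Den x s \<omega>) (at_right s)"
          by (rule controlled_tendsto_right[OF m(1) controlled_subset[OF m(2)], of s "s+1" "s+1"]) (use s in auto)
        then have lim: "(\<lambda>n. Den x (dyadic_above n s) \<omega>) \<longlonglongrightarrow> Den x s \<omega>"
          by (rule filterlim_compose[OF _ dyadic_above_at_right])
        obtain d where d: "s < d" "\<And>u. s \<le> u \<Longrightarrow> u < d \<Longrightarrow> ZJ Z u \<omega> = x" using near[OF s] by blast
        have "eventually (\<lambda>n. dyadic_above n s < d) sequentially"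
          using dyadic_above_tendsto d(1) by (rule order_tendstoD)
        then have "eventually (\<lambda>n. e \<le> Den x (dyadic_above n s) \<omega>) sequentially"
        proof eventually_elim
          case (elim n)
          have "s < dyadic_above n s" by (rule dyadic_above_gt)
          with elim s show ?case by (intro e(2) dyadic_above_rat d(2)) auto
        qed
        then show ?thesis by (intro tendsto_lowerbound[OF lim]) auto
      qed
      with e(1) show ?thesis by blast
    qed
    with \<omega> ctrl show ?case unfolding regular_def by blast
  qed
qed

end

section \<open>The reserve during a visit\<close>

lemma borel_measurable_augment:
  assumes "f \<in> borel_measurable F" "space F = space M"
  shows "f \<in> borel_measurable (augment M F)"
proof (rule measurableI)
  fix B :: "'b set" assume "B \<in> sets borel"
  from measurable_sets[OF assms(1) this] assms(2)
  show "f -` B \<inter> space (augment M F) \<in> sets (augment M F)" by (auto intro: sets_augmentI)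
qed simp

lemma augment_AE_eq:
  assumes F: "subalgebra M F" and A: "A \<in> sets (augment M F)"
  shows "\<exists>B\<in>sets F. AE \<omega> in M. \<omega> \<in> A \<longleftrightarrow> \<omega> \<in> B"
  using A unfolding sets_augment[OF F]
proof (induction rule: sigma_sets.induct)
  case (Basic A)
  then show ?case
  proof
    assume "A \<in> null_sets M"
    then have "AE \<omega> in M. \<omega> \<in> A \<longleftrightarrow> \<omega> \<in> {}" using AE_not_in by fastforce
    then show ?thesis by (intro bexI[of _ "{}"]) auto
  qed auto
next
  case Empty
  then show ?case by (intro bexI[of _ "{}"]) auto
next
  case (Compl A)
  then obtain B where "B \<in> sets F" "AE \<omega> in M. \<omega> \<in> A \<longleftrightarrow> \<omega> \<in> B" by blast
  moreover from this(2) AE_space have "AE \<omega> in M. \<omega> \<in> space M - A \<longleftrightarrow> \<omega> \<in> space F - B"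
    by eventually_elim (use F in \<open>auto simp: subalgebra_def\<close>)
  ultimately show ?case by blast
next
  case (Union A)
  then obtain B where B: "\<And>i. B i \<in> sets F" "\<And>i. AE \<omega> in M. \<omega> \<in> A i \<longleftrightarrow> \<omega> \<in> B i" by metis
  then have "AE \<omega> in M. \<forall>i. \<omega> \<in> A i \<longleftrightarrow> \<omega> \<in> B i" by (simp add: AE_all_countable)
  then have "AE \<omega> in M. \<omega> \<in> (\<Union>i. A i) \<longleftrightarrow> \<omega> \<in> (\<Union>i. B i)" by eventually_elim auto
  with B(1) show ?case by blast
qed

lemma (in finite_measure) real_cond_exp_augment:
  assumes F: "subalgebra M F" and f: "integrable M f"
  shows "AE \<omega> in M. real_cond_exp M (augment M F) f \<omega> = real_cond_exp M F f \<omega>"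
proof -
  interpret F: finite_measure_subalgebra M F by unfold_locales (rule F)
  interpret A: finite_measure_subalgebra M "augment M F" by unfold_locales (rule subalgebra_augment[OF F])
  show ?thesis
  proof (rule A.real_cond_exp_charact[OF _ f])
    show "integrable M (real_cond_exp M F f)" by (rule F.real_cond_exp_int(1)[OF f])
    show "real_cond_exp M F f \<in> borel_measurable (augment M F)"
      using F by (intro borel_measurable_augment) (auto simp: subalgebra_def)
    fix A assume A: "A \<in> sets (augment M F)"
    then obtain B where B: "B \<in> sets F" "AE \<omega> in M. \<omega> \<in> A \<longleftrightarrow> \<omega> \<in> B" using augment_AE_eq[OF F] by blast
    have AM: "A \<in> sets M" "B \<in> sets M"
      using A B subalgebra_augment[OF F] F by (auto simp: subalgebra_def)
    have eq: "(LINT \<omega>:A|M. g \<omega>) = (LINT \<omega>:B|M. g \<omega>)" if "integrable M g" for g :: "'a \<Rightarrow> real"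
      unfolding set_lebesgue_integral_def
    proof (rule integral_cong_AE)
      show "AE \<omega> in M. indicator A \<omega> *\<^sub>R g \<omega> = indicator B \<omega> *\<^sub>R g \<omega>"
        using B(2) by eventually_elim (auto simp: indicator_def)
    qed (use AM that in auto)
    show "(LINT \<omega>:A|M. f \<omega>) = (LINT \<omega>:A|M. real_cond_exp M F f \<omega>)"
      unfolding eq[OF f] eq[OF F.real_cond_exp_int(1)[OF f]] by (rule F.real_cond_exp_intA[OF f B(1)])
  qed
qed

context reserve_model
begin

lemma sets_info: "A \<in> sets (info x) \<Longrightarrow> A \<in> sets M"
  using subalgebra_info[of x] by (auto simp: subalgebra_def)

lemma sets_full_info: "A \<in> sets (full_info M Z t) \<Longrightarrow> A \<in> sets M"
  using subalgebra_full_info[of t] by (auto simp: subalgebra_def)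

text \<open>
  The information carried by a random index \<open>U\<close> together with the component of \<open>\<zeta>\<close> that it selects.  For
  \<^term>\<open>ZJ Z t\<close> and \<^term>\<open>ZJ_left Z t\<close> this is the reduced information at \<open>t\<close> and at \<open>t-\<close> before the
  augmentation by null sets.
\<close>

definition cur_info :: "('a \<Rightarrow> 's \<times> nat) \<Rightarrow> 'a measure" where
  "cur_info U = vimage_algebra (space M) (\<lambda>\<omega>. (U \<omega>, \<zeta> (U \<omega>) \<omega>)) (count_space UNIV \<Otimes>\<^sub>M borel)"

lemma space_cur_info [simp]: "space (cur_info U) = space M"
  by (simp add: cur_info_def)

lemma sets_cur_info:
  "sets (cur_info U) = {(\<lambda>\<omega>. (U \<omega>, \<zeta> (U \<omega>) \<omega>)) -` B \<inter> space M | B. B \<in> sets (count_space UNIV \<Otimes>\<^sub>M borel)}"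
  unfolding cur_info_def by (rule sets_vimage_algebra2) (auto simp: space_pair_measure)

lemma info_in_cur_info:
  assumes "A \<in> sets (info x)"
  shows "A \<inter> {\<omega> \<in> space M. U \<omega> = x} \<in> sets (cur_info U)"
proof -
  obtain B where B: "B \<in> sets borel" "A = \<zeta> x -` B \<inter> space M"
    using assms by (auto simp: sigma_info_def sets_vimage_algebra2)
  have "A \<inter> {\<omega> \<in> space M. U \<omega> = x} = (\<lambda>\<omega>. (U \<omega>, \<zeta> (U \<omega>) \<omega>)) -` ({x} \<times> B) \<inter> space M"
    unfolding B(2) by auto
  moreover have "{x} \<times> B \<in> sets (count_space UNIV \<Otimes>\<^sub>M borel)" using B(1) by auto
  ultimately show ?thesis unfolding sets_cur_info by blast
qed

lemma cur_info_event: "{\<omega> \<in> space M. U \<omega> = x} \<in> sets (cur_info U)"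
proof -
  have "space M \<inter> {\<omega> \<in> space M. U \<omega> = x} \<in> sets (cur_info U)"
    using sets.top[of "info x"] by (intro info_in_cur_info) auto
  then show ?thesis by (simp add: Int_def cong: conj_cong)
qed

lemma cur_info_trace:
  assumes "A \<in> sets (cur_info U)"
  obtains A' where "A' \<in> sets (info x)" "\<And>\<omega>. U \<omega> = x \<Longrightarrow> \<omega> \<in> A \<longleftrightarrow> \<omega> \<in> A'"
proof -
  obtain B where B: "B \<in> sets (count_space UNIV \<Otimes>\<^sub>M borel)" "A = (\<lambda>\<omega>. (U \<omega>, \<zeta> (U \<omega>) \<omega>)) -` B \<inter> space M"
    using assms by (auto simp: sets_cur_info)
  have "Pair x -` B \<inter> space borel \<in> sets borel"
    by (rule measurable_sets[OF _ B(1)]) (rule measurable_Pair1', simp)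
  then have "\<zeta> x -` (Pair x -` B) \<inter> space M \<in> sets (info x)"
    by (auto simp: sigma_info_def intro!: in_vimage_algebra)
  then show thesis by (rule that) (auto simp: B(2))
qed

lemma measurable_cur_info:
  assumes "f \<in> borel_measurable (info x)"
  shows "(\<lambda>\<omega>. of_bool (U \<omega> = x) * f \<omega> :: real) \<in> borel_measurable (cur_info U)"
  by (rule borel_measurable_trace[OF assms]) (auto intro: info_in_cur_info cur_info_event)

lemma subalgebra_cur_info:
  assumes "\<And>x. {\<omega> \<in> space M. U \<omega> = x} \<in> sets M"
  shows "subalgebra M (cur_info U)"
  unfolding subalgebra_def
proof (intro conjI subsetI)
  fix A assume A: "A \<in> sets (cur_info U)"
  have "\<exists>A'. A' \<in> sets (info x) \<and> (\<forall>\<omega>. U \<omega> = x \<longrightarrow> (\<omega> \<in> A \<longleftrightarrow> \<omega> \<in> A'))" for x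
    using cur_info_trace[OF A, of x] by metis
  then obtain A' where A': "\<And>x. A' x \<in> sets (info x)" "\<And>x \<omega>. U \<omega> = x \<Longrightarrow> \<omega> \<in> A \<longleftrightarrow> \<omega> \<in> A' x" by metis
  have "A \<subseteq> space M" using sets.sets_into_space[OF A] by simp
  then have "A = (\<Union>x. A' x \<inter> {\<omega> \<in> space M. U \<omega> = x})" using A'(2) by blast
  also have "\<dots> \<in> sets M"
    using sets_info[OF A'(1)] assms by (intro sets.countable_UN' sets.Int) auto
  finally show "A \<in> sets M" .
qed simp

definition res :: "'s \<times> nat \<Rightarrow> real \<Rightarrow> 'a \<Rightarrow> real" where
  "res x t \<omega> = Num x t \<omega> / Den x t \<omega>"

lemma sojourn_reserve_eq: "sojourn_reserve M Z \<zeta> Y x t \<omega> = res x t \<omega>"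
  by (simp add: sojourn_reserve_def res_def Num_def Den_def here_def[abs_def])

lemma Num_Den_measurable:
  assumes "0 \<le> t"
  shows "Num x t \<in> borel_measurable (info x)" "Den x t \<in> borel_measurable (info x)"
  using Num_process(1)[of x] Den_process(1)[of x] assms by (auto simp: is_cond_exp_process_def)

lemma res_measurable: "0 \<le> t \<Longrightarrow> res x t \<in> borel_measurable (info x)"
  unfolding res_def by (intro borel_measurable_divide Num_Den_measurable)

text \<open>
  Let \<open>I\<close> be the indicator of the visit and \<open>v = N / D\<close>.  An event of the reduced information agrees on the
  visit with some \<open>A'\<close> in \<open>\<sigma>(\<zeta> x)\<close>, and \<open>\<integral>\<^sub>A\<^sub>' I Y = \<integral>\<^sub>A\<^sub>' N = \<integral>\<^sub>A\<^sub>' v D = \<integral>\<^sub>A\<^sub>' v I\<close>.  The restriction to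
  \<open>\<bar>v\<bar> \<le> k\<close> makes these integrals exist.
\<close>

lemma res_on_visit:
  assumes t: "0 \<le> t"
  shows "AE \<omega> in M. ZJ Z t \<omega> = x \<longrightarrow> real_cond_exp M (cur_info (ZJ Z t)) (Y t) \<omega> = res x t \<omega>"
proof -
  let ?F = "cur_info (ZJ Z t)" and ?G = "info x"
  define I where "I = here x t"
  have F_sub: "subalgebra M ?F" using ZJ_event'[OF t] by (rule subalgebra_cur_info)
  interpret F: finite_measure_subalgebra M ?F by unfold_locales (rule F_sub)
  interpret G: finite_measure_subalgebra M ?G by (rule info_finite)
  have I: "integrable M I" "\<And>f. integrable M f \<Longrightarrow> integrable M (\<lambda>\<omega>. I \<omega> * f \<omega>)"
    unfolding I_def by (auto intro: here_integrable[OF t] here_mult_integrable[OF t])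
  have I01: "I \<omega> = of_bool (ZJ Z t \<omega> = x)" for \<omega> by (simp add: I_def here_def)
  have IY: "integrable M (\<lambda>\<omega>. I \<omega> * Y t \<omega>)" by (rule I(2)[OF Y_integrable[OF t]])
  define N where "N = real_cond_exp M ?G (\<lambda>\<omega>. I \<omega> * Y t \<omega>)"
  define D where "D = real_cond_exp M ?G I"
  have NDm: "N \<in> borel_measurable ?G" "D \<in> borel_measurable ?G" by (auto simp: N_def D_def)
  have ND: "AE \<omega> in M. Num x t \<omega> = N \<omega>" "AE \<omega> in M. Den x t \<omega> = D \<omega>"
    using Num_process(1)[of x] Den_process(1)[of x] t
    by (auto simp: is_cond_exp_process_def N_def D_def I_def)
  define v where "v \<omega> = N \<omega> / D \<omega>" for \<omega>
  have v: "v \<in> borel_measurable ?G" unfolding v_def by (intro borel_measurable_divide NDm)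
  have GM: "A \<in> sets M" if "A \<in> sets ?G" for A using that by (rule sets_info)
  have FM: "A \<in> sets M" if "A \<in> sets ?F" for A using that F_sub by (auto simp: subalgebra_def)
  \<comment> \<open>Where \<open>D = 0\<close>, almost surely \<open>I = 0\<close>, and therefore also \<open>N = 0\<close>.\<close>
  define D0 where "D0 = {\<omega> \<in> space ?G. D \<omega> = 0}"
  have D0: "D0 \<in> sets ?G" unfolding D0_def using NDm by measurable
  have "AE \<omega> in M. \<omega> \<in> D0 \<longrightarrow> I \<omega> = 0"
  proof -
    have "(LINT \<omega>:D0|M. I \<omega>) = (LINT \<omega>:D0|M. D \<omega>)" unfolding D_def by (rule G.real_cond_exp_intA[OF I(1) D0])
    also have "\<dots> = 0" unfolding set_lebesgue_integral_def by (rule integral_eq_zero_AE) (auto simp: D0_def indicator_def)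
    finally have "(LINT \<omega>|M. indicator D0 \<omega> * I \<omega>) = 0" by (simp add: set_lebesgue_integral_def)
    moreover have "integrable M (\<lambda>\<omega>. indicator D0 \<omega> * I \<omega>)"
      using integrable_mult_indicator[OF GM[OF D0] I(1)] by simp
    ultimately have "AE \<omega> in M. indicator D0 \<omega> * I \<omega> = 0"
      by (subst (asm) integral_nonneg_eq_0_iff_AE) (auto simp: I01)
    then show ?thesis by eventually_elim (auto simp: indicator_def split: if_splits)
  qed
  note I0 = this
  have N0: "AE \<omega> in M. \<omega> \<in> D0 \<longrightarrow> N \<omega> = 0"
  proof -
    have i0: "(indicator D0 :: 'a \<Rightarrow> real) \<in> borel_measurable ?G" using D0 by auto
    have int: "integrable M (\<lambda>\<omega>. indicator D0 \<omega> * (I \<omega> * Y t \<omega>))"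
      using integrable_mult_indicator[OF GM[OF D0] IY] by simp
    have "AE \<omega> in M. real_cond_exp M ?G (\<lambda>\<omega>. indicator D0 \<omega> * (I \<omega> * Y t \<omega>)) \<omega> = indicator D0 \<omega> * N \<omega>"
      unfolding N_def by (rule G.real_cond_exp_mult[OF i0 _ int]) (use IY in auto)
    moreover have "AE \<omega> in M. real_cond_exp M ?G (\<lambda>\<omega>. indicator D0 \<omega> * (I \<omega> * Y t \<omega>)) \<omega> = real_cond_exp M ?G (\<lambda>_. 0) \<omega>"
    proof (rule G.real_cond_exp_cong)
      show "AE \<omega> in M. indicator D0 \<omega> * (I \<omega> * Y t \<omega>) = 0"
        using I0 by eventually_elim (auto simp: indicator_def)
    qed (use int in auto)
    moreover have "AE \<omega> in M. real_cond_exp M ?G (\<lambda>_. 0) \<omega> = 0" by (rule G.real_cond_exp_F_meas) auto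
    ultimately show ?thesis by eventually_elim (auto simp: indicator_def split: if_splits)
  qed
  \<comment> \<open>Where \<open>D = 0\<close> the convention for division gives \<open>v = 0\<close>, which is consistent with \<open>N = v D\<close>.\<close>
  have vD: "AE \<omega> in M. N \<omega> = v \<omega> * D \<omega>"
    using N0 AE_space by eventually_elim (auto simp: v_def D0_def)
  have part: "AE \<omega> in M. ZJ Z t \<omega> = x \<and> \<bar>v \<omega>\<bar> \<le> real k \<longrightarrow> real_cond_exp M ?F (Y t) \<omega> = v \<omega>" for k
  proof -
    define E where "E = {\<omega> \<in> space ?G. \<bar>v \<omega>\<bar> \<le> real k}"
    have E: "E \<in> sets ?G" unfolding E_def using v by measurable
    define S where "S = E \<inter> {\<omega> \<in> space M. ZJ Z t \<omega> = x}"
    have S: "S \<in> sets ?F" unfolding S_def by (rule info_in_cur_info[OF E])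
    have iS: "(indicator S :: 'a \<Rightarrow> real) \<in> borel_measurable ?F" using S by auto
    have intY: "integrable M (\<lambda>\<omega>. indicator S \<omega> * Y t \<omega>)"
      using integrable_mult_indicator[OF FM[OF S] Y_integrable[OF t]] by simp
    have vM: "v \<in> borel_measurable M" by (rule measurable_from_subalg[OF subalgebra_info v])
    have intEv: "integrable M (\<lambda>\<omega>. indicator (A \<inter> E) \<omega> * v \<omega> * I \<omega>)" if "A \<in> sets ?G" for A
    proof (rule integrable_const_bound[of _ "real k"])
      show "AE \<omega> in M. norm (indicator (A \<inter> E) \<omega> * v \<omega> * I \<omega>) \<le> real k"
        by (auto simp: indicator_def E_def I01)
      show "(\<lambda>\<omega>. indicator (A \<inter> E) \<omega> * v \<omega> * I \<omega>) \<in> borel_measurable M"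
        using vM I(1) GM[OF E] GM[OF that] by (intro borel_measurable_times) auto
    qed
    have Sv: "indicator S \<omega> * v \<omega> = indicator (space M \<inter> E) \<omega> * v \<omega> * I \<omega>" for \<omega>
      by (auto simp: S_def E_def indicator_def I01)
    have intv: "integrable M (\<lambda>\<omega>. indicator S \<omega> * v \<omega>)"
      unfolding Sv using sets.top[of ?G] by (intro intEv) simp
    have "AE \<omega> in M. real_cond_exp M ?F (\<lambda>\<omega>. indicator S \<omega> * Y t \<omega>) \<omega> = indicator S \<omega> * v \<omega>"
    proof (rule F.real_cond_exp_charact[OF _ intY intv])
      show "(\<lambda>\<omega>. indicator S \<omega> * v \<omega>) \<in> borel_measurable ?F"
      proof -
        have "(\<lambda>\<omega>. of_bool (ZJ Z t \<omega> = x) * (indicator E \<omega> * v \<omega>)) \<in> borel_measurable ?F"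
          using E v by (intro measurable_cur_info) auto
        also have "?this \<longleftrightarrow> ?thesis" by (intro measurable_cong) (auto simp: S_def indicator_def)
        finally show ?thesis .
      qed
      fix A assume A: "A \<in> sets ?F"
      obtain A' where A': "A' \<in> sets ?G" "\<And>\<omega>. ZJ Z t \<omega> = x \<Longrightarrow> \<omega> \<in> A \<longleftrightarrow> \<omega> \<in> A'"
        using cur_info_trace[OF A] by metis
      have AE: "A' \<inter> E \<in> sets ?G" using A'(1) E by auto
      have "(LINT \<omega>:A|M. indicator S \<omega> * Y t \<omega>) = (LINT \<omega>:A' \<inter> E|M. I \<omega> * Y t \<omega>)"
        unfolding set_lebesgue_integral_def
        using A'(2) by (intro Bochner_Integration.integral_cong) (auto simp: S_def indicator_def I01)
      also have "\<dots> = (LINT \<omega>:A' \<inter> E|M. N \<omega>)" unfolding N_def by (rule G.real_cond_exp_intA[OF IY AE])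
      also have "\<dots> = (LINT \<omega>|M. (indicator (A' \<inter> E) \<omega> * v \<omega>) * D \<omega>)"
        unfolding set_lebesgue_integral_def
      proof (rule integral_cong_AE)
        show "AE \<omega> in M. indicator (A' \<inter> E) \<omega> *\<^sub>R N \<omega> = indicator (A' \<inter> E) \<omega> * v \<omega> * D \<omega>"
          using vD by eventually_elim simp
      qed (use GM[OF AE] vM NDm[THEN measurable_from_subalg[OF subalgebra_info]] in \<open>auto intro!: borel_measurable_times\<close>)
      also have "\<dots> = (LINT \<omega>|M. (indicator (A' \<inter> E) \<omega> * v \<omega>) * I \<omega>)"
        unfolding D_def
      proof (rule G.real_cond_exp_intg(2))
        show "(\<lambda>\<omega>. indicator (A' \<inter> E) \<omega> * v \<omega>) \<in> borel_measurable ?G" using AE v by (intro borel_measurable_times) auto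
      qed (use intEv[OF A'(1)] I(1) in auto)
      also have "\<dots> = (LINT \<omega>:A|M. indicator S \<omega> * v \<omega>)"
        unfolding set_lebesgue_integral_def
        using A'(2) by (intro Bochner_Integration.integral_cong) (auto simp: S_def indicator_def I01)
      finally show "(LINT \<omega>:A|M. indicator S \<omega> * Y t \<omega>) = (LINT \<omega>:A|M. indicator S \<omega> * v \<omega>)" .
    qed
    moreover have "AE \<omega> in M. real_cond_exp M ?F (\<lambda>\<omega>. indicator S \<omega> * Y t \<omega>) \<omega> = indicator S \<omega> * real_cond_exp M ?F (Y t) \<omega>"
      by (rule F.real_cond_exp_mult[OF iS _ intY]) (use Y_integrable[OF t] in auto)
    ultimately show ?thesis using AE_space
      by eventually_elim (auto simp: S_def E_def indicator_def)
  qed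
  have "AE \<omega> in M. \<forall>k. ZJ Z t \<omega> = x \<and> \<bar>v \<omega>\<bar> \<le> real k \<longrightarrow> real_cond_exp M ?F (Y t) \<omega> = v \<omega>"
    unfolding AE_all_countable using part by blast
  with ND show ?thesis
  proof eventually_elim
    case (elim \<omega>)
    obtain k where "\<bar>v \<omega>\<bar> \<le> real k" using real_arch_simple by blast
    with elim show ?case by (auto simp: res_def v_def)
  qed
qed

lemma state_reserve_eq:
  assumes "\<omega> \<in> space M"
  shows "state_reserve M Z \<zeta> Y j t \<omega> = res (j, exit_count (path \<omega>) j t) t \<omega>"
proof -
  let ?n = "exit_count (path \<omega>) j t"
  have "state_reserve M Z \<zeta> Y j t \<omega> = (\<Sum>n. of_bool (?n = n) * res (j, n) t \<omega>)"
    unfolding state_reserve_def sojourn_reserve_eq exits_before_eq[where Z = Z, OF Z_path[OF assms]] ..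
  also have "\<dots> = (\<Sum>n\<in>{?n}. of_bool (?n = n) * res (j, n) t \<omega>)"
    by (rule suminf_finite) auto
  finally show ?thesis by simp
qed

lemma state_reserve_on_visit:
  assumes "\<omega> \<in> space M" "Z t \<omega> = j"
  shows "state_reserve M Z \<zeta> Y j t \<omega> = res (ZJ Z t \<omega>) t \<omega>"
  unfolding state_reserve_eq[OF assms(1)] ZJ_eq_numbered[where Z = Z, OF Z_path[OF assms(1)]] numbered_def
  using assms(2) by simp

lemma state_reserve_measurable:
  assumes t: "0 \<le> t"
  shows "state_reserve M Z \<zeta> Y j t \<in> borel_measurable M"
proof -
  have "(\<lambda>\<omega>. of_bool (exit_count (path \<omega>) j t = n) * res (j, n) t \<omega>) \<in> borel_measurable M" for n
  proof (intro borel_measurable_times)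
    have "{\<omega> \<in> space M. exit_count (path \<omega>) j t = n} \<in> sets M"
      by (rule sets_full_info[OF exit_count_eq_event])
    then have "Measurable.pred M (\<lambda>\<omega>. exit_count (path \<omega>) j t = n)" by (simp add: pred_def)
    then show "(\<lambda>\<omega>. of_bool (exit_count (path \<omega>) j t = n) :: real) \<in> borel_measurable M" by measurable
    show "res (j, n) t \<in> borel_measurable M" by (rule measurable_from_subalg[OF subalgebra_info res_measurable[OF t]])
  qed
  then have "(\<lambda>\<omega>. \<Sum>n. of_bool (exit_count (path \<omega>) j t = n) * res (j, n) t \<omega>) \<in> borel_measurable M"
    by (rule borel_measurable_suminf)
  also have "?this \<longleftrightarrow> ?thesis"
    unfolding state_reserve_def sojourn_reserve_eq
    by (intro measurable_cong) (simp add: exits_before_eq[where Z = Z, OF Z_path])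
  finally show ?thesis .
qed

lemma state_reserve_version:
  assumes t: "0 \<le> t" and V: "AE \<omega> in M. V t \<omega> = real_cond_exp M (reduced_info M Z \<zeta> t) (Y t) \<omega>"
  shows "AE \<omega> in M. of_bool (Z t \<omega> = j) * state_reserve M Z \<zeta> Y j t \<omega> = of_bool (Z t \<omega> = j) * V t \<omega>"
proof -
  have "reduced_info M Z \<zeta> t = augment M (cur_info (ZJ Z t))"
    by (simp add: reduced_info_def cur_info_def)
  then have "AE \<omega> in M. real_cond_exp M (reduced_info M Z \<zeta> t) (Y t) \<omega> = real_cond_exp M (cur_info (ZJ Z t)) (Y t) \<omega>"
    using real_cond_exp_augment[OF subalgebra_cur_info Y_integrable[OF t]] ZJ_event'[OF t] by simp
  moreover have "AE \<omega> in M. \<forall>x. ZJ Z t \<omega> = x \<longrightarrow> real_cond_exp M (cur_info (ZJ Z t)) (Y t) \<omega> = res x t \<omega>"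
    unfolding AE_all_countable using res_on_visit[OF t] by blast
  ultimately show ?thesis using V AE_space
    by eventually_elim (auto simp: state_reserve_on_visit)
qed

text \<open>
  The visit that is in progress at \<open>t-\<close> has the number of exits strictly before \<open>t\<close>, which is also the
  index that the reserve uses at \<open>t\<close>.
\<close>

lemma state_reserve_left_measurable:
  assumes t: "0 < t"
  shows "(\<lambda>\<omega>. of_bool (left_val (path \<omega>) t = j) * state_reserve M Z \<zeta> Y j t \<omega>)
    \<in> borel_measurable (reduced_info_left M Z \<zeta> t)"
proof -
  let ?U = "ZJ_left Z t"
  have "(\<lambda>\<omega>. \<Sum>n. of_bool (?U \<omega> = (j, n)) * res (j, n) t \<omega>) \<in> borel_measurable (cur_info ?U)"
    using t by (intro borel_measurable_suminf measurable_cur_info res_measurable) simp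
  also have "?this \<longleftrightarrow> (\<lambda>\<omega>. of_bool (left_val (path \<omega>) t = j) * state_reserve M Z \<zeta> Y j t \<omega>) \<in> borel_measurable (cur_info ?U)"
  proof (rule measurable_cong)
    fix \<omega> assume "\<omega> \<in> space (cur_info ?U)"
    then have \<omega>: "\<omega> \<in> space M" by simp
    let ?k = "left_val (path \<omega>) t"
    have U: "?U \<omega> = (?k, exit_count (path \<omega>) ?k t)"
      unfolding ZJ_left_def ZJ_path[OF \<omega>] by (rule left_val_numbered[OF Z_path[OF \<omega>] t])
    have "(\<Sum>n. of_bool (?U \<omega> = (j, n)) * res (j, n) t \<omega>) =
        (\<Sum>n\<in>{exit_count (path \<omega>) ?k t}. of_bool (?U \<omega> = (j, n)) * res (j, n) t \<omega>)"
      by (rule suminf_finite) (auto simp: U)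
    then show "(\<Sum>n. of_bool (?U \<omega> = (j, n)) * res (j, n) t \<omega>) =
        of_bool (?k = j) * state_reserve M Z \<zeta> Y j t \<omega>"
      by (auto simp: U state_reserve_eq[OF \<omega>])
  qed
  finally have "(\<lambda>\<omega>. of_bool (left_val (path \<omega>) t = j) * state_reserve M Z \<zeta> Y j t \<omega>) \<in> borel_measurable (cur_info ?U)" .
  then show ?thesis
    unfolding reduced_info_left_def cur_info_def[symmetric] by (rule borel_measurable_augment) simp
qed

end

section \<open>Sums over the crossing times of a visit\<close>

lemma exit_between:
  assumes z: "pure_jump_path z" and "0 \<le> s" "s < u" "z s = d" "z u \<noteq> d"
  shows "\<exists>v\<in>exit_times z d. s < v \<and> v \<le> u"
proof (rule ccontr)
  assume no: "\<not> ?thesis"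
  have "z r = d" if "s \<le> r" "r < u" for r
    by (rule no_exit_stay[OF z \<open>0 \<le> s\<close> \<open>z s = d\<close> _ that]) (use no in auto)
  then have "left_val z u = d" using \<open>s < u\<close> by (intro left_val_const[of s]) auto
  then have "u \<in> exit_times z d" using assms by (auto simp: exit_times_def)
  with no \<open>s < u\<close> show False by auto
qed

lemma exit_times_step:
  assumes "0 \<le> s" "s < u" and const: "\<And>r. s \<le> r \<Longrightarrow> r < u \<Longrightarrow> z r = k"
  shows "exit_times z d \<inter> {..u} = (exit_times z d \<inter> {..s}) \<union> (if k = d \<and> z u \<noteq> d then {u} else {})"
proof -
  have lu: "left_val z u = k" using assms by (intro left_val_const[of s]) auto
  have "r \<notin> exit_times z d" if "s < r" "r < u" for r
    using exit_times_stay[of s u z k r d] assms(1) const that by auto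
  note between = this
  have u: "u \<in> exit_times z d \<longleftrightarrow> k = d \<and> z u \<noteq> d"
    using lu assms(1,2) by (auto simp: exit_times_def)
  have "r \<in> exit_times z d \<and> r \<le> u \<longleftrightarrow> r \<in> exit_times z d \<and> r \<le> s \<or> r = u \<and> u \<in> exit_times z d" for r
    using between[of r] assms(2) by (cases "r \<le> s"; cases "r < u") auto
  then show ?thesis unfolding u[symmetric] by auto
qed

lemma tendsto_right_closed:
  fixes C :: "real \<Rightarrow> real"
  assumes "(C \<longlongrightarrow> C \<sigma>) (at_right \<sigma>)" "f \<longlonglongrightarrow> \<sigma>" "\<And>n. \<sigma> \<le> f n"
  shows "(\<lambda>n. C (f n)) \<longlonglongrightarrow> C \<sigma>"
proof -
  have "(C \<longlongrightarrow> C \<sigma>) (at \<sigma> within {\<sigma>..})"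
    using assms(1) by (simp add: at_within_Ici_at_right)
  then have "continuous (at \<sigma> within {\<sigma>..}) C" by (simp add: continuous_within)
  from continuous_within_tendsto_compose'[OF this _ assms(2)] assms(3) show ?thesis by auto
qed

definition grid :: "real \<Rightarrow> nat \<Rightarrow> nat \<Rightarrow> real" where
  "grid t k i = t * real i / 2 ^ k"

lemma grid_mono: "0 \<le> t \<Longrightarrow> i \<le> j \<Longrightarrow> grid t k i \<le> grid t k j"
  by (auto simp: grid_def intro!: divide_right_mono mult_left_mono)

lemma grid_nonneg: "0 \<le> t \<Longrightarrow> 0 \<le> grid t k i"
  by (simp add: grid_def)

lemma grid_le: "0 \<le> t \<Longrightarrow> i \<le> 2 ^ k \<Longrightarrow> grid t k i \<le> t"
proof -
  assume *: "0 \<le> t" "i \<le> 2 ^ k"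
  then have "grid t k i \<le> grid t k (2 ^ k)" by (rule grid_mono)
  also have "\<dots> = t" by (simp add: grid_def)
  finally show ?thesis .
qed

lemma grid_step: "grid t k (Suc i) = grid t k i + t / 2 ^ k"
  by (simp add: grid_def field_simps)

lemma grid_sum_tendsto:
  fixes C :: "real \<Rightarrow> real"
  assumes \<sigma>: "0 < \<sigma>" "\<sigma> \<le> t" and C: "(C \<longlongrightarrow> C \<sigma>) (at_right \<sigma>)"
  shows "(\<lambda>k. \<Sum>i<2 ^ k. of_bool (grid t k i < \<sigma> \<and> \<sigma> \<le> grid t k (Suc i)) * C (grid t k (Suc i))) \<longlonglongrightarrow> C \<sigma>"
proof -
  have t: "0 < t" using \<sigma> by simp
  \<comment> \<open>The grid interval of index \<open>N k\<close> is the one that contains \<open>\<sigma>\<close>.\<close>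
  define N where "N k = nat (\<lceil>\<sigma> * 2 ^ k / t\<rceil> - 1)" for k
  have pos: "0 < \<sigma> * 2 ^ k / t" "\<sigma> * 2 ^ k / t \<le> 2 ^ k" for k using \<sigma> t by (auto simp: field_simps)
  have c1: "1 \<le> \<lceil>\<sigma> * 2 ^ k / t\<rceil>" for k using pos(1)[of k] by linarith
  have rN: "real (N k) = of_int \<lceil>\<sigma> * 2 ^ k / t\<rceil> - 1" for k using c1[of k] by (simp add: N_def)
  have iff: "grid t k i < \<sigma> \<and> \<sigma> \<le> grid t k (Suc i) \<longleftrightarrow> i = N k" for k i
  proof -
    have "grid t k i < \<sigma> \<longleftrightarrow> real i < \<sigma> * 2 ^ k / t" "\<sigma> \<le> grid t k (Suc i) \<longleftrightarrow> \<sigma> * 2 ^ k / t \<le> real i + 1"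
      using t by (auto simp: grid_def field_simps)
    moreover have "real i < \<sigma> * 2 ^ k / t \<and> \<sigma> * 2 ^ k / t \<le> real i + 1 \<longleftrightarrow> \<lceil>\<sigma> * 2 ^ k / t\<rceil> = int i + 1"
      by (simp add: ceiling_eq_iff)
    ultimately show ?thesis using c1[of k] by (auto simp: N_def)
  qed
  have N: "N k < 2 ^ k" for k
  proof -
    have "\<lceil>\<sigma> * 2 ^ k / t\<rceil> \<le> 2 ^ k" using pos(2)[of k] by (simp add: ceiling_le_iff)
    then have "real_of_int \<lceil>\<sigma> * 2 ^ k / t\<rceil> \<le> real_of_int (2 ^ k)" by (simp only: of_int_le_iff)
    then have "real_of_int \<lceil>\<sigma> * 2 ^ k / t\<rceil> \<le> 2 ^ k" by (simp only: of_int_power of_int_numeral)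
    then have "real (N k) < 2 ^ k" unfolding rN by linarith
    then show ?thesis by (metis of_nat_less_iff of_nat_numeral of_nat_power)
  qed
  have "(\<Sum>i<2 ^ k. of_bool (grid t k i < \<sigma> \<and> \<sigma> \<le> grid t k (Suc i)) * C (grid t k (Suc i))) = C (grid t k (Suc (N k)))" for k
  proof -
    have "(\<Sum>i<2 ^ k. of_bool (grid t k i < \<sigma> \<and> \<sigma> \<le> grid t k (Suc i)) * C (grid t k (Suc i))) =
        (\<Sum>i\<in>{N k}. of_bool (i = N k) * C (grid t k (Suc i)))"
      unfolding iff using N[of k] by (intro sum.mono_neutral_right) auto
    then show ?thesis by simp
  qed
  moreover have "(\<lambda>k. C (grid t k (Suc (N k)))) \<longlonglongrightarrow> C \<sigma>"
  proof (rule tendsto_right_closed[OF C])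
    have b: "\<sigma> \<le> grid t k (Suc (N k))" "grid t k (Suc (N k)) \<le> \<sigma> + t * (1 / 2) ^ k" for k
      using iff[of k "N k"] grid_step[of t k "N k"] by (auto simp: power_one_over)
    show "\<sigma> \<le> grid t k (Suc (N k))" for k by (rule b)
    have "(\<lambda>k. \<sigma> + t * (1 / 2) ^ k) \<longlonglongrightarrow> \<sigma> + t * 0" by (intro tendsto_intros LIMSEQ_power_zero) simp
    then have lim: "(\<lambda>k. \<sigma> + t * (1 / 2) ^ k) \<longlonglongrightarrow> \<sigma>" by simp
    show "(\<lambda>k. grid t k (Suc (N k))) \<longlonglongrightarrow> \<sigma>"
      by (rule tendsto_sandwich[OF always_eventually always_eventually tendsto_const lim]) (intro allI b)+
  qed
  ultimately show ?thesis by simp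
qed

text \<open>
  For a fine grid, the only grid interval over which the path is seen to leave \<open>d\<close> is the one that
  contains the crossing time, and its right end point tends to that time from the right.
\<close>

lemma grid_crossing_tendsto:
  fixes C :: "real \<Rightarrow> real"
  assumes z: "pure_jump_path z" and t: "0 \<le> t"
    and one: "\<And>u v. u \<in> exit_times z d \<Longrightarrow> v \<in> exit_times z d \<Longrightarrow> u = v"
    and C: "\<And>s. 0 \<le> s \<Longrightarrow> (C \<longlongrightarrow> C s) (at_right s)"
  shows "(\<lambda>k. \<Sum>i<2 ^ k. of_bool (z (grid t k i) = d \<and> z (grid t k (Suc i)) \<noteq> d) * C (grid t k (Suc i)))
    \<longlonglongrightarrow> (\<Sum>s\<in>exit_times z d \<inter> {..t}. C s)"
proof -
  have cross: "\<exists>v\<in>exit_times z d \<inter> {..t}. grid t k i < v \<and> v \<le> grid t k (Suc i)"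
    if "z (grid t k i) = d" "z (grid t k (Suc i)) \<noteq> d" "i < 2 ^ k" for k i
  proof -
    have "grid t k i \<noteq> grid t k (Suc i)" using that by metis
    then have "grid t k i < grid t k (Suc i)" using grid_mono[OF t, of i "Suc i" k] by simp
    from exit_between[OF z grid_nonneg[OF t] this that(1,2)] grid_le[OF t, of "Suc i" k] that(3)
    show ?thesis by fastforce
  qed
  show ?thesis
  proof (cases "exit_times z d \<inter> {..t} = {}")
    case True
    have "(\<Sum>i<2 ^ k. of_bool (z (grid t k i) = d \<and> z (grid t k (Suc i)) \<noteq> d) * C (grid t k (Suc i))) = 0" for k
      by (intro sum.neutral) (use cross True in auto)
    with True show ?thesis by simp
  next
    case False
    then obtain \<sigma> where s: "\<sigma> \<in> exit_times z d" "\<sigma> \<le> t" by auto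
    have set: "exit_times z d \<inter> {..t} = {\<sigma>}" using one s by auto
    have \<sigma>: "0 < \<sigma>" "left_val z \<sigma> = d" "z \<sigma> \<noteq> d" using s by (auto simp: exit_times_def)
    obtain e where e: "0 \<le> e" "e < \<sigma>" "\<And>r. e < r \<Longrightarrow> r < \<sigma> \<Longrightarrow> z r = d"
      using pure_jump_left[OF z \<sigma>(1)] \<sigma>(2) by metis
    obtain e' where e': "\<sigma> < e'" "\<And>r. \<sigma> \<le> r \<Longrightarrow> r < e' \<Longrightarrow> z r = z \<sigma>"
      using pure_jump_right[OF z, of \<sigma>] \<sigma>(1) by auto
    have "(\<lambda>k. t * (1 / 2) ^ k) \<longlonglongrightarrow> t * 0" by (intro tendsto_intros LIMSEQ_power_zero) simp
    then have "eventually (\<lambda>k. t * (1 / 2) ^ k < min (\<sigma> - e) (e' - \<sigma>)) sequentially"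
      using e(2) e'(1) by (intro order_tendstoD(2)[where y = "t * 0"]) auto
    then have ev: "eventually (\<lambda>k. (\<Sum>i<2 ^ k. of_bool (grid t k i < \<sigma> \<and> \<sigma> \<le> grid t k (Suc i)) * C (grid t k (Suc i))) =
      (\<Sum>i<2 ^ k. of_bool (z (grid t k i) = d \<and> z (grid t k (Suc i)) \<noteq> d) * C (grid t k (Suc i)))) sequentially"
    proof eventually_elim
      case (elim k)
      have "grid t k i < \<sigma> \<and> \<sigma> \<le> grid t k (Suc i) \<longleftrightarrow> z (grid t k i) = d \<and> z (grid t k (Suc i)) \<noteq> d"
        if i: "i < 2 ^ k" for i
      proof
        assume *: "grid t k i < \<sigma> \<and> \<sigma> \<le> grid t k (Suc i)"
        have st: "grid t k (Suc i) = grid t k i + t * (1 / 2) ^ k" by (simp add: grid_step power_one_over)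
        have "z (grid t k i) = d" using * elim st by (intro e(3)) auto
        moreover have "z (grid t k (Suc i)) = z \<sigma>" using * elim st by (intro e'(2)) auto
        ultimately show "z (grid t k i) = d \<and> z (grid t k (Suc i)) \<noteq> d" using \<sigma>(3) by simp
      next
        assume "z (grid t k i) = d \<and> z (grid t k (Suc i)) \<noteq> d"
        with cross[OF _ _ i] set show "grid t k i < \<sigma> \<and> \<sigma> \<le> grid t k (Suc i)" by auto
      qed
      then show ?case by (intro sum.cong) auto
    qed
    have "(\<lambda>k. \<Sum>i<2 ^ k. of_bool (grid t k i < \<sigma> \<and> \<sigma> \<le> grid t k (Suc i)) * C (grid t k (Suc i))) \<longlonglongrightarrow> C \<sigma>"
      using s(2) \<sigma>(1) by (intro grid_sum_tendsto C) auto
    from Lim_transform_eventually[OF this ev] show ?thesis by (simp add: set)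
  qed
qed

lemma visit_crossing_unique:
  assumes b: "pure_jump_path b" and conv: "\<And>s t u. 0 \<le> s \<Longrightarrow> s \<le> t \<Longrightarrow> t \<le> u \<Longrightarrow> b s \<Longrightarrow> b u \<Longrightarrow> b t"
    and u: "u \<in> exit_times b d" and v: "v \<in> exit_times b d"
  shows "u = v"
proof -
  have "False" if uv: "u < v" and u: "u \<in> exit_times b d" and v: "v \<in> exit_times b d" for u v
  proof -
    have u': "0 < u" "left_val b u = d" "b u \<noteq> d" and v': "0 < v" "left_val b v = d" "b v \<noteq> d"
      using u v by (auto simp: exit_times_def)
    obtain e where e: "0 \<le> e" "e < u" "\<And>r. e < r \<Longrightarrow> r < u \<Longrightarrow> b r = d"
      using pure_jump_left[OF b u'(1)] u'(2) by metis
    obtain e' where e': "0 \<le> e'" "e' < v" "\<And>r. e' < r \<Longrightarrow> r < v \<Longrightarrow> b r = d"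
      using pure_jump_left[OF b v'(1)] v'(2) by metis
    obtain p where p: "e < p" "p < u" using dense[OF e(2)] by auto
    obtain q where q: "max e' u < q" "q < v" using dense[of "max e' u" v] e'(2) uv by auto
    have "b p = d" "b q = d" using e(3)[OF p] e'(3)[of q] q by auto
    have ord: "0 \<le> p" "p \<le> u" "u \<le> q" "q \<le> v" "0 \<le> u" using p q e(1) u'(1) by auto
    show False
    proof (cases d)
      case True
      with conv[OF ord(1-3)] \<open>b p = d\<close> \<open>b q = d\<close> u'(3) show False by simp
    next
      case False
      with conv[OF ord(5,3,4)] u'(3) v'(3) \<open>b q = d\<close> show False by simp
    qed
  qed
  then show ?thesis using u v by (metis linorder_neqE)
qed

definition crossing_sum :: "(real \<Rightarrow> bool) \<Rightarrow> bool \<Rightarrow> (real \<Rightarrow> real) \<Rightarrow> real \<Rightarrow> real" where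
  "crossing_sum b d f t = (\<Sum>s\<in>exit_times b d \<inter> {..t}. f s)"

text \<open>
  With \<open>b\<close> telling whether a fixed state is occupied, this is the value of \<open>f\<close> at the exit, or now if the
  visit lasts, minus the value at the entry, or at time \<open>0\<close>.  Exits are crossings from \<^const>\<open>True\<close>
  and entries are crossings from \<^const>\<open>False\<close>.
\<close>

definition visit_gain :: "(real \<Rightarrow> bool) \<Rightarrow> (real \<Rightarrow> real) \<Rightarrow> real \<Rightarrow> real" where
  "visit_gain b f t = of_bool (b t) * f t - of_bool (b 0) * f 0 + crossing_sum b True f t - crossing_sum b False f t"

lemma visit_gain_0: "visit_gain b f 0 = 0"
proof -
  have "exit_times b d \<inter> {..0} = {}" for d by (auto simp: exit_times_def)
  then show ?thesis by (simp add: visit_gain_def crossing_sum_def)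
qed

lemma crossing_sum_step:
  assumes b: "pure_jump_path b" and s: "0 \<le> s" "s < u" and const: "\<And>r. s \<le> r \<Longrightarrow> r < u \<Longrightarrow> b r = k"
  shows "crossing_sum b d f u = crossing_sum b d f s + of_bool (k = d \<and> b u \<noteq> d) * f u"
proof -
  have eq: "exit_times b d \<inter> {..u} = exit_times b d \<inter> {..s} \<union> (if k = d \<and> b u \<noteq> d then {u} else {})"
    by (rule exit_times_step[OF s const])
  have "sum f (exit_times b d \<inter> {..u}) =
      sum f (exit_times b d \<inter> {..s}) + sum f (if k = d \<and> b u \<noteq> d then {u} else {})"
    unfolding eq by (rule sum.union_disjoint) (use finite_exit_times[OF b, of d s] s in auto)
  then show ?thesis by (auto simp: crossing_sum_def)
qed

lemma visit_gain_step:
  assumes b: "pure_jump_path b" and s: "0 \<le> s" "s < u" and const: "\<And>r. s \<le> r \<Longrightarrow> r < u \<Longrightarrow> b r = k"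
  shows "visit_gain b f u - visit_gain b f s = of_bool k * (f u - f s)"
proof -
  have "b s = k" using const s by auto
  then show ?thesis
    unfolding visit_gain_def
    using crossing_sum_step[OF b s const, of True f] crossing_sum_step[OF b s const, of False f]
    by (cases k; cases "b u") auto
qed

lemma visit_gain_unvisited:
  assumes "\<And>s. 0 \<le> s \<Longrightarrow> s \<le> t \<Longrightarrow> \<not> b s" "0 \<le> t"
  shows "visit_gain b f t = 0"
proof -
  have "s \<notin> exit_times b d" if "s \<le> t" for s d
  proof
    assume *: "s \<in> exit_times b d"
    then have "0 < s" by (auto simp: exit_times_def)
    have "left_val b s = False" using assms(1) that \<open>0 < s\<close> by (intro left_val_const[of 0]) auto
    moreover have "\<not> b s" using assms(1) that \<open>0 < s\<close> by auto
    ultimately show False using * by (auto simp: exit_times_def)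
  qed
  then have "exit_times b d \<inter> {..t} = {}" for d by auto
  then show ?thesis using assms by (simp add: visit_gain_def crossing_sum_def)
qed

lemma crossing_sum_divide:
  assumes b: "pure_jump_path b" and one: "\<And>u v. u \<in> exit_times b d \<Longrightarrow> v \<in> exit_times b d \<Longrightarrow> u = v"
  shows "crossing_sum b d (\<lambda>s. f s / g s) t = crossing_sum b d f t / crossing_sum b d g t"
proof (cases "exit_times b d \<inter> {..t} = {}")
  case False
  then obtain \<sigma> where "exit_times b d \<inter> {..t} = {\<sigma>}" using one by auto
  then show ?thesis by (simp add: crossing_sum_def)
qed (simp add: crossing_sum_def)

context reserve_model
begin

subsection \<open>The integral process\<close>

definition at_state :: "'s \<times> nat \<Rightarrow> 'a \<Rightarrow> real \<Rightarrow> bool" where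
  "at_state x \<omega> t \<longleftrightarrow> ZJ Z t \<omega> = x"

lemma at_state_pure_jump:
  assumes "\<omega> \<in> space M" shows "pure_jump_path (at_state x \<omega>)"
  using ZJ_pure_jump[OF assms] unfolding pure_jump_path_def at_state_def
proof (elim conjE, intro conjI allI impI)
  fix t :: real assume *: "\<forall>t>0. \<exists>j. eventually (\<lambda>s. ZJ Z s \<omega> = j) (at_left t)" "0 < t"
  then obtain j where "eventually (\<lambda>s. ZJ Z s \<omega> = j) (at_left t)" by blast
  then have "eventually (\<lambda>s. (ZJ Z s \<omega> = x) = (j = x)) (at_left t)" by eventually_elim simp
  then show "\<exists>j. eventually (\<lambda>s. (ZJ Z s \<omega> = x) = j) (at_left t)" ..
next
  fix t :: real assume *: "\<forall>t\<ge>0. eventually (\<lambda>s. ZJ Z s \<omega> = ZJ Z t \<omega>) (at_right t)" "0 \<le> t"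
  then have "eventually (\<lambda>s. ZJ Z s \<omega> = ZJ Z t \<omega>) (at_right t)" by blast
  then show "eventually (\<lambda>s. (ZJ Z s \<omega> = x) = (ZJ Z t \<omega> = x)) (at_right t)" by eventually_elim simp
qed

lemma at_state_unique:
  assumes "\<omega> \<in> space M" "u \<in> exit_times (at_state x \<omega>) d" "v \<in> exit_times (at_state x \<omega>) d"
  shows "u = v"
proof (rule visit_crossing_unique[OF at_state_pure_jump[OF assms(1)] _ assms(2,3)])
  show "at_state x \<omega> t" if "0 \<le> s" "s \<le> t" "t \<le> u" "at_state x \<omega> s" "at_state x \<omega> u" for s t u
    using single_visitsD[OF ZJ_single[OF assms(1)], of s t u x] that by (simp add: at_state_def)
qed

lemma at_state_measurable:
  assumes f: "f \<in> borel_measurable (info x)" and s: "0 \<le> s" "s \<le> t"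
  shows "(\<lambda>\<omega>. of_bool (at_state x \<omega> s) * f \<omega> :: real) \<in> borel_measurable (full_info M Z t)"
  unfolding at_state_def by (rule measurable_on_visit[OF f _ \<zeta>_info s]) simp

lemma at_state_indicator: 
  assumes "0 \<le> s" "s \<le> t"
  shows "(\<lambda>\<omega>. of_bool (at_state x \<omega> s = d) :: real) \<in> borel_measurable (full_info M Z t)"
proof -
  have "Measurable.pred (full_info M Z t) (\<lambda>\<omega>. at_state x \<omega> s)"
    using ZJ_event[OF assms, of x] by (simp add: pred_def at_state_def)
  then show ?thesis by measurable
qed

definition grid_crossing :: "'s \<times> nat \<Rightarrow> bool \<Rightarrow> (real \<Rightarrow> 'a \<Rightarrow> real) \<Rightarrow> real \<Rightarrow> nat \<Rightarrow> 'a \<Rightarrow> real" where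
  "grid_crossing x d C t k \<omega> =
     (\<Sum>i<2 ^ k. of_bool (at_state x \<omega> (grid t k i) = d \<and> at_state x \<omega> (grid t k (Suc i)) \<noteq> d) * C (grid t k (Suc i)) \<omega>)"

lemma grid_crossing_measurable:
  assumes t: "0 \<le> t" and C: "\<And>s. 0 \<le> s \<Longrightarrow> C s \<in> borel_measurable (info x)"
  shows "grid_crossing x d C t k \<in> borel_measurable (full_info M Z t)"
  unfolding grid_crossing_def
proof (rule borel_measurable_sum)
  fix i :: nat assume i: "i \<in> {..<2 ^ k}"
  let ?s = "grid t k i" and ?u = "grid t k (Suc i)"
  have g: "0 \<le> ?s" "?s \<le> t" "0 \<le> ?u" "?u \<le> t" using i t by (auto intro: grid_nonneg grid_le)
  have "(\<lambda>\<omega>. (of_bool (at_state x \<omega> (if d then ?s else ?u)) * C ?u \<omega>) *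
      of_bool (at_state x \<omega> (if d then ?u else ?s) = False)) \<in> borel_measurable (full_info M Z t)"
    using g by (intro borel_measurable_times at_state_measurable at_state_indicator C) auto
  also have "(\<lambda>\<omega>. (of_bool (at_state x \<omega> (if d then ?s else ?u)) * C ?u \<omega>) *
      of_bool (at_state x \<omega> (if d then ?u else ?s) = False)) =
    (\<lambda>\<omega>. of_bool (at_state x \<omega> ?s = d \<and> at_state x \<omega> ?u \<noteq> d) * C ?u \<omega>)"
    by (cases d) (auto simp: fun_eq_iff)
  finally show "(\<lambda>\<omega>. of_bool (at_state x \<omega> ?s = d \<and> at_state x \<omega> ?u \<noteq> d) * C ?u \<omega>) \<in> borel_measurable (full_info M Z t)" .
qed

text \<open>
  The limits of numerator and denominator are taken separately because \<open>Den\<close> may vanish at the exit,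
  where the quotient need not be right-continuous.  Without a crossing this is \<open>0 / 0 = 0\<close>.
\<close>

definition crossing_value :: "'s \<times> nat \<Rightarrow> bool \<Rightarrow> real \<Rightarrow> 'a \<Rightarrow> real" where
  "crossing_value x d t \<omega> = lim (\<lambda>k. grid_crossing x d (Num x) t k \<omega>) / lim (\<lambda>k. grid_crossing x d (Den x) t k \<omega>)"

lemma crossing_value_measurable:
  assumes "0 \<le> t" shows "crossing_value x d t \<in> borel_measurable (full_info M Z t)"
  unfolding crossing_value_def
  by (intro borel_measurable_divide borel_measurable_lim_metric grid_crossing_measurable assms Num_Den_measurable)

lemma regular_right_cont:
  assumes "regular \<omega>" "0 \<le> s"
  shows "((\<lambda>t. Num x t \<omega>) \<longlongrightarrow> Num x s \<omega>) (at_right s)" "((\<lambda>t. Den x t \<omega>) \<longlongrightarrow> Den x s \<omega>) (at_right s)"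
proof -
  obtain m where m: "control m" "\<And>b. controlled (\<lambda>t. Num x t \<omega>) m 0 b" "\<And>b. controlled (\<lambda>t. Den x t \<omega>) m 0 b"
    using assms(1) unfolding regular_def by blast
  show "((\<lambda>t. Num x t \<omega>) \<longlongrightarrow> Num x s \<omega>) (at_right s)" "((\<lambda>t. Den x t \<omega>) \<longlongrightarrow> Den x s \<omega>) (at_right s)"
    by (rule controlled_tendsto_right[OF m(1) controlled_subset[OF m(2)], of s "s+1" "s+1"], use assms(2) in auto)
       (rule controlled_tendsto_right[OF m(1) controlled_subset[OF m(3)], of s "s+1" "s+1"], use assms(2) in auto)
qed

lemma crossing_value_eq:
  assumes \<omega>: "regular \<omega>" and t: "0 \<le> t"
  shows "crossing_value x d t \<omega> = crossing_sum (at_state x \<omega>) d (\<lambda>s. res x s \<omega>) t"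
proof -
  have sp: "\<omega> \<in> space M" using \<omega> by (simp add: regular_def)
  note b = at_state_pure_jump[OF sp, of x]
  have one: "u = v" if "u \<in> exit_times (at_state x \<omega>) d" "v \<in> exit_times (at_state x \<omega>) d" for u v
    by (rule at_state_unique[OF sp that])
  have "(\<lambda>k. grid_crossing x d (Num x) t k \<omega>) \<longlonglongrightarrow> crossing_sum (at_state x \<omega>) d (\<lambda>s. Num x s \<omega>) t"
    "(\<lambda>k. grid_crossing x d (Den x) t k \<omega>) \<longlonglongrightarrow> crossing_sum (at_state x \<omega>) d (\<lambda>s. Den x s \<omega>) t"
    unfolding grid_crossing_def crossing_sum_def
    by (rule grid_crossing_tendsto[OF b t one regular_right_cont(1)[OF \<omega>]], assumption+)
       (rule grid_crossing_tendsto[OF b t one regular_right_cont(2)[OF \<omega>]], assumption+)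
  moreover have "crossing_sum (at_state x \<omega>) d (\<lambda>s. Num x s \<omega> / Den x s \<omega>) t =
      crossing_sum (at_state x \<omega>) d (\<lambda>s. Num x s \<omega>) t / crossing_sum (at_state x \<omega>) d (\<lambda>s. Den x s \<omega>) t"
    by (rule crossing_sum_divide[OF b]) (rule one)
  ultimately show ?thesis
    unfolding crossing_value_def res_def by (simp add: limI)
qed

definition gain :: "'s \<times> nat \<Rightarrow> real \<Rightarrow> 'a \<Rightarrow> real" where
  "gain x t \<omega> = of_bool (at_state x \<omega> t) * res x t \<omega> - of_bool (at_state x \<omega> 0) * res x 0 \<omega> +
     crossing_value x True t \<omega> - crossing_value x False t \<omega>"

lemma gain_measurable: "0 \<le> t \<Longrightarrow> gain x t \<in> borel_measurable (full_info M Z t)"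
  unfolding gain_def
  by (intro borel_measurable_add borel_measurable_diff crossing_value_measurable at_state_measurable res_measurable) auto

lemma gain_eq: "regular \<omega> \<Longrightarrow> 0 \<le> t \<Longrightarrow> gain x t \<omega> = visit_gain (at_state x \<omega>) (\<lambda>s. res x s \<omega>) t"
  by (simp add: gain_def visit_gain_def crossing_value_eq)

text \<open>
  The integral of \<open>I\<^sub>j(s-)\<close> against the reserve of state \<open>j\<close>, visit by visit.
\<close>

definition total_gain :: "'s \<Rightarrow> real \<Rightarrow> 'a \<Rightarrow> real" where
  "total_gain j t \<omega> = (\<Sum>n. gain (j, n) t \<omega>)"

lemma total_gain_measurable: "0 \<le> t \<Longrightarrow> total_gain j t \<in> borel_measurable (full_info M Z t)"
  unfolding total_gain_def by (intro borel_measurable_suminf gain_measurable)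

lemma total_gain_finite:
  assumes \<omega>: "regular \<omega>" and t: "0 \<le> t" "t \<le> u"
  shows "total_gain j t \<omega> = (\<Sum>n\<le>exit_count (path \<omega>) j u. visit_gain (at_state (j, n) \<omega>) (\<lambda>s. res (j, n) s \<omega>) t)"
proof -
  have sp: "\<omega> \<in> space M" using \<omega> by (simp add: regular_def)
  have "gain (j, n) t \<omega> = 0" if "n \<notin> {..exit_count (path \<omega>) j u}" for n
    unfolding gain_eq[OF \<omega> t(1)]
  proof (rule visit_gain_unvisited[OF _ t(1)])
    fix s assume s: "0 \<le> s" "s \<le> t"
    show "\<not> at_state (j, n) \<omega> s"
    proof
      assume "at_state (j, n) \<omega> s"
      then have "n = exit_count (path \<omega>) j s"
        by (auto simp: at_state_def ZJ_eq_numbered[where Z = Z, OF Z_path[OF sp]] numbered_def)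
      also have "\<dots> \<le> exit_count (path \<omega>) j u" using s t by (intro exit_count_mono Z_path sp) auto
      finally show False using that by simp
    qed
  qed
  then have "total_gain j t \<omega> = (\<Sum>n\<le>exit_count (path \<omega>) j u. gain (j, n) t \<omega>)"
    unfolding total_gain_def by (intro suminf_finite) auto
  then show ?thesis by (simp add: gain_eq[OF \<omega> t(1)])
qed

lemma total_gain_0: "regular \<omega> \<Longrightarrow> total_gain j 0 \<omega> = 0"
  by (simp add: total_gain_finite[of \<omega> 0 0] visit_gain_0)

lemma total_gain_step:
  assumes \<omega>: "regular \<omega>" and s: "0 \<le> s" "s < u" and const: "\<And>r. s \<le> r \<Longrightarrow> r < u \<Longrightarrow> Z r \<omega> = k"
  shows "total_gain j u \<omega> - total_gain j s \<omega> =
    of_bool (k = j) * (state_reserve M Z \<zeta> Y j u \<omega> - state_reserve M Z \<zeta> Y j s \<omega>)"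
proof -
  have sp: "\<omega> \<in> space M" using \<omega> by (simp add: regular_def)
  let ?c = "exit_count (path \<omega>)"
  have sk: "Z s \<omega> = k" using const s by auto
  have cnt: "?c k r = ?c k s" if "s \<le> r" "r \<le> u" for r
    by (rule exit_count_stay[OF s(1) const that])
  have ZJ: "ZJ Z r \<omega> = (k, ?c k s)" if "s \<le> r" "r < u" for r
    using const[OF that] cnt[of r] that by (simp add: ZJ_eq_numbered[where Z = Z, OF Z_path[OF sp]] numbered_def)
  have step: "visit_gain (at_state (j, n) \<omega>) f u - visit_gain (at_state (j, n) \<omega>) f s =
      of_bool ((j, n) = (k, ?c k s)) * (f u - f s)" for n f
  proof (rule visit_gain_step[OF at_state_pure_jump[OF sp] s])
    fix r assume "s \<le> r" "r < u"
    from ZJ[OF this] show "at_state (j, n) \<omega> r = ((j, n) = (k, ?c k s))" by (auto simp: at_state_def)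
  qed
  have "total_gain j u \<omega> - total_gain j s \<omega> = (\<Sum>n\<le>?c j u. of_bool ((j, n) = (k, ?c k s)) * (res (j, n) u \<omega> - res (j, n) s \<omega>))"
    using s by (simp add: total_gain_finite[OF \<omega>, of _ u] sum_subtractf[symmetric] step)
  also have "\<dots> = of_bool (k = j) * (res (j, ?c j s) u \<omega> - res (j, ?c j s) s \<omega>)"
  proof (cases "k = j")
    case True
    have "(\<Sum>n\<le>?c j u. of_bool ((j, n) = (k, ?c k s)) * (res (j, n) u \<omega> - res (j, n) s \<omega>)) =
      (\<Sum>n\<in>{?c j s}. of_bool ((j, n) = (k, ?c k s)) * (res (j, n) u \<omega> - res (j, n) s \<omega>))"
      using True cnt[of u] s by (intro sum.mono_neutral_right) auto
    with True show ?thesis by simp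
  qed simp
  also have "\<dots> = of_bool (k = j) * (state_reserve M Z \<zeta> Y j u \<omega> - state_reserve M Z \<zeta> Y j s \<omega>)"
    using cnt[of u] s by (auto simp: state_reserve_eq[OF sp])
  finally show ?thesis .
qed

text \<open>
  During the visit the denominator is bounded away from zero, up to but excluding the exit time.
\<close>

lemma res_controlled_on_visit:
  assumes \<omega>: "regular \<omega>" and s: "0 \<le> s" "s < u" and here: "\<And>r. s \<le> r \<Longrightarrow> r < u \<Longrightarrow> ZJ Z r \<omega> = x"
  shows "\<exists>m. control m \<and> (\<forall>r<u. controlled (\<lambda>t. res x t \<omega>) m s r)"
proof -
  obtain m where m: "control m" "\<And>b. controlled (\<lambda>t. Num x t \<omega>) m 0 b" "\<And>b. controlled (\<lambda>t. Den x t \<omega>) m 0 b"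
    using \<omega> unfolding regular_def by blast
  have "ZJ Z s \<omega> = x" using here s by auto
  then obtain e where e: "0 < e" "\<And>r. 0 \<le> r \<Longrightarrow> ZJ Z r \<omega> = x \<Longrightarrow> e \<le> Den x r \<omega>"
    using \<omega> s(1) unfolding regular_def by blast
  define C where "C = \<bar>Num x 0 \<omega>\<bar> + (m u - m 0)"
  have C0: "0 \<le> C" using controlD[OF m(1), of 0 u] s by (simp add: C_def)
  have "controlled (\<lambda>t. res x t \<omega>) (\<lambda>t. (1 / e + C / e\<^sup>2) * m t) s r" if r: "r < u" for r
    unfolding res_def
  proof (rule controlled_divide[OF _ _ e(1) _ _ m(1) C0])
    show "controlled (\<lambda>t. Num x t \<omega>) m s r" by (rule controlled_subset[OF m(2)[of r]]) (use s in auto)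
    show "controlled (\<lambda>t. Den x t \<omega>) m s r" by (rule controlled_subset[OF m(3)[of r]]) (use s in auto)
    fix t assume t: "s \<le> t" "t \<le> r"
    show "e \<le> Den x t \<omega>" using t s r by (intro e(2) here) auto
    have "\<bar>Num x t \<omega> - Num x 0 \<omega>\<bar> \<le> m t - m 0" by (rule controlledD[OF m(2)[of t]]) (use t s in auto)
    moreover have "m t \<le> m u" using t r by (intro controlD[OF m(1)]) simp
    ultimately show "\<bar>Num x t \<omega>\<bar> \<le> C" unfolding C_def by linarith
  qed
  moreover have "control (\<lambda>t. (1 / e + C / e\<^sup>2) * m t)" using e(1) C0 by (intro control_cmult m(1)) simp
  ultimately show ?thesis by blast
qed

text \<open>
  Induction along the path of \<open>Z\<close>.  On a stay in \<open>j\<close> the quotient is controlled before the exit, and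
  \<open>controlled_end_jump\<close> adds its value at the exit, at which the denominator may vanish.
\<close>

lemma total_gain_controlled:
  assumes \<omega>: "regular \<omega>" and t: "0 \<le> t"
  shows "\<exists>m. control m \<and> controlled (\<lambda>t. total_gain j t \<omega>) m 0 t"
proof -
  have sp: "\<omega> \<in> space M" using \<omega> by (simp add: regular_def)
  show ?thesis
    using Z_path[OF sp] t
  proof (induction t rule: pure_jump_induct[consumes 2, case_names base step])
    case base
    have "controlled (\<lambda>t. total_gain j t \<omega>) (\<lambda>_. 0) 0 0"
      unfolding controlled_def
    proof (intro allI impI)
      fix s u :: real assume "0 \<le> s" "s \<le> u" "u \<le> 0"
      then have "s = u" by simp
      then show "\<bar>total_gain j u \<omega> - total_gain j s \<omega>\<bar> \<le> 0 - 0" by simp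
    qed
    with control_const show ?case by blast
  next
    case (step s u)
    note su = step(1,2)
    have const: "Z r \<omega> = Z s \<omega>" if "s \<le> r" "r < u" for r using that by (rule step(3))
    let ?X = "\<lambda>t. total_gain j t \<omega>"
    obtain m where m: "control m" "controlled ?X m 0 s" using step(4) by blast
    have inc: "?X r - ?X s = of_bool (Z s \<omega> = j) * (state_reserve M Z \<zeta> Y j r \<omega> - state_reserve M Z \<zeta> Y j s \<omega>)"
      if "s \<le> r" "r \<le> u" for r
    proof (cases "s = r")
      case False
      with that show ?thesis by (intro total_gain_step[OF \<omega> su(1)]) (auto intro: const)
    qed simp
    have "\<exists>m. control m \<and> (\<forall>r<u. controlled ?X m s r)"
    proof (cases "Z s \<omega> = j")
      case False
      have Xr: "?X r = ?X s" if "s \<le> r" "r \<le> u" for r using inc[OF that] False by simp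
      have "controlled ?X (\<lambda>_. 0) s r" if "r < u" for r
        unfolding controlled_def
      proof (intro allI impI)
        fix v w assume "s \<le> v" "v \<le> w" "w \<le> r"
        with that have "?X v = ?X s" "?X w = ?X s" by (auto intro!: Xr)
        then show "\<bar>?X w - ?X v\<bar> \<le> 0 - 0" by simp
      qed
      with control_const show ?thesis by blast
    next
      case True
      let ?x = "(j, exit_count (path \<omega>) j s)"
      have cnt: "exit_count (path \<omega>) j r = exit_count (path \<omega>) j s" if "s \<le> r" "r \<le> u" for r
        using const[unfolded True] by (intro exit_count_stay[OF su(1) _ that]) blast
      have "ZJ Z r \<omega> = ?x" if "s \<le> r" "r < u" for r
        using const[OF that] cnt[of r] that True
        by (simp add: ZJ_eq_numbered[where Z = Z, OF Z_path[OF sp]] numbered_def)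
      from res_controlled_on_visit[OF \<omega> su this] obtain m'
        where m': "control m'" "\<And>r. r < u \<Longrightarrow> controlled (\<lambda>t. res ?x t \<omega>) m' s r" by blast
      have Xr: "?X r = ?X s + (res ?x r \<omega> - res ?x s \<omega>)" if "s \<le> r" "r \<le> u" for r
        using inc[OF that] True cnt[OF that] by (simp add: state_reserve_eq[OF sp])
      have "controlled ?X m' s r" if "r < u" for r
        unfolding controlled_def
      proof (intro allI impI)
        fix v w assume "s \<le> v" "v \<le> w" "w \<le> r"
        with that show "\<bar>?X w - ?X v\<bar> \<le> m' w - m' v"
          using controlledD[OF m'(2)[OF that], of v w] Xr[of v] Xr[of w] by simp
      qed
      with m'(1) show ?thesis by blast
    qed
    then obtain m' where "control m'" "\<And>r. r < u \<Longrightarrow> controlled ?X m' s r" by blast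
    from controlled_end_jump[OF this su(2)] obtain m'' where m'': "control m''" "controlled ?X m'' s u" by blast
    show ?case by (rule controlled_glue[OF m(1) m''(1) m(2) m''(2)]) (use su in auto)
  qed
qed

lemma total_gain_fv: "fv_process M (full_info M Z) (total_gain j)"
  unfolding fv_process_def
proof (intro conjI allI impI total_gain_measurable)
  show "AE \<omega> in M. cadlag (\<lambda>t. total_gain j t \<omega>) \<and> fv_on_compacts (\<lambda>t. total_gain j t \<omega>)"
    using AE_regular by eventually_elim (auto intro!: controlled_cadlag_fv total_gain_controlled)
qed

lemma total_gain_LS:
  assumes \<omega>: "regular \<omega>" and t: "0 \<le> t"
  shows "has_LS_integral (\<lambda>s. of_bool (left_val (path \<omega>) s = j)) (\<lambda>s. state_reserve M Z \<zeta> Y j s \<omega>) {0<..t} (total_gain j t \<omega>)"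
proof -
  have sp: "\<omega> \<in> space M" using \<omega> by (simp add: regular_def)
  obtain m where m: "control m" "controlled (\<lambda>t. total_gain j t \<omega>) m 0 t" using total_gain_controlled[OF \<omega> t] by blast
  show ?thesis
  proof (rule has_LS_integral_left_val[OF Z_path[OF sp] t m total_gain_0[OF \<omega>]])
    fix s u :: real assume su: "0 \<le> s" "s < u" "u \<le> t" and c: "\<And>r. s \<le> r \<Longrightarrow> r < u \<Longrightarrow> path \<omega> r = j"
    from total_gain_step[OF \<omega> su(1,2) c]
    show "total_gain j u \<omega> - total_gain j s \<omega> = state_reserve M Z \<zeta> Y j u \<omega> - state_reserve M Z \<zeta> Y j s \<omega>" by simp
  next
    fix s u :: real and k assume su: "0 \<le> s" "s < u" "u \<le> t" "k \<noteq> j" and c: "\<And>r. s \<le> r \<Longrightarrow> r < u \<Longrightarrow> path \<omega> r = k"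
    from total_gain_step[OF \<omega> su(1,2) c, of j] su(4)
    show "total_gain j u \<omega> = total_gain j s \<omega>" by simp
  qed
qed

end

section \<open>Existence and uniqueness\<close>

context reserve_model
begin

text \<open>
  Just after \<open>t\<close> the path stays in \<open>j\<close>, where the integral representation determines the increments.
\<close>

lemma right_cont_on_visit:
  assumes \<omega>: "\<omega> \<in> space M" and t: "0 \<le> t" "Z t \<omega> = j"
    and LS: "has_LS_integral (\<lambda>s. of_bool (left_val (path \<omega>) s = j)) F {0<..t + 1} y"
  shows "((\<lambda>s. of_bool (Z s \<omega> = j) * F s) \<longlongrightarrow> of_bool (Z t \<omega> = j) * F t) (at_right t)"
proof -
  obtain e where e: "t < e" "\<And>s. t \<le> s \<Longrightarrow> s < e \<Longrightarrow> path \<omega> s = path \<omega> t"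
    using pure_jump_right[OF Z_path[OF \<omega>] t(1)] by metis
  have Zj: "Z s \<omega> = j" if "t \<le> s" "s < e" for s using e(2)[OF that] t(2) by simp
  obtain d where d: "t < d" "d < min e (t + 1)" using dense[of t "min e (t + 1)"] e(1) by auto
  have "{t<..d} \<subseteq> {s \<in> {0<..t + 1}. of_bool (left_val (path \<omega>) s = j) \<noteq> (0::real)}"
  proof
    fix s assume s: "s \<in> {t<..d}"
    then have "left_val (path \<omega>) s = j" using d by (intro left_val_const[of t] Zj) auto
    with s d t(1) show "s \<in> {s \<in> {0<..t + 1}. of_bool (left_val (path \<omega>) s = j) \<noteq> (0::real)}" by auto
  qed
  from has_LS_integral_right_cont[OF LS this d(1)]
  have "(F \<longlongrightarrow> of_bool (Z t \<omega> = j) * F t) (at_right t)" using t(2) by simp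
  then show ?thesis
    by (rule tendsto_right_cong[OF e(1), rotated]) (simp add: Zj)
qed

lemma state_reserve_state_wise:
  assumes V: "\<And>t. 0 \<le> t \<Longrightarrow> AE \<omega> in M. V t \<omega> = real_cond_exp M (reduced_info M Z \<zeta> t) (Y t) \<omega>"
  shows "state_wise_prospective_reserves M Z \<zeta> V (state_reserve M Z \<zeta> Y)"
  unfolding state_wise_prospective_reserves_def
proof (intro allI conjI impI)
  fix j and t :: real
  show "state_reserve M Z \<zeta> Y j t \<in> borel_measurable M" if "0 \<le> t"
    by (rule state_reserve_measurable[OF that])
  show "AE \<omega> in M. of_bool (Z t \<omega> = j) * state_reserve M Z \<zeta> Y j t \<omega> = of_bool (Z t \<omega> = j) * V t \<omega>" if "0 \<le> t"
    by (rule state_reserve_version[where V = V, OF that V[OF that]])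
  show "(\<lambda>\<omega>. of_bool (left_val (path \<omega>) t = j) * state_reserve M Z \<zeta> Y j t \<omega>)
      \<in> borel_measurable (reduced_info_left M Z \<zeta> t)" if "0 < t"
    by (rule state_reserve_left_measurable[OF that])
next
  fix j
  have "AE \<omega> in M. \<forall>t\<ge>0. has_LS_integral (\<lambda>s. of_bool (left_val (path \<omega>) s = j))
      (\<lambda>s. state_reserve M Z \<zeta> Y j s \<omega>) {0<..t} (total_gain j t \<omega>)"
    using AE_regular by eventually_elim (auto intro: total_gain_LS)
  with total_gain_fv show "\<exists>X. fv_process M (full_info M Z) X \<and> (AE \<omega> in M. \<forall>t\<ge>0.
      has_LS_integral (\<lambda>s. of_bool (left_val (path \<omega>) s = j))
        (\<lambda>s. state_reserve M Z \<zeta> Y j s \<omega>) {0<..t} (X t \<omega>))"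
    by blast
qed

text \<open>
  Both sides agree with \<open>V\<close> at rational times while \<open>Z\<close> is in \<open>j\<close>, and both are right-continuous there.
\<close>

lemma state_wise_unique:
  assumes W: "state_wise_prospective_reserves M Z \<zeta> V W" and W': "state_wise_prospective_reserves M Z \<zeta> V W'"
  shows "AE \<omega> in M. \<forall>j. \<forall>t\<ge>0. of_bool (Z t \<omega> = j) * W j t \<omega> = of_bool (Z t \<omega> = j) * W' j t \<omega>"
proof -
  have rc: "AE \<omega> in M. \<forall>j. \<forall>t\<ge>0. Z t \<omega> = j \<longrightarrow>
      ((\<lambda>s. of_bool (Z s \<omega> = j) * W j s \<omega>) \<longlongrightarrow> of_bool (Z t \<omega> = j) * W j t \<omega>) (at_right t)"
    if W: "state_wise_prospective_reserves M Z \<zeta> V W" for W :: "'s \<Rightarrow> real \<Rightarrow> 'a \<Rightarrow> real"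
    unfolding AE_all_countable
  proof
    fix j
    obtain X where "AE \<omega> in M. \<forall>t\<ge>0. has_LS_integral (\<lambda>s. of_bool (left_val (path \<omega>) s = j))
        (\<lambda>s. W j s \<omega>) {0<..t} (X t \<omega>)"
      using W unfolding state_wise_prospective_reserves_def by blast
    with AE_space show "AE \<omega> in M. \<forall>t\<ge>0. Z t \<omega> = j \<longrightarrow>
      ((\<lambda>s. of_bool (Z s \<omega> = j) * W j s \<omega>) \<longlongrightarrow> of_bool (Z t \<omega> = j) * W j t \<omega>) (at_right t)"
    proof eventually_elim
      case (elim \<omega>)
      show ?case
      proof (intro allI impI)
        fix t :: real assume t: "0 \<le> t" "Z t \<omega> = j"
        have "0 \<le> t + 1" using t(1) by simp
        with elim(2) have "has_LS_integral (\<lambda>s. of_bool (left_val (path \<omega>) s = j)) (\<lambda>s. W j s \<omega>) {0<..t + 1} (X (t + 1) \<omega>)"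
          by blast
        then show "((\<lambda>s. of_bool (Z s \<omega> = j) * W j s \<omega>) \<longlongrightarrow> of_bool (Z t \<omega> = j) * W j t \<omega>) (at_right t)"
          by (rule right_cont_on_visit[OF elim(1) t])
      qed
    qed
  qed
  have rat: "AE \<omega> in M. \<forall>q\<in>\<rat>. \<forall>j. 0 \<le> q \<longrightarrow> of_bool (Z q \<omega> = j) * W j q \<omega> = of_bool (Z q \<omega> = j) * V q \<omega>"
    if W: "state_wise_prospective_reserves M Z \<zeta> V W" for W :: "'s \<Rightarrow> real \<Rightarrow> 'a \<Rightarrow> real"
  proof (intro AE_ball_countable' countable_rat)
    fix q :: real
    have "AE \<omega> in M. 0 \<le> q \<longrightarrow> of_bool (Z q \<omega> = j) * W j q \<omega> = of_bool (Z q \<omega> = j) * V q \<omega>" for j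
    proof (cases "0 \<le> q")
      case True
      with W have "AE \<omega> in M. of_bool (Z q \<omega> = j) * W j q \<omega> = of_bool (Z q \<omega> = j) * V q \<omega>"
        unfolding state_wise_prospective_reserves_def by blast
      then show ?thesis by eventually_elim simp
    qed simp
    then show "AE \<omega> in M. \<forall>j. 0 \<le> q \<longrightarrow> of_bool (Z q \<omega> = j) * W j q \<omega> = of_bool (Z q \<omega> = j) * V q \<omega>"
      unfolding AE_all_countable by blast
  qed
  from rc[OF W] rc[OF W'] rat[OF W] rat[OF W'] show ?thesis
  proof eventually_elim
    case (elim \<omega>)
    show ?case
    proof (intro allI impI)
      fix j and t :: real assume t: "0 \<le> t"
      show "of_bool (Z t \<omega> = j) * W j t \<omega> = of_bool (Z t \<omega> = j) * W' j t \<omega>"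
      proof (cases "Z t \<omega> = j")
        case True
        show ?thesis
        proof (rule right_cont_eq_on_rats[where f = "\<lambda>s. of_bool (Z s \<omega> = j) * W j s \<omega>"
              and g = "\<lambda>s. of_bool (Z s \<omega> = j) * W' j s \<omega>" and t = t])
          show "((\<lambda>s. of_bool (Z s \<omega> = j) * W j s \<omega>) \<longlongrightarrow> of_bool (Z t \<omega> = j) * W j t \<omega>) (at_right t)"
            using elim(1) t True by blast
          show "((\<lambda>s. of_bool (Z s \<omega> = j) * W' j s \<omega>) \<longlongrightarrow> of_bool (Z t \<omega> = j) * W' j t \<omega>) (at_right t)"
            using elim(2) t True by blast
          fix q :: real assume q: "q \<in> \<rat>" "t < q"
          then have "0 \<le> q" using t by simp
          with elim(3) q(1) have "of_bool (Z q \<omega> = j) * W j q \<omega> = of_bool (Z q \<omega> = j) * V q \<omega>" by blast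
          also from elim(4) q(1) \<open>0 \<le> q\<close> have "\<dots> = of_bool (Z q \<omega> = j) * W' j q \<omega>" by metis
          finally show "of_bool (Z q \<omega> = j) * W j q \<omega> = of_bool (Z q \<omega> = j) * W' j q \<omega>" .
        qed
      qed simp
    qed
  qed
qed

end

theorem theorem5p4:
  fixes M :: "'a measure"
    and Z :: "real \<Rightarrow> 'a \<Rightarrow> 's::countable"
    and \<zeta> :: "'s \<times> nat \<Rightarrow> 'a \<Rightarrow> 'e::polish_space"
    and b :: "'s \<Rightarrow> real \<Rightarrow> 'a \<Rightarrow> real"
    and c :: "'s \<Rightarrow> 's \<Rightarrow> real \<Rightarrow> 'a \<Rightarrow> real"
    and \<tau> :: "nat \<Rightarrow> real"
    and \<kappa> :: "real \<Rightarrow> real"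
    and Y V :: "real \<Rightarrow> 'a \<Rightarrow> real"
  assumes "prob_space M" and "complete_measure M"
    and Z_meas: "\<And>t. 0 \<le> t \<Longrightarrow> Z t \<in> measurable M (count_space UNIV)"
    and Z_path: "\<And>\<omega>. \<omega> \<in> space M \<Longrightarrow> pure_jump_path (\<lambda>t. Z t \<omega>)"
    and N_integrable: "\<And>t. 0 \<le> t \<Longrightarrow>
      (\<integral>\<^sup>+\<omega>. (\<Sum>\<^sub>\<infinity>(j, k)\<in>{(j, k). j \<noteq> k}. ennreal (real (jump_count Z j k t \<omega>))) \<partial>M) < \<infinity>"
    and \<zeta>_meas: "\<And>x. \<zeta> x \<in> borel_measurable M"
    and \<zeta>_info: "\<And>x. sets (sigma_info M (\<zeta> x)) \<subseteq> sets (sigma_history M Z x)"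
    and b: "\<And>j. predictable M (full_info M Z) (b j)" "\<And>j. bounded_process M (b j)"
    and c: "\<And>j k. j \<noteq> k \<Longrightarrow> predictable M (full_info M Z) (c j k)"
      "\<And>j k. j \<noteq> k \<Longrightarrow> bounded_process M (c j k)"
    and \<tau>: "0 \<le> \<tau> 0" "strict_mono \<tau>" "filterlim \<tau> at_top sequentially"
    and \<kappa>: "set_borel_measurable borel {0..} \<kappa>" "cadlag \<kappa>" "\<exists>e>0. \<forall>t\<ge>0. e \<le> \<kappa> t"
      "fv_on_compacts \<kappa>" "\<kappa> 0 = 1"
    and Y: "discounted_future_payments M \<kappa> (cumulative_payments Z \<tau> b c) Y"
      "finite_expected_variation M Y"
    and V: "prospective_reserve M Z \<zeta> Y V"
  shows "state_wise_prospective_reserves M Z \<zeta> V (state_reserve M Z \<zeta> Y) \<and>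
    (\<forall>W. state_wise_prospective_reserves M Z \<zeta> V W \<longrightarrow>
       (AE \<omega> in M. \<forall>j. \<forall>t\<ge>0.
          of_bool (Z t \<omega> = j) * W j t \<omega> = of_bool (Z t \<omega> = j) * state_reserve M Z \<zeta> Y j t \<omega>))"
proof -
  interpret prob_space M by fact
  interpret reserve_model M Z \<zeta> Y
  proof
    show "Z t \<in> measurable M (count_space UNIV)" if "0 \<le> t" for t by (rule Z_meas[OF that])
    show "pure_jump_path (\<lambda>t. Z t \<omega>)" if "\<omega> \<in> space M" for \<omega> by (rule Z_path[OF that])
    show "\<zeta> x \<in> borel_measurable M" for x by (rule \<zeta>_meas)
    show "sets (sigma_info M (\<zeta> x)) \<subseteq> sets (sigma_history M Z x)" for x by (rule \<zeta>_info)
    show "finite_expected_variation M Y" by (rule Y(2))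
    obtain e where e: "0 < e" "\<And>t. 0 \<le> t \<Longrightarrow> e \<le> \<kappa> t" using \<kappa>(3) by blast
    show "AE \<omega> in M. \<forall>t\<ge>0. ((\<lambda>s. Y s \<omega>) \<longlongrightarrow> Y t \<omega>) (at_right t)"
      using Y(1) unfolding discounted_future_payments_def
    proof eventually_elim
      case (elim \<omega>)
      then show ?case
        using discounted_payments_right_cont[OF \<kappa>(2) e, of "\<lambda>s. cumulative_payments Z \<tau> b c s \<omega>" "\<lambda>t. Y t \<omega>"] by blast
    qed
  qed
  have "state_wise_prospective_reserves M Z \<zeta> V (state_reserve M Z \<zeta> Y)"
    using V by (intro state_reserve_state_wise) (simp add: prospective_reserve_def)
  with state_wise_unique show ?thesis by blast
qed

end
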